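(* Let $\mathscr A/{\cong}$ be the set of isomorphism classes of infinite finitely generated abelian groups, partially ordered by $\rightsquigarrow$. The group of order-preserving bijections (automorphisms of the partially ordered set) of $(\mathscr A/{\cong},\rightsquigarrow)$ is the infinite symmetric group on a countable set, namely the group of all permutations of this set. If we identify this countable set with the set of prime numbers, then the action is as follows: a permutation $p\mapsto\sigma(p)$ of the primes acts as \[\mathbb Z^d\oplus\mathbb Z/p_1^{\nu_1}\mathbb Z\oplus\cdots\oplus\mathbb Z/p_k^{\nu_k}\mathbb Z\ \mapsto\ \mathbb Z^d\oplus\mathbb Z/\sigma(p_1)^{\nu_1}\mathbb Z\oplus\cdots\oplus\mathbb Z/\sigma(p_k)^{\nu_k}\mathbb Z,\] where $d\ge1$, $k\ge0$, the $p_i$ are (not necessarily distinct) primes and $\nu_i\ge1$.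
   Context: For finitely generated groups $G,H$, write $G\rightsquigarrow H$ ("$G$ preforms $H$") if there exist a finite generating set $T$ of $H$ and a sequence $S_1,S_2,\dots$ of finite generating sets of $G$, with bijections $S_n\to T$, such that for every $R\in\mathbb N$ and all $n$ large enough the balls of radius $R$ around the identity in the Cayley graphs of $(G,S_n)$ and $(H,T)$ are isomorphic as rooted graphs with edges labelled by generators, labels being identified via $S_n\to T$. On isomorphism classes of finitely generated abelian groups this relation is a partial order. *)

theory Defs
  imports "HOL-Algebra.Product_Groups" "HOL-Algebra.Bij" "HOL-Computational_Algebra.Primes"
begin

definition finite_generating_set :: "('a, 'm) monoid_scheme \<Rightarrow> 'a set \<Rightarrow> bool" where
  "finite_generating_set G S \<longleftrightarrow> finite S \<and> S \<subseteq> carrier G \<and> generate G S = carrier G"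

definition finitely_generated_group :: "('a, 'm) monoid_scheme \<Rightarrow> bool" where
  "finitely_generated_group G \<longleftrightarrow> group G \<and> (\<exists>S. finite_generating_set G S)"

text \<open>An edge \<open>(g, s, h)\<close> of the Cayley graph goes from \<open>g\<close> to \<open>h = g s\<close> and is labelled \<open>s\<close>.
  Generating sets are not assumed symmetric, so paths may traverse edges in either direction.\<close>

definition cayley_edges :: "('a, 'm) monoid_scheme \<Rightarrow> 'a set \<Rightarrow> ('a \<times> 'a \<times> 'a) set" where
  "cayley_edges G S = {(g, s, h). g \<in> carrier G \<and> s \<in> S \<and> h = g \<otimes>\<^bsub>G\<^esub> s}"

fun cayley_ball :: "('a, 'm) monoid_scheme \<Rightarrow> 'a set \<Rightarrow> nat \<Rightarrow> 'a set" where
  "cayley_ball G S 0 = {\<one>\<^bsub>G\<^esub>}"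
| "cayley_ball G S (Suc R) = cayley_ball G S R \<union>
     {h. \<exists>g \<in> cayley_ball G S R. \<exists>s.
        (g, s, h) \<in> cayley_edges G S \<or> (h, s, g) \<in> cayley_edges G S}"

text \<open>A ball is regarded as the subgraph induced on its vertices, rooted at the identity;
  the edge labels are identified by \<open>\<beta>\<close>.\<close>

definition cayley_balls_isomorphic ::
  "nat \<Rightarrow> ('a \<Rightarrow> 'b) \<Rightarrow> ('a, 'm) monoid_scheme \<Rightarrow> 'a set \<Rightarrow> ('b, 'n) monoid_scheme \<Rightarrow> 'b set \<Rightarrow> bool"
where
  "cayley_balls_isomorphic R \<beta> G S H T \<longleftrightarrow>
     (\<exists>\<phi>. bij_betw \<phi> (cayley_ball G S R) (cayley_ball H T R) \<and> \<phi> \<one>\<^bsub>G\<^esub> = \<one>\<^bsub>H\<^esub> \<and>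
        (\<forall>g \<in> cayley_ball G S R. \<forall>h \<in> cayley_ball G S R. \<forall>s \<in> S.
           (g, s, h) \<in> cayley_edges G S \<longleftrightarrow> (\<phi> g, \<beta> s, \<phi> h) \<in> cayley_edges H T))"

definition preforms :: "('a, 'm) monoid_scheme \<Rightarrow> ('b, 'n) monoid_scheme \<Rightarrow> bool"
    (infix \<open>\<leadsto>\<close> 50) where
  "G \<leadsto> H \<longleftrightarrow>
     (\<exists>(T :: 'b set) (S :: nat \<Rightarrow> 'a set) (\<beta> :: nat \<Rightarrow> 'a \<Rightarrow> 'b).
        finite_generating_set H T \<and>
        (\<forall>n. finite_generating_set G (S n) \<and> bij_betw (\<beta> n) (S n) T) \<and>
        (\<forall>R. \<exists>N. \<forall>n\<ge>N. cayley_balls_isomorphic R (\<beta> n) G (S n) H T))"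

text \<open>Finitely generated groups are countable, so each one is isomorphic to a group whose carrier
  is a set of natural numbers; hence type \<open>nat monoid\<close> realises every isomorphism class.\<close>

definition inf_fg_abelian :: "nat monoid set" where
  "inf_fg_abelian = {G. comm_group G \<and> finitely_generated_group G \<and> infinite (carrier G)}"

definition iso_classes :: "nat monoid set set" where
  "iso_classes = inf_fg_abelian // {(G, H). G \<in> inf_fg_abelian \<and> H \<in> inf_fg_abelian \<and> G \<cong> H}"

definition iso_class :: "('a, 'm) monoid_scheme \<Rightarrow> nat monoid set" where
  "iso_class G = {H \<in> inf_fg_abelian. G \<cong> H}"

definition preforms_class :: "nat monoid set \<Rightarrow> nat monoid set \<Rightarrow> bool" where
  "preforms_class C D \<longleftrightarrow> (\<exists>G\<in>C. \<exists>H\<in>D. G \<leadsto> H)"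

text \<open>As in \<^const>\<open>BijGroup\<close>, bijections of \<open>A\<close> are represented by functions extensional
  on \<open>A\<close>, and multiplication is composition.\<close>

definition order_aut_group :: "'a set \<Rightarrow> ('a \<Rightarrow> 'a \<Rightarrow> bool) \<Rightarrow> ('a \<Rightarrow> 'a) monoid" where
  "order_aut_group A r =
     (BijGroup A)\<lparr>carrier := {f \<in> Bij A. \<forall>x\<in>A. \<forall>y\<in>A. r x y \<longleftrightarrow> r (f x) (f y)}\<rparr>"

text \<open>The group \<open>\<int>\<^sup>d \<oplus> \<int>/p\<^sub>0\<^sup>\<nu>\<^sup>0 \<oplus> \<dots>\<close> with \<open>k\<close> torsion summands, indexed by \<open>i < k\<close>;
  values \<open>p i\<close> and \<open>\<nu> i\<close> for \<open>i \<ge> k\<close> are irrelevant.\<close>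

definition std_abelian_group ::
  "nat \<Rightarrow> nat \<Rightarrow> (nat \<Rightarrow> nat) \<Rightarrow> (nat \<Rightarrow> nat) \<Rightarrow> ((nat \<Rightarrow> int) \<times> (nat \<Rightarrow> int)) monoid" where
  "std_abelian_group d k p \<nu> =
     product_group {..<d} (\<lambda>_. integer_group) \<times>\<times>
     product_group {..<k} (\<lambda>i. integer_mod_group (p i ^ \<nu> i))"

end

theory Submission
  imports Defs "HOL-Algebra.FiniteProduct" "HOL-Library.Function_Algebras" "HOL-Library.Countable"
begin

text \<open>An infinite finitely generated abelian group \<open>G\<close> of rank \<open>d\<close> is determined by \<open>d\<close> and the numbers
  \<open>a\<^sub>q\<^sub>,\<^sub>j\<close> of cyclic \<open>q\<close>-primary summands of order at least \<open>q\<^sup>j\<^sup>+\<^sup>1\<close>. Here \<open>q\<close> to the power \<open>a\<^sub>q\<^sub>,\<^sub>j\<close>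
  counts the elements of order dividing \<open>q\<close> among the \<open>q\<^sup>j\<close>-th powers, and \<open>q\<close> to the power
  \<open>a\<^sub>q\<^sub>,\<^sub>j + d\<close> is the index of the \<open>q\<^sup>j\<^sup>+\<^sup>1\<close>-th powers in the \<open>q\<^sup>j\<close>-th powers. Along \<open>G \<leadsto> H\<close> the
  first number can only drop and the second can only grow, since both are visible in large balls;
  conversely these inequalities allow \<open>G\<close> to be written as a quotient of \<open>H\<close> by a subgroup avoiding
  any given ball. So with \<open>(e, b)\<close> the invariants of \<open>H\<close>, \<open>G \<leadsto> H\<close> means
  \<open>b \<le> a\<close> and \<open>a + d \<le> b + e\<close>, which is visibly invariant under permutations of the primes.
  An automorphism of this order preserves the rank. It fixes the groups \<open>\<int>\<^sup>d\<close>, the only ones with a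
  single upper cover, hence permutes the groups \<open>\<int>\<^sup>d \<oplus> \<int>/p\<close>, and the permutation of the primes does
  not depend on \<open>d\<close>. If that permutation is trivial, induction on the sum of all \<open>a\<^sub>q\<^sub>,\<^sub>j\<close>
  shows that the automorphism is the identity.\<close>

section \<open>Families of partitions indexed by primes, and the order on them\<close>

section \<open>The order on codes and its automorphisms\<close>


text \<open>Strict comparison raises the rank, so an automorphism is studied through the set
  \<open>code_covers a\<close> of codes that lie above \<open>(d, a)\<close> at rank
  \<open>Suc d\<close>. Besides smaller codes this set contains \<open>a\<close> itself. The smaller
  ones are known by induction; the one unknown member forces the induction to treat all ranks at
  once and to work with \<open>code_covers a - {a}\<close>. These sets separate codes of size at
  least two, but not the codes of the groups Z^d + Z/p, whose only proper cover is zero whatever p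
  is. That ambiguity is the sole freedom of an automorphism, whence the symmetric group.

  On the group side everything is expressed by integer exponent vectors: for tuples of generators,
  agreement of balls means that the same short vectors give trivial words. At each prime a code is
  the conjugate of the partition of exponents in the invariant factors. The inequalities between
  codes thereby become the interlacing divisibilities \<open>m i dvd m' i\<close> and
  \<open>m' (i + r) dvd m i\<close>, from which the approximating quotients are built.\<close>

text \<open>The entry \<open>a q j\<close> of a code stands for the number of cyclic summands of order at least
  \<open>q ^ Suc j\<close> in the \<open>q\<close>-primary torsion; the first component of a ranked code is the free rank.\<close>

definition codes :: "(nat \<Rightarrow> nat \<Rightarrow> nat) set" where
  "codes = {a. (\<forall>p j. a p (Suc j) \<le> a p j) \<and> finite {x. a (fst x) (snd x) \<noteq> 0} \<and>
               (\<forall>p j. a p j \<noteq> 0 \<longrightarrow> prime p)}"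

definition code_le :: "nat \<times> (nat \<Rightarrow> nat \<Rightarrow> nat) \<Rightarrow> nat \<times> (nat \<Rightarrow> nat \<Rightarrow> nat) \<Rightarrow> bool" where
  "code_le x y \<longleftrightarrow> fst x \<le> fst y \<and>
     (\<forall>p j. snd y p j \<le> snd x p j \<and> snd x p j + fst x \<le> snd y p j + fst y)"

definition ranked_codes :: "(nat \<times> (nat \<Rightarrow> nat \<Rightarrow> nat)) set" where
  "ranked_codes = {1..} \<times> codes"

definition code_size :: "(nat \<Rightarrow> nat \<Rightarrow> nat) \<Rightarrow> nat" where
  "code_size a = (\<Sum>x | a (fst x) (snd x) \<noteq> 0. a (fst x) (snd x))"

definition code_delta :: "nat \<Rightarrow> nat \<Rightarrow> nat \<Rightarrow> nat" where
  "code_delta p = (\<lambda>q j. if q = p \<and> j = 0 then 1 else 0)"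

text \<open>Precomposition reverses composites, which is why the action on groups later uses the
  inverse permutation. Values at non-primes are reset to 0 because nothing is assumed about
  \<open>\<tau>\<close> there.\<close>

definition code_perm :: "(nat \<Rightarrow> nat) \<Rightarrow> nat \<times> (nat \<Rightarrow> nat \<Rightarrow> nat) \<Rightarrow> nat \<times> (nat \<Rightarrow> nat \<Rightarrow> nat)" where
  "code_perm \<tau> x = (fst x, \<lambda>q j. if prime q then snd x (\<tau> q) j else 0)"

text \<open>For a code \<open>a\<close> and any \<open>d\<close> these are the codes above
  \<open>(d, a)\<close> at rank \<open>Suc d\<close>; \<open>a\<close> itself is among them.\<close>

definition code_covers :: "(nat \<Rightarrow> nat \<Rightarrow> nat) \<Rightarrow> (nat \<Rightarrow> nat \<Rightarrow> nat) set" where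
  "code_covers a = {b \<in> codes. \<forall>p j. b p j \<le> a p j \<and> a p j \<le> Suc (b p j)}"

lemma codes_antimono: "a \<in> codes \<Longrightarrow> i \<le> j \<Longrightarrow> a p j \<le> a p i"
  unfolding codes_def by (auto intro: lift_Suc_antimono_le[of "a p"])

lemma codes_finite: "a \<in> codes \<Longrightarrow> finite {x. a (fst x) (snd x) \<noteq> 0}"
  unfolding codes_def by auto

lemma codes_prime: "a \<in> codes \<Longrightarrow> a p j \<noteq> 0 \<Longrightarrow> prime p"
  unfolding codes_def by auto

lemma codes_nonprime: "a \<in> codes \<Longrightarrow> \<not> prime p \<Longrightarrow> a p j = 0"
  using codes_prime by blast

lemma codes_below:
  assumes "a \<in> codes" "\<And>p j. b p j \<le> a p j" "\<And>p j. b p (Suc j) \<le> b p j"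
  shows "b \<in> codes"
proof -
  have "finite {x. b (fst x) (snd x) \<noteq> 0}"
  proof (rule finite_subset[OF _ codes_finite[OF assms(1)]])
    show "{x. b (fst x) (snd x) \<noteq> 0} \<subseteq> {x. a (fst x) (snd x) \<noteq> 0}"
      using assms(2) by (auto intro: less_le_trans)
  qed
  moreover have "prime p" if "b p j \<noteq> 0" for p j
    using codes_prime[OF assms(1), of p j] assms(2)[of p j] that by auto
  ultimately show ?thesis using assms(3) by (auto simp: codes_def)
qed

lemma zero_in_codes [simp]: "(\<lambda>_ _. 0) \<in> codes"
  by (auto simp: codes_def)

lemma code_delta_in_codes: "prime p \<Longrightarrow> code_delta p \<in> codes"
proof -
  assume "prime p"
  moreover have "finite {x. code_delta p (fst x) (snd x) \<noteq> 0}"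
    by (rule finite_subset[of _ "{(p, 0)}"]) (auto simp: code_delta_def split: if_splits)
  ultimately show ?thesis by (auto simp: codes_def code_delta_def split: if_splits)
qed

lemma code_size_alt:
  assumes "finite F" "{x. a (fst x) (snd x) \<noteq> 0} \<subseteq> F"
  shows "code_size a = (\<Sum>x\<in>F. a (fst x) (snd x))"
  unfolding code_size_def using assms by (intro sum.mono_neutral_left) auto

lemma code_size_eq_imp:
  assumes "b \<in> codes" "\<And>p j. a p j \<le> b p j" "code_size b \<le> code_size a"
  shows "a = b"
proof (rule ccontr)
  assume "a \<noteq> b"
  then obtain p j where pj: "a p j \<noteq> b p j" by (meson ext)
  let ?F = "{x. b (fst x) (snd x) \<noteq> 0}"
  have lt: "a p j < b p j" using pj assms(2)[of p j] by simp
  have "code_size a = (\<Sum>x\<in>?F. a (fst x) (snd x))"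
    using codes_finite[OF assms(1)] assms(2) by (intro code_size_alt) (auto intro: less_le_trans)
  also have "\<dots> < code_size b" unfolding code_size_def
  proof (rule sum_strict_mono_ex1[OF codes_finite[OF assms(1)]])
    show "\<exists>x\<in>?F. a (fst x) (snd x) < b (fst x) (snd x)"
      using lt by (intro bexI[of _ "(p, j)"]) auto
  qed (use assms(2) in auto)
  finally show False using assms(3) by simp
qed

lemma code_size_less:
  assumes "b \<in> codes" "\<And>p j. a p j \<le> b p j" "a \<noteq> b"
  shows "code_size a < code_size b"
  using code_size_eq_imp[OF assms(1,2)] assms(3) by fastforce

section \<open>Removable corners of the Young diagrams \<open>a p\<close>, and codes recovered from
  their covers\<close>

definition corner :: "(nat \<Rightarrow> nat \<Rightarrow> nat) \<Rightarrow> nat \<Rightarrow> nat \<Rightarrow> bool" where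
  "corner a p j \<longleftrightarrow> a p (Suc j) < a p j"

definition remove_corner :: "(nat \<Rightarrow> nat \<Rightarrow> nat) \<Rightarrow> nat \<Rightarrow> nat \<Rightarrow> nat \<Rightarrow> nat \<Rightarrow> nat" where
  "remove_corner a p j = (\<lambda>q i. if q = p \<and> i = j then a q i - 1 else a q i)"

text \<open>Finite support forces the row \<open>a p\<close> to drop below \<open>a p j\<close>
  eventually; up to the first drop it is constant.\<close>

lemma corner_exists:
  assumes "a \<in> codes" "a p j \<noteq> 0"
  obtains i where "i \<ge> j" "corner a p i" "a p i = a p j"
proof -
  have "\<exists>i\<ge>j. a p (Suc i) < a p j"
  proof (rule ccontr)
    assume "\<not> ?thesis"
    then have ge: "a p (Suc i) \<ge> a p j" if "i \<ge> j" for i using that by (meson not_le)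
    have "(\<lambda>i. (p, Suc i)) ` {j..} \<subseteq> {x. a (fst x) (snd x) \<noteq> 0}"
      using ge assms(2) by fastforce
    moreover have "infinite ((\<lambda>i. (p, Suc i)) ` {j..})"
      by (subst finite_image_iff) (auto simp: inj_on_def infinite_Ici)
    ultimately show False using codes_finite[OF assms(1)] finite_subset by blast
  qed
  then obtain i where i: "i \<ge> j" "a p (Suc i) < a p j"
    and min: "\<And>k. k \<ge> j \<Longrightarrow> a p (Suc k) < a p j \<Longrightarrow> i \<le> k"
    using exists_least_iff[of "\<lambda>i. i \<ge> j \<and> a p (Suc i) < a p j"] by (metis not_le)
  have "a p i = a p j"
  proof (cases "i = j")
    case False
    then obtain k where k: "i = Suc k" "k \<ge> j" using i(1) by (metis le_SucE not0_implies_Suc le_zero_eq)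
    have "\<not> a p i < a p j" using min[of k] k by auto
    then show ?thesis using codes_antimono[OF assms(1) i(1), of p] by simp
  qed simp
  then show ?thesis using that i by (auto simp: corner_def)
qed

lemma remove_corner_in_covers:
  assumes "a \<in> codes" "corner a p j"
  shows "remove_corner a p j \<in> code_covers a" "remove_corner a p j \<noteq> a"
proof -
  have "remove_corner a p j q (Suc i) \<le> remove_corner a p j q i" for q i
    using assms codes_antimono[OF assms(1), of i "Suc i" q] by (auto simp: remove_corner_def corner_def)
  then have "remove_corner a p j \<in> codes"
    by (intro codes_below[OF assms(1)]) (auto simp: remove_corner_def)
  then show "remove_corner a p j \<in> code_covers a"
    by (auto simp: code_covers_def remove_corner_def)
  show "remove_corner a p j \<noteq> a"
    using assms(2) by (auto simp: remove_corner_def corner_def fun_eq_iff intro!: exI[of _ p] exI[of _ j])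
qed

text \<open>This is the least element of \<open>code_covers a\<close>, since every cover satisfies
  \<open>a p j \<le> Suc (b p j)\<close>.\<close>

lemma code_pred_in_covers:
  assumes "a \<in> codes"
  shows "(\<lambda>p j. a p j - 1) \<in> code_covers a"
proof -
  have "(\<lambda>p j. a p j - 1) \<in> codes"
    using codes_antimono[OF assms] by (intro codes_below[OF assms]) (auto intro!: diff_le_mono)
  then show ?thesis by (auto simp: code_covers_def)
qed

lemma self_in_covers: "a \<in> codes \<Longrightarrow> a \<in> code_covers a"
  by (auto simp: code_covers_def)

text \<open>Every nonzero entry leads along its row to a corner with the same value. If there is
  only one corner, the diagram is a rectangle in row \<open>p\<close>.\<close>

lemma single_corner_shape:
  assumes "a \<in> codes" "corner a p i" "\<And>q j. corner a q j \<Longrightarrow> q = p \<and> j = i"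
  shows "a q j = (if q = p \<and> j \<le> i then a p i else 0)"
proof (cases "a q j = 0")
  case False
  obtain k where "k \<ge> j" "corner a q k" "a q k = a q j" using corner_exists[OF assms(1) False] .
  then show ?thesis using assms(3)[of q k] by auto
next
  case True
  have "a p i > 0" using assms(2) by (auto simp: corner_def)
  then show ?thesis using True codes_antimono[OF assms(1), of j i p] by auto
qed

text \<open>Removing a corner lowers a single entry, so the pointwise maximum of two different
  removals is \<open>a\<close> again, and \<open>b\<close> dominates both.\<close>

lemma two_corners_le:
  assumes "a \<in> codes" "code_covers a - {a} \<subseteq> code_covers b"
    and "corner a p i" "corner a q j" "(p, i) \<noteq> (q, j)"
  shows "a r k \<le> b r k"
proof -
  have "remove_corner a p i \<in> code_covers b" "remove_corner a q j \<in> code_covers b"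
    using remove_corner_in_covers[OF assms(1)] assms by blast+
  then have "remove_corner a p i r k \<le> b r k" "remove_corner a q j r k \<le> b r k"
    by (auto simp: code_covers_def)
  then show ?thesis using assms(5) by (auto simp: remove_corner_def split: if_splits)
qed

lemma code_size_remove_corner:
  assumes "a \<in> codes" "corner a p i"
  shows "Suc (code_size (remove_corner a p i)) = code_size a"
proof -
  let ?F = "{x. a (fst x) (snd x) \<noteq> 0}"
  have pi: "(p, i) \<in> ?F" using assms(2) by (auto simp: corner_def)
  have fin: "finite ?F" by (rule codes_finite[OF assms(1)])
  have "code_size (remove_corner a p i) = (\<Sum>x\<in>?F. remove_corner a p i (fst x) (snd x))"
    using fin by (intro code_size_alt) (auto simp: remove_corner_def split: if_splits)
  also have "\<dots> = remove_corner a p i p i + (\<Sum>x\<in>?F - {(p, i)}. remove_corner a p i (fst x) (snd x))"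
    by (subst sum.remove[OF fin pi]) simp
  also have "(\<Sum>x\<in>?F - {(p, i)}. remove_corner a p i (fst x) (snd x)) = (\<Sum>x\<in>?F - {(p, i)}. a (fst x) (snd x))"
    by (intro sum.cong) (auto simp: remove_corner_def)
  finally show ?thesis
    unfolding code_size_def using sum.remove[OF fin pi, of "\<lambda>x. a (fst x) (snd x)"] pi
    by (simp add: remove_corner_def)
qed

text \<open>A cover of a rectangle that keeps the corner entry keeps all entries by monotonicity of
  the row. So removing the corner gives the largest proper cover.\<close>

lemma single_corner_cover_le:
  assumes "a \<in> codes" "corner a p i" "\<And>q j. corner a q j \<Longrightarrow> q = p \<and> j = i"
    and "b \<in> code_covers a" "b \<noteq> a"
  shows "b q j \<le> remove_corner a p i q j"
proof -
  have b: "b \<in> codes" "\<And>q j. b q j \<le> a q j" using assms(4) by (auto simp: code_covers_def)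
  note shape = single_corner_shape[OF assms(1-3)]
  have "b p i < a p i"
  proof (rule ccontr)
    assume "\<not> b p i < a p i"
    then have "b p i = a p i" using b(2)[of p i] by simp
    then have "b q j = a q j" for q j
      using shape[of q j] b(2)[of q j] codes_antimono[OF b(1), of j i p] by (auto split: if_splits)
    then show False using assms(5) by (simp add: fun_eq_iff)
  qed
  then show ?thesis using b(2)[of q j] by (auto simp: remove_corner_def)
qed

lemma nonzero_corner:
  assumes "a \<in> codes" "a \<noteq> (\<lambda>_ _. 0)"
  obtains p i where "corner a p i"
proof -
  obtain p j where "a p j \<noteq> 0" using assms(2) by (auto simp: fun_eq_iff)
  then show ?thesis using corner_exists[OF assms(1)] that by metis
qed

lemma code_size_le_1:
  assumes "a \<in> codes" "code_size a < 2" "a \<noteq> (\<lambda>_ _. 0)"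
  obtains p where "prime p" "a = code_delta p"
proof -
  obtain p j where "a p j \<noteq> 0" using assms(3) by (auto simp: fun_eq_iff)
  then have p0: "a p 0 \<noteq> 0" using codes_antimono[OF assms(1), of 0 j p] by simp
  have pr: "prime p" using codes_prime[OF assms(1) p0] .
  have le: "code_delta p q j \<le> a q j" for q j using p0 by (auto simp: code_delta_def)
  have "code_size (code_delta p) = 1"
    by (subst code_size_alt[of "{(p, 0)}"]) (auto simp: code_delta_def split: if_splits)
  then have "code_delta p = a" using assms(2) by (intro code_size_eq_imp[OF assms(1) le]) simp
  then show ?thesis using that pr by auto
qed

text \<open>A code of size at least two is determined by its proper covers: it is their join if it has
  two corners; otherwise it is a rectangle, and the proper covers have a largest and
  a smallest element that determine it.\<close>

lemma two_corners_determined: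
  assumes a: "a \<in> codes" "code_size a \<noteq> 0" and b: "b \<in> codes" "b \<noteq> (\<lambda>_ _. 0)"
    and eq: "code_covers a - {a} = code_covers b - {b}"
    and two: "corner a p i" "corner a q j" "(p, i) \<noteq> (q, j)"
  shows "a = b"
proof -
  have le: "a r k \<le> b r k" for r k using two_corners_le[OF a(1) _ two] eq by blast
  \<comment> \<open>A corner of \<open>b\<close> yields a common proper cover of size one less than
    that of \<open>b\<close>; it is strictly smaller than \<open>a\<close>, which bounds the size of
    \<open>b\<close> by that of \<open>a\<close>.\<close>
  obtain s l where c: "corner b s l" using nonzero_corner[OF b] .
  have "remove_corner b s l \<in> code_covers a" "remove_corner b s l \<noteq> a"
    using remove_corner_in_covers[OF b(1) c] eq by blast+
  then have "code_size (remove_corner b s l) < code_size a"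
    by (intro code_size_less[OF a(1)]) (auto simp: code_covers_def)
  then have "code_size b \<le> code_size a" using code_size_remove_corner[OF b(1) c] by simp
  then show ?thesis using code_size_eq_imp[OF b(1) le] by simp
qed

lemma one_corner_determined:
  assumes a: "a \<in> codes" "code_size a \<ge> 2" and b: "b \<in> codes" "code_size b \<ge> 2"
    and eq: "code_covers a - {a} = code_covers b - {b}"
    and ca: "corner a p i" "\<And>q j. corner a q j \<Longrightarrow> q = p \<and> j = i"
    and cb: "corner b s l" "\<And>q j. corner b q j \<Longrightarrow> q = s \<and> j = l"
  shows "a = b"
proof -
  have ne: "a \<noteq> (\<lambda>_ _. 0)" "b \<noteq> (\<lambda>_ _. 0)" using a b by (auto simp: code_size_def)
  have top: "remove_corner a p i = remove_corner b s l"
  proof (intro ext antisym)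
    fix q j
    show "remove_corner a p i q j \<le> remove_corner b s l q j"
      using remove_corner_in_covers[OF a(1) ca(1)] eq
      by (intro single_corner_cover_le[OF b(1) cb]) auto
    show "remove_corner b s l q j \<le> remove_corner a p i q j"
      using remove_corner_in_covers[OF b(1) cb(1)] eq
      by (intro single_corner_cover_le[OF a(1) ca]) auto
  qed
  have pred: "(\<lambda>p j. a p j - 1) \<noteq> a" "(\<lambda>p j. b p j - 1) \<noteq> b"
    using ca(1) cb(1) unfolding corner_def fun_eq_iff by (metis diff_less less_one not_less_zero neq0_conv less_irrefl)+
  \<comment> \<open>The least cover of each code is a proper cover, hence also a cover of the other
    code.\<close>
  have bot: "a q j - 1 = b q j - 1" for q j
  proof (rule antisym)
    have "(\<lambda>p j. b p j - 1) \<in> code_covers a" "(\<lambda>p j. a p j - 1) \<in> code_covers b"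
      using code_pred_in_covers a(1) b(1) pred eq by blast+
    then have "a q j \<le> Suc (b q j - 1)" "b q j \<le> Suc (a q j - 1)" by (auto simp: code_covers_def)
    then show "a q j - 1 \<le> b q j - 1" "b q j - 1 \<le> a q j - 1" by auto
  qed
  have "(p, i) = (s, l)"
  proof (rule ccontr)
    \<comment> \<open>Different corners, equal largest proper covers and equal least covers force
      both rectangles to have height one. Two rows of ones that agree after losing their last entry
      are then equal, a contradiction.\<close>
    assume neq: "(p, i) \<noteq> (s, l)"
    have "remove_corner a p i p i = remove_corner b s l p i" using top by simp
    then have "a p i - 1 = b p i" using neq by (auto simp: remove_corner_def split: if_splits)
    moreover have "a p i > 0" using ca(1) by (simp add: corner_def)
    ultimately have one: "a p i = 1" using bot[of p i] by auto
    have shape: "a q j = (if q = p \<and> j \<le> i then 1 else 0)" for q j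
      unfolding one[symmetric] by (rule single_corner_shape[OF a(1) ca])
    have shapeb: "b q j = (if q = s \<and> j \<le> l then b s l else 0)" for q j
      by (rule single_corner_shape[OF b(1) cb])
    \<comment> \<open>Size at least two enters here: a rectangle of height and length one is a
      \<open>code_delta\<close>.\<close>
    have "i \<noteq> 0"
    proof
      assume "i = 0"
      then have "code_size a = (\<Sum>x\<in>{(p, 0)}. a (fst x) (snd x))"
        using shape by (intro code_size_alt) (auto split: if_splits)
      then show False using a(2) one \<open>i = 0\<close> by simp
    qed
    then have "remove_corner b s l p 0 = 1"
      using top[symmetric] shape[of p 0] one by (simp add: remove_corner_def)
    then have "b p 0 \<noteq> 0" by (auto simp: remove_corner_def split: if_splits)
    then have ps: "p = s" using shapeb[of p 0] by (auto split: if_splits)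
    have "remove_corner a p i s l = remove_corner b s l s l" using top by simp
    then have "b s l - 1 = a s l" using neq by (auto simp: remove_corner_def split: if_splits)
    moreover have bsl: "b s l > 0" using cb(1) by (simp add: corner_def)
    ultimately have "b s l = 1 \<and> a s l = 0" using bot[of s l] by auto
    then have "i < l" using shape[of s l] ps one by (auto split: if_splits)
    then have "b p i \<noteq> 0" using shapeb[of p i] ps bsl by simp
    then show False using \<open>a p i - 1 = b p i\<close> one by simp
  qed
  then show ?thesis
    using top ca(1) cb(1) unfolding fun_eq_iff remove_corner_def corner_def
    by (metis One_nat_def Suc_pred gr_implies_not0 neq0_conv prod.inject)
qed

lemma code_determined_by_covers:
  assumes a: "a \<in> codes" "code_size a \<ge> 2" and b: "b \<in> codes" "code_size b \<ge> 2"
    and eq: "code_covers a - {a} = code_covers b - {b}"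
  shows "a = b"
proof -
  have ne: "a \<noteq> (\<lambda>_ _. 0)" "b \<noteq> (\<lambda>_ _. 0)" using a b by (auto simp: code_size_def)
  obtain p i where ca: "corner a p i" using nonzero_corner[OF a(1) ne(1)] .
  obtain s l where cb: "corner b s l" using nonzero_corner[OF b(1) ne(2)] .
  show ?thesis
  proof (cases "\<exists>q j. corner a q j \<and> (q, j) \<noteq> (p, i)")
    case True
    then show ?thesis using two_corners_determined[OF a(1) _ b(1) ne(2) eq _ ca] a(2) by fastforce
  next
    case onea: False
    show ?thesis
    proof (cases "\<exists>q j. corner b q j \<and> (q, j) \<noteq> (s, l)")
      case True
      then show ?thesis
        using two_corners_determined[OF b(1) _ a(1) ne(1) eq[symmetric] _ cb] b(2) by fastforce
    next
      case False
      show ?thesis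
      proof (rule one_corner_determined[OF a b eq ca _ cb])
        show "q = p \<and> j = i" if "corner a q j" for q j using that onea by blast
        show "q = s \<and> j = l" if "corner b q j" for q j using that False by blast
      qed
    qed
  qed
qed

section \<open>Comparison of consecutive ranks, and the action of prime permutations\<close>

lemma code_le_Suc:
  "a \<in> codes \<Longrightarrow> b \<in> codes \<Longrightarrow> code_le (d, a) (Suc d, b) \<longleftrightarrow> b \<in> code_covers a"
  by (auto simp: code_le_def code_covers_def)

lemma code_le_antisym_fst: "code_le x y \<Longrightarrow> fst x = fst y \<Longrightarrow> x = y"
  by (cases x; cases y) (auto simp: code_le_def fun_eq_iff intro: antisym)

lemma code_perm_in: 
  assumes "bij_betw \<tau> {p. prime p} {p. prime p}" "x \<in> ranked_codes"
  shows "code_perm \<tau> x \<in> ranked_codes"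
proof -
  obtain d a where x: "x = (d, a)" "d \<ge> 1" "a \<in> codes" using assms(2) by (auto simp: ranked_codes_def)
  let ?b = "\<lambda>q j. if prime q then a (\<tau> q) j else 0"
  have "finite {x. ?b (fst x) (snd x) \<noteq> 0}"
  proof (rule finite_subset)
    show "{x. ?b (fst x) (snd x) \<noteq> 0} \<subseteq>
        (\<lambda>x. (inv_into {p. prime p} \<tau> (fst x), snd x)) ` {x. a (fst x) (snd x) \<noteq> 0}"
    proof
      fix y assume "y \<in> {x. ?b (fst x) (snd x) \<noteq> 0}"
      then have y: "prime (fst y)" "a (\<tau> (fst y)) (snd y) \<noteq> 0" by (auto split: if_splits)
      have "inv_into {p. prime p} \<tau> (\<tau> (fst y)) = fst y"
        using assms(1) y(1) by (intro inv_into_f_f) (auto simp: bij_betw_def)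
      then show "y \<in> (\<lambda>x. (inv_into {p. prime p} \<tau> (fst x), snd x)) ` {x. a (fst x) (snd x) \<noteq> 0}"
        using y(2) by (intro image_eqI[of _ _ "(\<tau> (fst y), snd y)"]) auto
    qed
  qed (use codes_finite[OF x(3)] in simp)
  then have "?b \<in> codes" using x(3) unfolding codes_def by auto
  then show ?thesis using x(2) by (simp add: x(1) code_perm_def ranked_codes_def cong: if_cong)
qed

lemma code_perm_comp:
  assumes "\<And>p. prime p \<Longrightarrow> prime (\<tau> p)"
  shows "code_perm \<tau> (code_perm \<rho> x) = code_perm (\<rho> \<circ> \<tau>) x"
  using assms by (auto simp: code_perm_def fun_eq_iff)

lemma code_perm_cong:
  "(\<And>p. prime p \<Longrightarrow> \<tau> p = \<rho> p) \<Longrightarrow> code_perm \<tau> x = code_perm \<rho> x"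
  by (auto simp: code_perm_def fun_eq_iff)

lemma code_perm_ident:
  assumes "x \<in> ranked_codes" "\<And>p. prime p \<Longrightarrow> \<tau> p = p"
  shows "code_perm \<tau> x = x"
proof -
  have "(if prime q then snd x (\<tau> q) j else 0) = snd x q j" for q j
    using assms codes_prime[of "snd x" q j] by (cases "prime q"; cases "snd x q j = 0") (auto simp: ranked_codes_def)
  then show ?thesis by (simp add: code_perm_def)
qed

lemma code_perm_le_iff:
  assumes "bij_betw \<tau> {p. prime p} {p. prime p}" "x \<in> ranked_codes" "y \<in> ranked_codes"
  shows "code_le (code_perm \<tau> x) (code_perm \<tau> y) \<longleftrightarrow> code_le x y"
proof
  assume "code_le x y"
  then have le: "fst x \<le> fst y" "snd y p j \<le> snd x p j" "snd x p j + fst x \<le> snd y p j + fst y" for p j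
    unfolding code_le_def by blast+
  show "code_le (code_perm \<tau> x) (code_perm \<tau> y)"
    unfolding code_le_def
  proof (intro conjI allI)
    show "fst (code_perm \<tau> x) \<le> fst (code_perm \<tau> y)"
      using le(1) by (simp add: code_perm_def)
    fix p j
    show "snd (code_perm \<tau> y) p j \<le> snd (code_perm \<tau> x) p j"
      using le(2)[of "\<tau> p" j] by (cases "prime p") (simp_all add: code_perm_def)
    show "snd (code_perm \<tau> x) p j + fst (code_perm \<tau> x) \<le> snd (code_perm \<tau> y) p j + fst (code_perm \<tau> y)"
      using le(1) le(3)[of "\<tau> p" j] by (cases "prime p") (simp_all add: code_perm_def)
  qed
next
  assume l: "code_le (code_perm \<tau> x) (code_perm \<tau> y)"
  have "snd y p j \<le> snd x p j \<and> snd x p j + fst x \<le> snd y p j + fst y" for p j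
  proof (cases "prime p")
    case True
    then have "p \<in> \<tau> ` {p. prime p}" using assms(1) by (simp add: bij_betw_def)
    then obtain q where "prime q" "\<tau> q = p" by auto
    moreover have "snd (code_perm \<tau> y) q j \<le> snd (code_perm \<tau> x) q j \<and>
        snd (code_perm \<tau> x) q j + fst (code_perm \<tau> x) \<le> snd (code_perm \<tau> y) q j + fst (code_perm \<tau> y)"
      using l unfolding code_le_def by blast
    ultimately show ?thesis by (simp add: code_perm_def)
  next
    case False
    then have "snd x p j = 0" "snd y p j = 0"
      using codes_nonprime assms(2,3) by (auto simp: ranked_codes_def)
    moreover have "fst x \<le> fst y" using l unfolding code_le_def code_perm_def by (elim conjE) simp
    ultimately show ?thesis by simp
  qed
  moreover have "fst x \<le> fst y" using l unfolding code_le_def code_perm_def by (elim conjE) simp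
  ultimately show "code_le x y" unfolding code_le_def by blast
qed

lemma bij_code_perm:
  assumes "bij_betw \<tau> {p. prime p} {p. prime p}"
  shows "bij_betw (code_perm \<tau>) ranked_codes ranked_codes"
proof (rule bij_betwI)
  let ?r = "inv_into {p. prime p} \<tau>"
  have r: "bij_betw ?r {p. prime p} {p. prime p}" by (rule bij_betw_inv_into[OF assms])
  show "code_perm \<tau> \<in> ranked_codes \<rightarrow> ranked_codes" "code_perm ?r \<in> ranked_codes \<rightarrow> ranked_codes"
    using code_perm_in[OF assms] code_perm_in[OF r] by auto
  fix x assume x: "x \<in> ranked_codes"
  have p: "\<And>p. prime p \<Longrightarrow> prime (\<tau> p)" "\<And>p. prime p \<Longrightarrow> prime (?r p)"
    using assms r by (auto simp: bij_betw_def)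
  show "code_perm ?r (code_perm \<tau> x) = x"
    by (subst code_perm_comp[OF p(2)], assumption, rule code_perm_ident[OF x]) (simp add: bij_betw_inv_into_right[OF assms])
  show "code_perm \<tau> (code_perm ?r x) = x"
    by (subst code_perm_comp[OF p(1)], assumption, rule code_perm_ident[OF x]) (simp add: bij_betw_inv_into_left[OF assms])
qed

section \<open>Classification of the order automorphisms of ranked codes\<close>

locale code_automorphism =
  fixes f :: "nat \<times> (nat \<Rightarrow> nat \<Rightarrow> nat) \<Rightarrow> nat \<times> (nat \<Rightarrow> nat \<Rightarrow> nat)"
  assumes bij: "bij_betw f ranked_codes ranked_codes"
    and le_iff: "\<And>x y. x \<in> ranked_codes \<Longrightarrow> y \<in> ranked_codes \<Longrightarrow> code_le (f x) (f y) \<longleftrightarrow> code_le x y"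
begin

lemma closed: "x \<in> ranked_codes \<Longrightarrow> f x \<in> ranked_codes"
  using bij by (auto simp: bij_betw_def)

lemma inj: "x \<in> ranked_codes \<Longrightarrow> y \<in> ranked_codes \<Longrightarrow> f x = f y \<longleftrightarrow> x = y"
  using bij by (auto simp: bij_betw_def inj_on_def)

text \<open>The elements \<open>(1, a)\<close>, ..., \<open>(d, a)\<close> form a strict chain, and
  strict comparison strictly raises the rank, so the image of the last one has rank at least
  \<open>d\<close>. Applied to the inverse as well, this gives equality.\<close>

lemma rank_le: "(d, a) \<in> ranked_codes \<Longrightarrow> d \<le> fst (f (d, a))"
proof (induction d)
  case (Suc d)
  show ?case
  proof (cases "d = 0")
    case True
    then show ?thesis using closed[OF Suc.prems] by (auto simp: ranked_codes_def mem_Times_iff)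
  next
    case False
    then have x: "(d, a) \<in> ranked_codes" using Suc.prems by (auto simp: ranked_codes_def)
    have "code_le (d, a) (Suc d, a)" by (auto simp: code_le_def)
    then have le: "code_le (f (d, a)) (f (Suc d, a))" using le_iff x Suc.prems by blast
    have "f (d, a) \<noteq> f (Suc d, a)" using inj[OF x Suc.prems] by simp
    then have "fst (f (d, a)) < fst (f (Suc d, a))"
      using le code_le_antisym_fst[OF le] by (fastforce simp: code_le_def)
    then show ?thesis using Suc.IH[OF x] by simp
  qed
qed simp

lemma inverse: "code_automorphism (inv_into ranked_codes f)"
proof
  show "bij_betw (inv_into ranked_codes f) ranked_codes ranked_codes"
    by (rule bij_betw_inv_into[OF bij])
  fix x y assume xy: "x \<in> ranked_codes" "y \<in> ranked_codes"
  then have "inv_into ranked_codes f x \<in> ranked_codes" "inv_into ranked_codes f y \<in> ranked_codes"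
    using bij by (auto simp: bij_betw_def intro!: inv_into_into)
  from le_iff[OF this]
  show "code_le (inv_into ranked_codes f x) (inv_into ranked_codes f y) \<longleftrightarrow> code_le x y"
    using xy bij_betw_inv_into_right[OF bij] by simp
qed

lemma rank_eq: "x \<in> ranked_codes \<Longrightarrow> fst (f x) = fst x"
  using rank_le[of "fst x" "snd x"] code_automorphism.rank_le[OF inverse, of "fst (f x)" "snd (f x)"]
    closed[of x] bij_betw_inv_into_left[OF bij, of x]
  by fastforce

text \<open>The action of \<open>f\<close> on rank \<open>d\<close>; a priori the same code may be
  moved differently at different ranks.\<close>

definition lev :: "nat \<Rightarrow> (nat \<Rightarrow> nat \<Rightarrow> nat) \<Rightarrow> (nat \<Rightarrow> nat \<Rightarrow> nat)" where
  "lev d a = snd (f (d, a))"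

lemma f_eq: "d \<ge> 1 \<Longrightarrow> a \<in> codes \<Longrightarrow> f (d, a) = (d, lev d a)"
  using rank_eq[of "(d, a)"] by (auto simp: lev_def ranked_codes_def prod_eq_iff)

lemma lev_closed: "d \<ge> 1 \<Longrightarrow> a \<in> codes \<Longrightarrow> lev d a \<in> codes"
  using closed[of "(d, a)"] by (auto simp: lev_def ranked_codes_def mem_Times_iff)

lemma lev_inj: "d \<ge> 1 \<Longrightarrow> a \<in> codes \<Longrightarrow> b \<in> codes \<Longrightarrow> lev d a = lev d b \<longleftrightarrow> a = b"
  using inj[of "(d, a)" "(d, b)"] f_eq[of d a] f_eq[of d b] by (auto simp: ranked_codes_def)

lemma lev_surj:
  assumes "d \<ge> 1" "b \<in> codes"
  obtains a where "a \<in> codes" "lev d a = b"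
proof -
  have "(d, b) \<in> f ` ranked_codes" using bij assms by (auto simp: bij_betw_def ranked_codes_def)
  then obtain e a where "(e, a) \<in> ranked_codes" "f (e, a) = (d, b)" by auto
  then show ?thesis using that f_eq[of e a] by (auto simp: ranked_codes_def)
qed

text \<open>Between ranks \<open>d\<close> and \<open>Suc d\<close> the order is exactly the
  covering relation, and \<open>f\<close> maps each rank onto itself. This ties \<open>lev d\<close>
  to \<open>lev (Suc d)\<close>.\<close>

lemma lev_covers:
  assumes "d \<ge> 1" "a \<in> codes"
  shows "code_covers (lev d a) = lev (Suc d) ` code_covers a"
proof -
  have iff: "lev (Suc d) b \<in> code_covers (lev d a) \<longleftrightarrow> b \<in> code_covers a" if "b \<in> codes" for b
    using le_iff[of "(d, a)" "(Suc d, b)"] assms that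
    by (simp add: f_eq ranked_codes_def code_le_Suc lev_closed)
  have "c \<in> lev (Suc d) ` code_covers a" if c: "c \<in> code_covers (lev d a)" for c
  proof -
    have "c \<in> codes" using c by (simp add: code_covers_def)
    then obtain b where "b \<in> codes" "lev (Suc d) b = c" using lev_surj[of "Suc d" c] by auto
    then show ?thesis using iff c by blast
  qed
  moreover have "lev (Suc d) b \<in> code_covers (lev d a)" if "b \<in> code_covers a" for b
    using iff that by (auto simp: code_covers_def)
  ultimately show ?thesis by blast
qed

lemma covers_zero: "code_covers (\<lambda>_ _. 0) = {\<lambda>_ _. 0}"
  by (auto simp: code_covers_def fun_eq_iff)

text \<open>A code with only one cover coincides with its least cover, which is possible only if all
  entries vanish.\<close>

lemma lev_zero:
  assumes "d \<ge> 1"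
  shows "lev d (\<lambda>_ _. 0) = (\<lambda>_ _. 0)"
proof -
  let ?a = "lev d (\<lambda>_ _. 0)"
  have c: "?a \<in> codes" using lev_closed assms by simp
  have "code_covers ?a = {lev (Suc d) (\<lambda>_ _. 0)}"
    using lev_covers[OF assms zero_in_codes] covers_zero by simp
  then have "(\<lambda>p j. ?a p j - 1) = ?a"
    using code_pred_in_covers[OF c] self_in_covers[OF c] by auto
  then have "?a p j - 1 = ?a p j" for p j by (rule fun_cong[OF fun_cong])
  then have "?a p j = 0" for p j by (metis diff_is_0_eq' nat_le_linear not_one_le_zero diff_diff_cancel)
  then show ?thesis by auto
qed

lemma covers_delta:
  assumes "prime p"
  shows "code_covers (code_delta p) = {code_delta p, \<lambda>_ _. 0}"
proof -
  have "b = code_delta p \<or> b = (\<lambda>_ _. 0)" if "b \<in> code_covers (code_delta p)" for b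
  proof -
    have b: "b q j \<le> code_delta p q j" for q j using that by (auto simp: code_covers_def)
    have z: "b q j = 0" if "(q, j) \<noteq> (p, 0)" for q j
      using b[of q j] that by (auto simp: code_delta_def split: if_splits)
    have "b p 0 \<le> 1" using b[of p 0] by (auto simp: code_delta_def)
    then consider "b p 0 = 0" | "b p 0 = 1" by linarith
    then show ?thesis
    proof cases
      case 1
      then have "b q j = 0" for q j using z[of q j] by (cases "(q, j) = (p, 0)") auto
      then show ?thesis by (intro disjI2 ext)
    next
      case 2
      then have "b q j = code_delta p q j" for q j
        using z[of q j] by (cases "(q, j) = (p, 0)") (auto simp: code_delta_def)
      then show ?thesis by (intro disjI1 ext)
    qed
  qed
  moreover have "(\<lambda>_ _. 0) \<in> code_covers (code_delta p)"
    by (auto simp: code_covers_def code_delta_def)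
  ultimately show ?thesis using self_in_covers[OF code_delta_in_codes[OF assms]] by auto
qed

lemma code_delta_neq_zero [simp]: "code_delta p \<noteq> (\<lambda>_ _. 0)"
  by (auto simp: code_delta_def fun_eq_iff)

text \<open>The same prime is asserted for both ranks at once, so that independence of the rank
  follows by induction. The covers of the image are zero and one further code; the image itself and
  some \<open>code_delta q\<close> are both nonzero covers, so all three coincide.\<close>

lemma lev_delta_ex:
  assumes "d \<ge> 1" "prime p"
  shows "\<exists>q. prime q \<and> lev d (code_delta p) = code_delta q \<and> lev (Suc d) (code_delta p) = code_delta q"
proof -
  let ?a = "lev d (code_delta p)" and ?b = "lev (Suc d) (code_delta p)" and ?z = "\<lambda>_ _. 0 :: nat"
  have c: "?a \<in> codes" using lev_closed assms code_delta_in_codes by simp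
  have U: "code_covers ?a = {?b, ?z}"
    using lev_covers[OF assms(1) code_delta_in_codes[OF assms(2)]] covers_delta[OF assms(2)]
      lev_zero[of "Suc d"] by simp
  have "?a \<noteq> ?z"
    using lev_inj[of d "code_delta p" ?z] lev_zero[OF assms(1)] assms code_delta_in_codes by auto
  then obtain q j where "?a q j \<noteq> 0" by (auto simp: fun_eq_iff)
  then have q0: "?a q 0 \<noteq> 0" using codes_antimono[OF c, of 0 j q] by simp
  have q: "prime q" using codes_prime[OF c q0] .
  \<comment> \<open>Zero being a cover bounds all entries of the image by one, which makes
    \<open>code_delta q\<close> a cover for any \<open>q\<close> in its support.\<close>
  have "?z \<in> code_covers ?a" using U by simp
  then have le1: "?a r k \<le> 1" for r k by (auto simp: code_covers_def)
  have "code_delta q r k \<le> ?a r k \<and> ?a r k \<le> Suc (code_delta q r k)" for r k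
  proof -
    have "?a r k \<le> Suc (code_delta q r k)" using le1[of r k] by linarith
    moreover have "code_delta q r k \<le> ?a r k" using q0 by (auto simp: code_delta_def)
    ultimately show ?thesis by simp
  qed
  then have "code_delta q \<in> code_covers ?a"
    using code_delta_in_codes[OF q] by (auto simp: code_covers_def)
  then have "code_delta q = ?b" using U by auto
  moreover have "?a = ?b" using self_in_covers[OF c] U \<open>?a \<noteq> ?z\<close> by auto
  ultimately show ?thesis using q by (intro exI[of _ q]) simp
qed

lemma code_delta_inj [simp]: "code_delta p = code_delta q \<longleftrightarrow> p = q"
proof
  assume "code_delta p = code_delta q"
  then have "code_delta p p 0 = code_delta q p 0" by simp
  then show "p = q" by (auto simp: code_delta_def split: if_splits)
qed simp

lemma lev_delta:
  obtains \<sigma> where "bij_betw \<sigma> {p. prime p} {p. prime p}"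
    "\<And>d p. d \<ge> 1 \<Longrightarrow> prime p \<Longrightarrow> lev d (code_delta p) = code_delta (\<sigma> p)"
proof -
  obtain \<sigma> where \<sigma>: "\<And>p. prime p \<Longrightarrow> prime (\<sigma> p) \<and> lev 1 (code_delta p) = code_delta (\<sigma> p)"
    using lev_delta_ex[of 1] by (metis order_refl)
  have lev: "lev d (code_delta p) = code_delta (\<sigma> p)" if "d \<ge> 1" "prime p" for d p
    using that(1)
  proof (induction d rule: dec_induct)
    case base
    then show ?case using \<sigma> that by simp
  next
    case (step d)
    then show ?case using lev_delta_ex[OF step(1) that(2)] by (metis code_delta_inj)
  qed
  have "inj_on \<sigma> {p. prime p}"
  proof (rule inj_onI)
    fix p q assume "p \<in> {p. prime p}" "q \<in> {p. prime p}" "\<sigma> p = \<sigma> q"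
    then show "p = q" using lev[of 1 p] lev[of 1 q] lev_inj[of 1 "code_delta p" "code_delta q"]
      by (simp add: code_delta_in_codes)
  qed
  moreover have "q \<in> \<sigma> ` {p. prime p}" if q: "prime q" for q
  proof -
    \<comment> \<open>Surjectivity comes from applying the same argument to the inverse
      automorphism, which must also send \<open>code_delta q\<close> to some
      \<open>code_delta p\<close>.\<close>
    interpret i: code_automorphism "inv_into ranked_codes f" by (rule inverse)
    obtain p where p: "prime p" "i.lev 1 (code_delta q) = code_delta p"
      using i.lev_delta_ex[OF _ q, of 1] by auto
    have q': "(1, code_delta q) \<in> ranked_codes" using code_delta_in_codes[OF q] by (simp add: ranked_codes_def)
    have "inv_into ranked_codes f (1, code_delta q) = (1, code_delta p)"
      using i.f_eq[of 1 "code_delta q"] p code_delta_in_codes[OF q] by simp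
    then have "f (1, code_delta p) = (1, code_delta q)"
      using bij_betw_inv_into_right[OF bij q'] by simp
    then have "code_delta (\<sigma> p) = code_delta q"
      using f_eq[of 1 "code_delta p"] lev[of 1 p] p code_delta_in_codes by simp
    then show ?thesis using p by auto
  qed
  ultimately have "bij_betw \<sigma> {p. prime p} {p. prime p}" using \<sigma> by (auto simp: bij_betw_def)
  then show ?thesis using that lev by blast
qed

text \<open>The induction is on size with the rank left arbitrary, because the proper covers of a
  code at rank \<open>d\<close> have to be known as fixed at rank \<open>Suc d\<close>.\<close>

lemma identity_if_fixes_delta:
  assumes "\<And>d p. d \<ge> 1 \<Longrightarrow> prime p \<Longrightarrow> lev d (code_delta p) = code_delta p"
    and "d \<ge> 1" "a \<in> codes"
  shows "lev d a = a"
  using assms(2,3)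
proof (induction "code_size a" arbitrary: d a rule: less_induct)
  case less
  show ?case
  proof (cases "code_size a < 2")
    case True
    then show ?thesis
      using code_size_le_1[OF less.prems(2) True] lev_zero[OF less.prems(1)] assms(1)[OF less.prems(1)]
      by metis
  next
    case False
    have fixes_smaller: "lev e b = b" if "e \<ge> 1" "b \<in> codes" "code_size b < code_size a" for e b
      using less.hyps that by blast
    \<comment> \<open>A smaller image would itself be fixed by induction, so it would have the same
      image as \<open>a\<close>, against injectivity.\<close>
    have ge: "code_size (lev e a) \<ge> code_size a" if e: "e \<ge> 1" for e
    proof (rule ccontr)
      assume "\<not> ?thesis"
      then have lt: "code_size (lev e a) < code_size a" by simp
      then have "lev e (lev e a) = lev e a" using fixes_smaller[OF e] lev_closed[OF e less.prems(2)] by blast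
      then have "lev e a = a" using lev_inj[OF e] lev_closed[OF e less.prems(2)] less.prems(2) by blast
      then show False using lt by simp
    qed
    let ?b = "lev d a"
    have b: "?b \<in> codes" using lev_closed less.prems by blast
    have smaller: "code_size c < code_size a" "c \<in> codes" if "c \<in> code_covers a - {a}" for c
      using that code_size_less[OF less.prems(2), of c] by (auto simp: code_covers_def)
    have "code_covers a = insert a (code_covers a - {a})"
      using self_in_covers[OF less.prems(2)] by auto
    then have "code_covers ?b = insert (lev (Suc d) a) (lev (Suc d) ` (code_covers a - {a}))"
      using lev_covers[OF less.prems] by (metis image_insert)
    also have "lev (Suc d) ` (code_covers a - {a}) = code_covers a - {a}"
      using fixes_smaller[of "Suc d"] smaller by force
    finally have U: "code_covers ?b = insert (lev (Suc d) a) (code_covers a - {a})" .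
    \<comment> \<open>The code \<open>?b\<close> belongs to its own covers but is too large to be a
      proper cover of \<open>a\<close>; only the single unknown member \<open>lev (Suc d) a\<close>
      is left for it.\<close>
    have "?b \<notin> code_covers a - {a}" using smaller(1)[of ?b] ge[OF less.prems(1)] by linarith
    then have eq: "?b = lev (Suc d) a" using U self_in_covers[OF b] by auto
    then have "code_covers a - {a} = code_covers ?b - {?b}"
      using U \<open>?b \<notin> code_covers a - {a}\<close> by auto
    moreover have "code_size a \<ge> 2" "code_size ?b \<ge> 2" using False ge[OF less.prems(1)] by linarith+
    ultimately show ?thesis
      using code_determined_by_covers[OF less.prems(2) _ b] by metis
  qed
qed

theorem eq_code_perm:
  obtains \<tau> where "bij_betw \<tau> {p. prime p} {p. prime p}"
    "\<And>x. x \<in> ranked_codes \<Longrightarrow> f x = code_perm \<tau> x"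
proof -
  obtain \<sigma> where \<sigma>: "bij_betw \<sigma> {p. prime p} {p. prime p}"
    and lev: "\<And>d p. d \<ge> 1 \<Longrightarrow> prime p \<Longrightarrow> lev d (code_delta p) = code_delta (\<sigma> p)"
    using lev_delta by blast
  \<comment> \<open>Pulling back along \<open>\<sigma>\<close> turns
    \<open>code_delta (\<sigma> p)\<close> into \<open>code_delta p\<close>, so the composite fixes
    every delta and is the identity.\<close>
  interpret g: code_automorphism "code_perm \<sigma> \<circ> f"
    by unfold_locales
      (use bij_betw_trans[OF bij bij_code_perm[OF \<sigma>]] code_perm_le_iff[OF \<sigma> closed closed] le_iff in auto)
  have "g.lev d (code_delta p) = code_delta p" if "d \<ge> 1" "prime p" for d p
  proof -
    have "\<sigma> q = \<sigma> p \<longleftrightarrow> q = p" if "prime q" for q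
      using \<sigma> \<open>prime p\<close> that by (auto simp: bij_betw_def inj_on_def)
    then show ?thesis using that f_eq[of d "code_delta p"] code_delta_in_codes[of p] lev
      by (auto simp: g.lev_def code_perm_def code_delta_def fun_eq_iff)
  qed
  then have id: "code_perm \<sigma> (f x) = x" if "x \<in> ranked_codes" for x
    using g.identity_if_fixes_delta[of "fst x" "snd x"] g.f_eq[of "fst x" "snd x"] that
    by (auto simp: ranked_codes_def mem_Times_iff)
  let ?r = "inv_into {p. prime p} \<sigma>"
  have r: "bij_betw ?r {p. prime p} {p. prime p}" by (rule bij_betw_inv_into[OF \<sigma>])
  have "f x = code_perm ?r x" if x: "x \<in> ranked_codes" for x
  proof -
    have "code_perm ?r (code_perm \<sigma> (f x)) = code_perm (\<sigma> \<circ> ?r) (f x)"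
      using r by (intro code_perm_comp) (auto simp: bij_betw_def)
    also have "\<dots> = f x"
      using bij_betw_inv_into_right[OF \<sigma>] by (intro code_perm_ident closed x) auto
    finally show ?thesis using id[OF x] by simp
  qed
  then show ?thesis using that r by blast
qed

end

section \<open>Subgroups of Z^n and their elementary divisors\<close>

section \<open>Smith normal form\<close>


text \<open>Vectors are sequences indexed by all of \<open>nat\<close>. Rank \<open>n\<close> is
  expressed by requiring separately that the lattice contain all vectors vanishing below
  \<open>n\<close>, so that one type serves every rank.\<close>

definition int_lattice :: "(nat \<Rightarrow> int) set \<Rightarrow> bool" where
  "int_lattice L \<longleftrightarrow> 0 \<in> L \<and> (\<forall>x\<in>L. \<forall>y\<in>L. x - y \<in> L)"

definition std_unit :: "nat \<Rightarrow> nat \<Rightarrow> int" where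
  "std_unit i = (\<lambda>j. if j = i then 1 else 0)"

text \<open>The last clause makes \<open>A\<close> descend to the quotient Z^n by the vectors that
  vanish below \<open>n\<close>.\<close>

definition lattice_aut :: "nat \<Rightarrow> ((nat \<Rightarrow> int) \<Rightarrow> nat \<Rightarrow> int) \<Rightarrow> bool" where
  "lattice_aut n A \<longleftrightarrow> bij A \<and> (\<forall>x y. A (x + y) = A x + A y) \<and>
     (\<forall>x. (\<forall>i<n. x i = 0) \<longrightarrow> (\<forall>i<n. A x i = 0))"

lemma lattice_zero: "int_lattice L \<Longrightarrow> 0 \<in> L"
  by (simp add: int_lattice_def)

lemma lattice_diff: "int_lattice L \<Longrightarrow> x \<in> L \<Longrightarrow> y \<in> L \<Longrightarrow> x - y \<in> L"
  by (simp add: int_lattice_def)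

lemma lattice_uminus: "int_lattice L \<Longrightarrow> x \<in> L \<Longrightarrow> - x \<in> L"
  using lattice_diff[of L 0 x] by (simp add: lattice_zero)

lemma lattice_add: "int_lattice L \<Longrightarrow> x \<in> L \<Longrightarrow> y \<in> L \<Longrightarrow> x + y \<in> L"
  using lattice_diff[of L x "- y"] by (simp add: lattice_uminus)

lemma lattice_mult:
  assumes "int_lattice L" "x \<in> L"
  shows "(\<lambda>i. k * x i) \<in> L"
proof (induction k rule: int_induct[of _ 0])
  case base
  then show ?case using lattice_zero[OF assms(1)] by (simp add: zero_fun_def)
next
  case (step1 k)
  have "(\<lambda>i. (k + 1) * x i) = (\<lambda>i. k * x i) + x" by (auto simp: algebra_simps)
  then show ?case using lattice_add[OF assms(1) step1(2) assms(2)] by simp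
next
  case (step2 k)
  have "(\<lambda>i. (k - 1) * x i) = (\<lambda>i. k * x i) - x" by (auto simp: algebra_simps)
  then show ?case using lattice_diff[OF assms(1) step2(2) assms(2)] by simp
qed

lemma additive_diff:
  fixes A :: "'a::ab_group_add \<Rightarrow> 'b::ab_group_add"
  assumes "\<And>x y. A (x + y) = A x + A y"
  shows "A (x - y) = A x - A y"
  using assms[of "x - y" y] by (simp add: algebra_simps)

lemma lattice_vimage:
  assumes "int_lattice L" "\<And>x y. A (x + y) = A x + (A y :: nat \<Rightarrow> int)"
  shows "int_lattice (A -` L)"
proof -
  have "A 0 = 0" using additive_diff[of A 0 0] assms(2) by simp
  then show ?thesis
    using assms(1) additive_diff[of A] assms(2) by (auto simp: int_lattice_def)
qed

lemma lattice_aut_id: "lattice_aut n (\<lambda>x. x)"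
  by (simp add: lattice_aut_def bij_id[unfolded id_def])

lemma lattice_aut_comp: "lattice_aut n A \<Longrightarrow> lattice_aut n B \<Longrightarrow> lattice_aut n (A \<circ> B)"
  by (auto simp: lattice_aut_def bij_comp)

lemma lattice_aut_swap:
  assumes "k < n"
  shows "lattice_aut n (\<lambda>x i. x (if i = 0 then k else if i = k then 0 else i))" (is "lattice_aut n ?A")
proof -
  have "?A (?A x) = x" for x by (auto simp: fun_eq_iff)
  then have "bij ?A" by (intro o_bij[of ?A ?A]) (auto simp: fun_eq_iff)
  then show ?thesis using assms by (auto simp: lattice_aut_def fun_eq_iff)
qed

lemma lattice_aut_shear:
  "lattice_aut n (\<lambda>x i. if 0 < i \<and> i < n then x i + d i * x 0 else x i)" (is "lattice_aut n ?A")
proof -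
  have "bij ?A"
    by (intro o_bij[of "\<lambda>x i. if 0 < i \<and> i < n then x i - d i * x 0 else x i"])
      (auto simp: fun_eq_iff)
  then show ?thesis by (auto simp: lattice_aut_def fun_eq_iff algebra_simps)
qed

text \<open>Quantifying over all coordinate systems replaces the Euclidean algorithm: a division
  with remainder would exhibit a smaller positive entry after a change of coordinates. Looking at
  coordinate 0 suffices since swaps bring any other one there.\<close>

definition min_entry :: "nat \<Rightarrow> (nat \<Rightarrow> int) set \<Rightarrow> int \<Rightarrow> bool" where
  "min_entry n L c \<longleftrightarrow> (\<forall>B y. lattice_aut n B \<longrightarrow> B y \<in> L \<longrightarrow> y 0 > 0 \<longrightarrow> c \<le> y 0)"

lemma min_entryD:
  "min_entry n L c \<Longrightarrow> lattice_aut n B \<Longrightarrow> B y \<in> L \<Longrightarrow> y 0 > 0 \<Longrightarrow> c \<le> y 0"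
  unfolding min_entry_def by blast

lemma min_entry_vimage: "min_entry n L c \<Longrightarrow> lattice_aut n A \<Longrightarrow> min_entry n (A -` L) c"
  unfolding min_entry_def using lattice_aut_comp[of n A] by fastforce

lemma min_entry_dvd:
  assumes min: "min_entry n L c" and z: "z \<in> L" "z 0 = c" and i: "i < n" and c: "c > 0"
  shows "c dvd z i"
proof (cases "i = 0")
  case False
  let ?q = "z i div c"
  let ?T = "\<lambda>x j. if 0 < j \<and> j < n then x j + (if j = i then ?q else 0) * x 0 else (x j :: int)"
  let ?W = "\<lambda>x j. x (if j = 0 then i else if j = i then 0 else j) :: int"
  \<comment> \<open>Coordinate \<open>i\<close> of \<open>z\<close> is replaced by its remainder
    modulo \<open>c\<close> and swapped to the front, where minimality of \<open>c\<close>
    applies.\<close>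
  define y where "y = ?W (\<lambda>j. if j = i then z j - ?q * c else z j)"
  have "(?T \<circ> ?W) y = z" using False i z(2) by (auto simp: y_def fun_eq_iff)
  then have "(?T \<circ> ?W) y \<in> L" using z(1) by simp
  moreover have aut: "lattice_aut n (?T \<circ> ?W)"
    by (rule lattice_aut_comp[OF lattice_aut_shear lattice_aut_swap[OF i]])
  moreover have "y 0 = z i mod c" by (simp add: y_def minus_div_mult_eq_mod)
  ultimately have "z i mod c > 0 \<Longrightarrow> c \<le> z i mod c"
    using min_entryD[OF min aut, of y] by simp
  then have "z i mod c = 0"
    using pos_mod_bound[OF c, of "z i"] pos_mod_sign[OF c, of "z i"] by linarith
  then show ?thesis by auto
qed (simp add: z)

lemma min_entry_all_dvd:
  assumes L: "int_lattice L" and min: "min_entry n L c" and c: "c > 0" and n: "n > 0"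
    and e: "(\<lambda>i. c * std_unit 0 i) \<in> L" and y: "y \<in> L" and i: "i < n"
  shows "c dvd y i"
proof -
  let ?z = "y - (\<lambda>i. (y 0 div c) * (c * std_unit 0 i))"
  have z: "?z \<in> L" by (intro lattice_diff[OF L y] lattice_mult[OF L e])
  have z0: "?z 0 = y 0 mod c" by (simp add: std_unit_def minus_div_mult_eq_mod)
  have "lattice_aut n (\<lambda>x. x)" by (rule lattice_aut_id)
  then have "y 0 mod c > 0 \<Longrightarrow> c \<le> y 0 mod c"
    using min_entryD[OF min, of "\<lambda>x. x" ?z] z z0 by simp
  then have m0: "y 0 mod c = 0"
    using pos_mod_bound[OF c, of "y 0"] pos_mod_sign[OF c, of "y 0"] by linarith
  \<comment> \<open>Coordinate 0 of \<open>?z\<close> is 0; adding the vector \<open>c\<close> at 0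
    makes it equal to \<open>c\<close>, as \<open>min_entry_dvd\<close> requires, without affecting
    the other coordinates.\<close>
  let ?w = "?z + (\<lambda>i. c * std_unit 0 i)"
  have "?w \<in> L" by (rule lattice_add[OF L z e])
  moreover have "?w 0 = c" using z0 m0 by (simp add: std_unit_def)
  ultimately have "c dvd ?w i" by (intro min_entry_dvd[OF min _ _ i c])
  then show ?thesis using m0 by (auto simp: std_unit_def dvd_eq_mod_eq_0 split: if_splits)
qed

lemma min_entry_exists:
  assumes L: "int_lattice L" and x: "x \<in> L" "k < n" "x k \<noteq> 0"
  obtains A y where "lattice_aut n A" "A y \<in> L" "y 0 > 0" "min_entry n (A -` L) (y 0)"
proof -
  let ?P = "\<lambda>c. c > 0 \<and> (\<exists>A y. lattice_aut n A \<and> A y \<in> L \<and> y 0 = int c)"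
  let ?W = "\<lambda>x j. x (if j = 0 then k else if j = k then 0 else j) :: int"
  have sw: "lattice_aut n ?W" by (rule lattice_aut_swap[OF x(2)])
  let ?x = "if x k > 0 then x else - x"
  have "?W (?W z) = z" for z by (auto simp: fun_eq_iff)
  then have "?W (?W ?x) \<in> L" using x(1) lattice_uminus[OF L x(1)] by simp
  moreover have "?W ?x 0 = int (nat \<bar>x k\<bar>)" by auto
  ultimately have ex: "?P (nat \<bar>x k\<bar>)" using sw x(3) by (auto intro!: exI[of _ ?W] exI[of _ "?W ?x"])
  define c where "c = (LEAST c. ?P c)"
  have c: "?P c" unfolding c_def using ex by (rule LeastI)
  then obtain A y where A: "lattice_aut n A" "A y \<in> L" "y 0 = int c" by auto
  have least: "c \<le> d" if "?P d" for d unfolding c_def using that by (rule Least_le)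
  have "min_entry n L (int c)"
    unfolding min_entry_def
  proof (intro allI impI)
    fix B z assume "lattice_aut n B" "B z \<in> L" "z 0 > 0"
    then have "?P (nat (z 0))" by (auto intro!: exI[of _ B] exI[of _ z])
    then show "int c \<le> z 0" using least[of "nat (z 0)"] \<open>z 0 > 0\<close> by simp
  qed
  then show ?thesis using that[OF A(1,2)] min_entry_vimage[OF _ A(1)] A(3) c by simp
qed

lemma lattice_aut_extend:
  assumes "lattice_aut n A"
  shows "lattice_aut (Suc n) (\<lambda>x. case_nat (x 0) (A (\<lambda>i. x (Suc i))))" (is "lattice_aut _ ?D")
proof -
  have bij_A: "bij A" and add: "\<And>x y. A (x + y) = A x + A y"
    and W: "\<And>x. (\<forall>i<n. x i = 0) \<Longrightarrow> (\<forall>i<n. A x i = 0)"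
    using assms by (auto simp: lattice_aut_def)
  let ?E = "\<lambda>x. case_nat (x 0) (inv_into UNIV A (\<lambda>i. x (Suc i)))"
  have "bij ?D"
  proof (rule o_bij)
    show "?E \<circ> ?D = id"
      using bij_A by (auto simp: fun_eq_iff bij_is_inj inv_f_f split: nat.split)
    show "?D \<circ> ?E = id"
      using bij_A by (auto simp: fun_eq_iff bij_is_surj surj_f_inv_f split: nat.split)
  qed
  moreover have "?D (x + y) = ?D x + ?D y" for x y
  proof -
    have "A (\<lambda>i. (x + y) (Suc i)) = A (\<lambda>i. x (Suc i)) + A (\<lambda>i. y (Suc i))"
      using add[of "\<lambda>i. x (Suc i)" "\<lambda>i. y (Suc i)"] by (simp add: plus_fun_def)
    then show ?thesis by (auto simp: fun_eq_iff split: nat.split)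
  qed
  moreover have "?D x i = 0" if "\<forall>i<Suc n. x i = 0" "i < Suc n" for x i
    using W[of "\<lambda>i. x (Suc i)"] that by (auto split: nat.split)
  ultimately show ?thesis by (auto simp: lattice_aut_def)
qed

text \<open>An entry that is minimal among all positive entries of lattice vectors, in all bases, divides
  every other entry, so it splits off as a direct summand.\<close>

theorem smith_normal_form:
  assumes "int_lattice L" "\<And>x. (\<And>i. i < n \<Longrightarrow> x i = 0) \<Longrightarrow> x \<in> L"
  shows "\<exists>A m. lattice_aut n A \<and> (\<forall>x. A x \<in> L \<longleftrightarrow> (\<forall>i<n. int (m i) dvd x i)) \<and>
    (\<forall>i j. i \<le> j \<longrightarrow> j < n \<longrightarrow> m i dvd m j)"
  using assms
proof (induction n arbitrary: L)
  case 0
  then show ?case using lattice_aut_id by (intro exI[of _ "\<lambda>x. x"] exI[of _ "\<lambda>_. 0"]) auto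
next
  case (Suc n)
  note L = Suc.prems(1) and W = Suc.prems(2)
  show ?case
  proof (cases "\<exists>x k. x \<in> L \<and> k < Suc n \<and> x k \<noteq> 0")
    case False
    then have "\<forall>x. x \<in> L \<longleftrightarrow> (\<forall>i<Suc n. x i = 0)" using W by blast
    then show ?thesis using lattice_aut_id by (intro exI[of _ "\<lambda>x. x"] exI[of _ "\<lambda>_. 0"]) auto
  next
    case True
    then obtain A x where A: "lattice_aut (Suc n) A" "A x \<in> L" "x 0 > 0"
      "min_entry (Suc n) (A -` L) (x 0)"
      using min_entry_exists[OF L] by metis
    define c where "c = x 0"
    \<comment> \<open>Since \<open>c\<close> divides all relevant entries of \<open>x\<close>, this
      shear sends \<open>c\<close> times the first unit vector to \<open>x\<close>, up to
      coordinates that do not matter.\<close>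
    define B :: "(nat \<Rightarrow> int) \<Rightarrow> nat \<Rightarrow> int"
      where "B = (\<lambda>y i. if 0 < i \<and> i < Suc n then y i + (x i div c) * y 0 else y i)"
    have B: "lattice_aut (Suc n) B" unfolding B_def by (rule lattice_aut_shear)
    let ?L = "(A \<circ> B) -` L"
    have AB: "lattice_aut (Suc n) (A \<circ> B)" by (rule lattice_aut_comp[OF A(1) B])
    have L': "int_lattice ?L" using AB by (intro lattice_vimage[OF L]) (auto simp: lattice_aut_def)
    have LA: "int_lattice (A -` L)" using A(1) by (intro lattice_vimage[OF L]) (auto simp: lattice_aut_def)
    have c: "c > 0" using A(3) c_def by simp
    have minA: "min_entry (Suc n) (A -` L) c" using A(4) c_def by simp
    have min: "min_entry (Suc n) ?L c"
      using min_entry_vimage[OF minA B] by (simp add: vimage_comp)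
    have WA: "y \<in> A -` L" if "\<And>i. i < Suc n \<Longrightarrow> y i = 0" for y
      using A(1) that W by (simp add: lattice_aut_def)
    have WB: "y \<in> ?L" if "\<And>i. i < Suc n \<Longrightarrow> y i = 0" for y
      using AB that W by (simp add: lattice_aut_def)
    have e: "(\<lambda>i. c * std_unit 0 i) \<in> ?L"
    proof -
      have "x i = (x i div c) * c" if "i < Suc n" for i
        using min_entry_dvd[OF minA _ _ that c, of x] A(2) c_def by simp
      then have "x - B (\<lambda>i. c * std_unit 0 i) \<in> A -` L"
        by (intro WA) (auto simp: B_def std_unit_def c_def)
      moreover have "x \<in> A -` L" using A(2) by simp
      ultimately have "x - (x - B (\<lambda>i. c * std_unit 0 i)) \<in> A -` L"
        using lattice_diff[OF LA] by blast
      then show ?thesis by simp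
    qed
    \<comment> \<open>The slice of the lattice at coordinate 0 equal to zero. As \<open>c\<close>
      divides every first coordinate and \<open>c\<close> times the first unit vector lies in the
      lattice, this slice is a complement.\<close>
    let ?M = "{t. case_nat 0 t \<in> ?L}"
    have "int_lattice (case_nat 0 -` ?L)"
      by (rule lattice_vimage[OF L']) (auto simp: fun_eq_iff split: nat.split)
    then have M: "int_lattice ?M" by (simp add: vimage_def)
    have "\<exists>A' m. lattice_aut n A' \<and> (\<forall>x. A' x \<in> ?M \<longleftrightarrow> (\<forall>i<n. int (m i) dvd x i)) \<and>
        (\<forall>i j. i \<le> j \<longrightarrow> j < n \<longrightarrow> m i dvd m j)"
    proof (rule Suc.IH[OF M])
      fix t :: "nat \<Rightarrow> int" assume "\<And>i. i < n \<Longrightarrow> t i = 0"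
      then have "case_nat 0 t \<in> ?L" by (intro WB) (auto split: nat.split)
      then show "t \<in> ?M" by simp
    qed
    then obtain A' m where A': "lattice_aut n A'"
      and A'M: "\<And>x. A' x \<in> ?M \<longleftrightarrow> (\<forall>i<n. int (m i) dvd x i)"
      and m: "\<And>i j. i \<le> j \<Longrightarrow> j < n \<Longrightarrow> m i dvd m j" by metis
    define D where "D = (\<lambda>x. case_nat (x 0) (A' (\<lambda>i. x (Suc i))))"
    have D: "lattice_aut (Suc n) D" unfolding D_def by (rule lattice_aut_extend[OF A'])
    let ?m = "case_nat (nat c) m"
    have DL: "D x \<in> ?L \<longleftrightarrow> (\<forall>i<Suc n. int (?m i) dvd x i)" for x
    proof -
      have split: "D x = (\<lambda>i. x 0 * std_unit 0 i) + case_nat 0 (A' (\<lambda>i. x (Suc i)))"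
        by (auto simp: D_def std_unit_def fun_eq_iff split: nat.split)
      have mult: "(\<lambda>i. x 0 * std_unit 0 i) \<in> ?L" if "c dvd x 0"
      proof -
        have "(\<lambda>i. x 0 * std_unit 0 i) = (\<lambda>i. (x 0 div c) * (c * std_unit 0 i))"
          using that by (auto simp: std_unit_def)
        then show ?thesis using lattice_mult[OF L' e] by simp
      qed
      have "D x \<in> ?L \<longleftrightarrow> c dvd x 0 \<and> case_nat 0 (A' (\<lambda>i. x (Suc i))) \<in> ?L"
      proof
        assume Dx: "D x \<in> ?L"
        then have d: "c dvd x 0"
          using min_entry_all_dvd[OF L' min c _ e Dx, of 0] by (simp add: D_def)
        have "D x - (\<lambda>i. x 0 * std_unit 0 i) \<in> ?L" by (rule lattice_diff[OF L' Dx mult[OF d]])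
        then show "c dvd x 0 \<and> case_nat 0 (A' (\<lambda>i. x (Suc i))) \<in> ?L" using d split by simp
      next
        assume "c dvd x 0 \<and> case_nat 0 (A' (\<lambda>i. x (Suc i))) \<in> ?L"
        then show "D x \<in> ?L" unfolding split by (intro lattice_add[OF L'] mult) auto
      qed
      also have "\<dots> \<longleftrightarrow> c dvd x 0 \<and> (\<forall>i<n. int (m i) dvd x (Suc i))"
        using A'M[of "\<lambda>i. x (Suc i)"] by simp
      also have "\<dots> \<longleftrightarrow> (\<forall>i<Suc n. int (?m i) dvd x i)"
        using c by (auto simp: less_Suc_eq_0_disj)
      finally show ?thesis .
    qed
    \<comment> \<open>The sum of the two lattice vectors with single entries \<open>c\<close> and
      \<open>m i\<close> has first coordinate \<open>c\<close>, so minimality makes \<open>c\<close>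
      divide the other entry.\<close>
    have cm: "nat c dvd m i" if i: "i < n" for i
    proof -
      let ?z = "\<lambda>j. c * std_unit 0 j + int (m i) * std_unit (Suc i) j"
      have "D ?z \<in> ?L" unfolding DL using c i
        by (auto simp: std_unit_def less_Suc_eq_0_disj)
      then have "c dvd ?z (Suc i)"
        using i by (intro min_entry_dvd[OF min_entry_vimage[OF min D] _ _ _ c]) (auto simp: std_unit_def)
      then show ?thesis using c by (simp add: std_unit_def nat_dvd_iff)
    qed
    have "lattice_aut (Suc n) (A \<circ> B \<circ> D)" by (rule lattice_aut_comp[OF AB D])
    moreover have "(A \<circ> B \<circ> D) x \<in> L \<longleftrightarrow> (\<forall>i<Suc n. int (?m i) dvd x i)" for x
      using DL[of x] by simp
    moreover have "?m i dvd ?m j" if "i \<le> j" "j < Suc n" for i j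
      using that m cm by (auto split: nat.split)
    ultimately show ?thesis by blast
  qed
qed

section \<open>Abelian groups as images of integer vectors, split into cyclic summands\<close>

section \<open>Presentations of abelian groups by moduli\<close>


text \<open>All integer sequences form the domain, whatever the number of generators; finiteness
  enters only through vectors with a trivial image.\<close>

locale vec_hom = comm_group G for G (structure) +
  fixes \<phi> :: "(nat \<Rightarrow> int) \<Rightarrow> 'a"
  assumes vec_closed [simp, intro]: "\<phi> x \<in> carrier G"
    and vec_add: "\<phi> (x + y) = \<phi> x \<otimes> \<phi> y"
begin

lemma vec_zero: "\<phi> 0 = \<one>"
  using vec_add[of 0 0] l_cancel_one[of "\<phi> 0" "\<phi> 0"] by simp

lemma vec_uminus: "\<phi> (- x) = inv (\<phi> x)"
  using vec_add[of "- x" x] vec_zero by (intro inv_equality[symmetric]) auto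

lemma vec_diff: "\<phi> (x - y) = \<phi> x \<otimes> inv (\<phi> y)"
  using vec_add[of x "- y"] vec_uminus by simp

lemma vec_eq_iff: "\<phi> x = \<phi> y \<longleftrightarrow> \<phi> (x - y) = \<one>"
  unfolding vec_diff using inv_solve_right'[of \<one> "\<phi> x" "\<phi> y"] by auto

lemma vec_nat_pow: "\<phi> x [^] (k::nat) = \<phi> (\<lambda>i. int k * x i)"
proof (induction k)
  case 0
  then show ?case using vec_zero by (simp add: zero_fun_def)
next
  case (Suc k)
  have "(\<lambda>i. int (Suc k) * x i) = (\<lambda>i. int k * x i) + x" by (auto simp: algebra_simps)
  then show ?case using Suc vec_add by simp
qed

lemma vec_lattice: "int_lattice {x. \<phi> x = \<one>}"
  by (auto simp: int_lattice_def vec_zero vec_diff)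

lemma vec_vimage_subgroup:
  assumes "subgroup K G"
  shows "int_lattice {x. \<phi> x \<in> K}"
  using assms by (auto simp: int_lattice_def vec_zero vec_diff subgroup.one_closed
      subgroup.m_closed subgroup.m_inv_closed)

lemma vec_range_subgroup: "subgroup (range \<phi>) G"
proof (rule subgroupI)
  show "inv a \<in> range \<phi>" if "a \<in> range \<phi>" for a
    using that by (auto simp flip: vec_uminus)
  show "a \<otimes> b \<in> range \<phi>" if "a \<in> range \<phi>" "b \<in> range \<phi>" for a b
    using that by (auto simp flip: vec_add)
qed auto

end

lemma lattice_sum:
  assumes "int_lattice L" "finite F" "\<And>i. i \<in> F \<Longrightarrow> f i \<in> L"
  shows "(\<Sum>i\<in>F. f i) \<in> L"
  using assms(2,3) by (induction F rule: finite_induct) (auto simp: lattice_zero lattice_add assms(1))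

text \<open>Serves as an induction principle: a property closed under subtraction holds for all
  vectors once it holds for the unit vectors and the irrelevant tails.\<close>

lemma lattice_full:
  assumes L: "int_lattice L" and W: "\<And>x. (\<And>i. i < n \<Longrightarrow> x i = 0) \<Longrightarrow> x \<in> L"
    and e: "\<And>i. i < n \<Longrightarrow> std_unit i \<in> L"
  shows "x \<in> L"
proof -
  let ?s = "\<Sum>i<n. (\<lambda>j. x i * std_unit i j)"
  have s: "?s \<in> L" using e by (intro lattice_sum[OF L] lattice_mult[OF L]) auto
  have sum: "?s j = (\<Sum>i<n. x i * std_unit i j)" for j
    by (induction n) (auto simp: zero_fun_def)
  have "?s j = x j" if "j < n" for j
    unfolding sum using that by (simp add: std_unit_def if_distrib cong: if_cong)
  then have "x - ?s \<in> L" by (intro W) simp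
  then show ?thesis using lattice_add[OF L _ s, of "x - ?s"] by simp
qed

definition word_map :: "('a, 'm) monoid_scheme \<Rightarrow> (nat \<Rightarrow> 'a) \<Rightarrow> nat \<Rightarrow> (nat \<Rightarrow> int) \<Rightarrow> 'a" where
  "word_map G g n x = finprod G (\<lambda>i. g i [^]\<^bsub>G\<^esub> x i) {..<n}"

context comm_group
begin

lemma word_map_hom:
  assumes "g \<in> {..<n} \<rightarrow> carrier G"
  shows "vec_hom G (word_map G g n)"
proof
  have g: "\<And>i. i < n \<Longrightarrow> g i \<in> carrier G" using assms by auto
  show "word_map G g n x \<in> carrier G" for x
    unfolding word_map_def using g by (intro finprod_closed) auto
  show "word_map G g n (x + y) = word_map G g n x \<otimes> word_map G g n y" for x y
  proof -
    have "word_map G g n (x + y) = finprod G (\<lambda>i. g i [^] x i \<otimes> g i [^] y i) {..<n}"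
      unfolding word_map_def using g by (intro finprod_cong') (auto simp: int_pow_mult)
    also have "\<dots> = word_map G g n x \<otimes> word_map G g n y"
      unfolding word_map_def using g by (intro finprod_multf) auto
    finally show ?thesis .
  qed
qed

lemma word_map_cong: "(\<And>i. i < n \<Longrightarrow> x i = y i) \<Longrightarrow> g \<in> {..<n} \<rightarrow> carrier G \<Longrightarrow> word_map G g n x = word_map G g n y"
  unfolding word_map_def by (intro finprod_cong') auto

lemma word_map_trivial:
  assumes "g \<in> {..<n} \<rightarrow> carrier G" "\<And>i. i < n \<Longrightarrow> x i = 0"
  shows "word_map G g n x = \<one>"
  using word_map_cong[of n x 0 g] vec_hom.vec_zero[OF word_map_hom[OF assms(1)]] assms by simp

lemma word_map_unit:
  assumes "g \<in> {..<n} \<rightarrow> carrier G" "i < n"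
  shows "word_map G g n (std_unit i) = g i"
proof -
  have "word_map G g n (std_unit i) = finprod G (\<lambda>j. if i = j then g j else \<one>) {..<n}"
    unfolding word_map_def using assms by (intro finprod_cong') (auto simp: std_unit_def Pi_iff int_pow_1)
  also have "\<dots> = g i" using assms by (intro finprod_singleton) auto
  finally show ?thesis .
qed

lemma word_map_range:
  assumes g: "g \<in> {..<n} \<rightarrow> carrier G"
  shows "range (word_map G g n) = generate G (g ` {..<n})"
proof
  interpret w: vec_hom G "word_map G g n" by (rule word_map_hom[OF g])
  have "g ` {..<n} \<subseteq> range (word_map G g n)"
    using word_map_unit[OF g] by (metis image_subset_iff lessThan_iff rangeI)
  then show "generate G (g ` {..<n}) \<subseteq> range (word_map G g n)"
    by (rule generate_subgroup_incl[OF _ w.vec_range_subgroup])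
  have sub: "subgroup (generate G (g ` {..<n})) G" using g by (intro generate_is_subgroup) auto
  have "word_map G g n x \<in> generate G (g ` {..<n})" for x
  proof -
    have "x \<in> {x. word_map G g n x \<in> generate G (g ` {..<n})}"
    proof (rule lattice_full[OF w.vec_vimage_subgroup[OF sub]])
      show "y \<in> {x. word_map G g n x \<in> generate G (g ` {..<n})}" if "\<And>i. i < n \<Longrightarrow> y i = 0" for y
        using word_map_trivial[OF g that] subgroup.one_closed[OF sub] by simp
      show "std_unit i \<in> {x. word_map G g n x \<in> generate G (g ` {..<n})}" if "i < n" for i
        using word_map_unit[OF g that] that by (auto intro: generate.incl)
    qed
    then show ?thesis by simp
  qed
  then show "range (word_map G g n) \<subseteq> generate G (g ` {..<n})" by auto
qed

end

text \<open>The group is the direct sum of the \<open>\<int>/m\<^sub>i\<int>\<close>; a modulus \<open>0\<close> gives an infinite cyclic summand and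
  a modulus \<open>1\<close> a trivial one.\<close>

locale moduli_presentation = vec_hom G \<phi> for G (structure) and \<phi> +
  fixes m :: "nat \<Rightarrow> nat"
  assumes vec_surj: "range \<phi> = carrier G"
    and vec_kernel: "\<phi> x = \<one> \<longleftrightarrow> (\<forall>i. int (m i) dvd x i)"
    and finite_moduli: "finite {i. m i \<noteq> 1}"

definition has_moduli :: "('a, 'm) monoid_scheme \<Rightarrow> (nat \<Rightarrow> nat) \<Rightarrow> bool" where
  "has_moduli G m \<longleftrightarrow> (\<exists>\<phi>. moduli_presentation G \<phi> m)"

theorem (in vec_hom) has_moduli_desc:
  assumes surj: "range \<phi> = carrier G" and W: "\<And>x. (\<And>i. i < n \<Longrightarrow> x i = 0) \<Longrightarrow> \<phi> x = \<one>"
  shows "\<exists>m. has_moduli G m \<and> (\<forall>i. m (Suc i) dvd m i)"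
proof -
  have "\<exists>A m. lattice_aut n A \<and> (\<forall>x. A x \<in> {x. \<phi> x = \<one>} \<longleftrightarrow> (\<forall>i<n. int (m i) dvd x i)) \<and>
    (\<forall>i j. i \<le> j \<longrightarrow> j < n \<longrightarrow> m i dvd m j)"
    using W by (intro smith_normal_form vec_lattice) auto
  then obtain A m where A: "lattice_aut n A" "\<And>x. \<phi> (A x) = \<one> \<longleftrightarrow> (\<forall>i<n. int (m i) dvd x i)"
    and m: "\<And>i j. i \<le> j \<Longrightarrow> j < n \<Longrightarrow> m i dvd m j" by auto
  \<comment> \<open>The Smith form has ascending divisibility. Reversing the first \<open>n\<close>
    coordinates puts the free summands, with modulus 0, in front and lets the chain continue with
    modulus 1 beyond \<open>n\<close>.\<close>
  let ?R = "\<lambda>x i. x (if i < n then n - 1 - i else i) :: int"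
  have RR: "?R (?R x) = x" for x by (auto simp: fun_eq_iff)
  let ?m = "\<lambda>i. if i < n then m (n - 1 - i) else 1"
  have "moduli_presentation G (\<lambda>x. \<phi> (A (?R x))) ?m"
  proof unfold_locales
    show "\<phi> (A (?R (x + y))) = \<phi> (A (?R x)) \<otimes> \<phi> (A (?R y))" for x y
    proof -
      have "?R (x + y) = ?R x + ?R y" by (auto simp: fun_eq_iff)
      then show ?thesis using A(1) vec_add by (simp add: lattice_aut_def)
    qed
    have "surj A" using A(1) by (simp add: lattice_aut_def bij_is_surj)
    have "y \<in> range (\<lambda>x. \<phi> (A (?R x)))" if y: "y \<in> carrier G" for y
    proof -
      obtain v where "y = \<phi> v" using y surj by auto
      moreover obtain w where "v = A w" using \<open>surj A\<close> by (auto simp: surj_def)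
      ultimately have "y = \<phi> (A (?R (?R w)))" using RR[of w] by simp
      then show ?thesis by (rule range_eqI[of _ _ "?R w"])
    qed
    then show "range (\<lambda>x. \<phi> (A (?R x))) = carrier G" by auto
    show "\<phi> (A (?R x)) = \<one> \<longleftrightarrow> (\<forall>i. int (?m i) dvd x i)" for x
    proof -
      have "(\<forall>i<n. int (m i) dvd x (n - 1 - i)) \<longleftrightarrow> (\<forall>i<n. int (m (n - 1 - i)) dvd x i)"
        (is "?l \<longleftrightarrow> ?r")
      proof
        show ?r if ?l
        proof (intro allI impI)
          fix i assume "i < n"
          then show "int (m (n - 1 - i)) dvd x i" using that[rule_format, of "n - 1 - i"] by simp
        qed
        show ?l if ?r
        proof (intro allI impI)
          fix i assume "i < n"
          then show "int (m i) dvd x (n - 1 - i)" using that[rule_format, of "n - 1 - i"] by simp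
        qed
      qed
      then show ?thesis using A(2)[of "?R x"] by auto
    qed
    show "finite {i. ?m i \<noteq> 1}" by (rule finite_subset[of _ "{..<n}"]) auto
  qed auto
  moreover have "?m (Suc i) dvd ?m i" for i using m[of "n - 1 - Suc i" "n - 1 - i"] by auto
  ultimately show ?thesis unfolding has_moduli_def by blast
qed

lemma has_moduli_of_fg:
  assumes "comm_group G" "finitely_generated_group G"
  shows "\<exists>m. has_moduli G m \<and> (\<forall>i. m (Suc i) dvd m i)"
proof -
  interpret comm_group G by fact
  obtain S where S: "finite S" "S \<subseteq> carrier G" "generate G S = carrier G"
    using assms(2) by (auto simp: finitely_generated_group_def finite_generating_set_def)
  obtain g where g: "bij_betw g {0..<card S} S" using ex_bij_betw_nat_finite[OF S(1)] by blast
  then have im: "g ` {..<card S} = S" by (simp add: bij_betw_def lessThan_atLeast0)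
  then have gc: "g \<in> {..<card S} \<rightarrow> carrier G" using S(2) by auto
  interpret w: vec_hom G "word_map G g (card S)" by (rule word_map_hom[OF gc])
  show ?thesis
    using word_map_range[OF gc] im S(3) word_map_trivial[OF gc] by (intro w.has_moduli_desc[of "card S"]) auto
qed

context moduli_presentation
begin

lemma moduli_bound:
  obtains n where "\<And>i. i \<ge> n \<Longrightarrow> m i = 1"
proof -
  obtain n where "\<forall>i\<in>{i. m i \<noteq> 1}. i < n" using finite_moduli finite_nat_set_iff_bounded by meson
  then show ?thesis using that[of n] by (metis (mono_tags) mem_Collect_eq not_le)
qed

lemma finitely_generated: "finitely_generated_group G"
proof -
  obtain n where n: "\<And>i. i \<ge> n \<Longrightarrow> m i = 1" using moduli_bound by blast
  have "generate G ((\<lambda>i. \<phi> (std_unit i)) ` {..<n}) = carrier G" (is "generate G ?S = _")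
  proof
    show "generate G ?S \<subseteq> carrier G" by (rule generate_incl) auto
    have sub: "subgroup (generate G ?S) G" by (rule generate_is_subgroup) auto
    have "\<phi> x \<in> generate G ?S" for x
    proof -
      have "x \<in> {x. \<phi> x \<in> generate G ?S}"
      proof (rule lattice_full[OF vec_vimage_subgroup[OF sub]])
        show "y \<in> {x. \<phi> x \<in> generate G ?S}" if "\<And>i. i < n \<Longrightarrow> y i = 0" for y
        proof -
          have "int (m i) dvd y i" for i using that[of i] n[of i] by (cases "i < n") auto
          then have "\<phi> y = \<one>" by (simp add: vec_kernel)
          then show ?thesis using subgroup.one_closed[OF sub] by simp
        qed
      qed (auto intro: generate.incl)
      then show ?thesis by simp
    qed
    then show "carrier G \<subseteq> generate G ?S" using vec_surj by (metis image_subsetI)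
  qed
  then have "finite_generating_set G ?S" by (auto simp: finite_generating_set_def)
  then show ?thesis using is_group by (auto simp: finitely_generated_group_def)
qed

lemma infinite_iff: "infinite (carrier G) \<longleftrightarrow> (\<exists>i. m i = 0)"
proof
  assume inf: "infinite (carrier G)"
  show "\<exists>i. m i = 0"
  proof (rule ccontr)
    assume nz: "\<not> ?thesis"
    obtain n where n: "\<And>i. i \<ge> n \<Longrightarrow> m i = 1" using moduli_bound by blast
    have "carrier G \<subseteq> (\<lambda>f. \<phi> (\<lambda>i. if i < n then f i else 0)) ` (\<Pi>\<^sub>E i\<in>{..<n}. {0..<int (m i)})"
    proof
      fix y assume "y \<in> carrier G"
      then obtain x where y: "y = \<phi> x" using vec_surj by auto
      let ?f = "\<lambda>i\<in>{..<n}. x i mod int (m i)"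
      have "?f \<in> (\<Pi>\<^sub>E i\<in>{..<n}. {0..<int (m i)})" using nz by auto
      moreover have "y = \<phi> (\<lambda>i. if i < n then ?f i else 0)"
        unfolding y vec_eq_iff vec_kernel using n by (auto simp: minus_mod_eq_mult_div not_less)
      ultimately show "y \<in> (\<lambda>f. \<phi> (\<lambda>i. if i < n then f i else 0)) ` (\<Pi>\<^sub>E i\<in>{..<n}. {0..<int (m i)})"
        by blast
    qed
    then show False using inf finite_subset by (metis (no_types, lifting) finite_PiE finite_atLeastLessThan_int finite_imageI finite_lessThan)
  qed
next
  assume "\<exists>i. m i = 0"
  then obtain i where i: "m i = 0" by blast
  have "inj (\<lambda>k::int. \<phi> (\<lambda>j. k * std_unit i j))"
  proof (rule injI)
    fix k l :: int assume "\<phi> (\<lambda>j. k * std_unit i j) = \<phi> (\<lambda>j. l * std_unit i j)"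
    then have "int (m i) dvd ((\<lambda>j. k * std_unit i j) - (\<lambda>j. l * std_unit i j)) i"
      unfolding vec_eq_iff vec_kernel by blast
    then show "k = l" using i by (simp add: std_unit_def)
  qed
  then have "infinite (range (\<lambda>k::int. \<phi> (\<lambda>j. k * std_unit i j)))"
    using infinite_UNIV_int finite_imageD by blast
  then show "infinite (carrier G)" 
    using finite_subset[of "range (\<lambda>k::int. \<phi> (\<lambda>j. k * std_unit i j))" "carrier G"] by blast
qed

end

lemma has_moduli_iso:
  assumes "has_moduli G m" "G \<cong> H" "comm_group H"
  shows "has_moduli H m"
proof -
  obtain \<phi> where "moduli_presentation G \<phi> m" using assms(1) by (auto simp: has_moduli_def)
  then interpret moduli_presentation G \<phi> m .
  interpret H: comm_group H by fact
  obtain h where h: "h \<in> iso G H" using assms(2) by (auto simp: is_iso_def)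
  then have hom: "\<And>x y. x \<in> carrier G \<Longrightarrow> y \<in> carrier G \<Longrightarrow> h (x \<otimes>\<^bsub>G\<^esub> y) = h x \<otimes>\<^bsub>H\<^esub> h y"
    and bij: "bij_betw h (carrier G) (carrier H)" and hh: "h \<in> hom G H"
    by (auto simp: iso_def hom_def)
  have one: "h \<one>\<^bsub>G\<^esub> = \<one>\<^bsub>H\<^esub>" using hom_one[OF hh is_group H.is_group] .
  have "moduli_presentation H (h \<circ> \<phi>) m"
  proof unfold_locales
    show "(h \<circ> \<phi>) x \<in> carrier H" for x using bij by (auto simp: bij_betw_def)
    show "(h \<circ> \<phi>) (x + y) = (h \<circ> \<phi>) x \<otimes>\<^bsub>H\<^esub> (h \<circ> \<phi>) y" for x y by (simp add: vec_add hom)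
    show "range (h \<circ> \<phi>) = carrier H"
      using bij unfolding image_comp[symmetric] vec_surj by (simp add: bij_betw_def)
    show "(h \<circ> \<phi>) x = \<one>\<^bsub>H\<^esub> \<longleftrightarrow> (\<forall>i. int (m i) dvd x i)" for x
      using bij inj_on_eq_iff[of h "carrier G" "\<phi> x" "\<one>\<^bsub>G\<^esub>"]
      by (simp add: one[symmetric] vec_kernel[symmetric] bij_betw_def)
  qed (rule finite_moduli)
  then show ?thesis by (auto simp: has_moduli_def)
qed

lemma has_moduli_imp_iso:
  assumes "has_moduli G m" "has_moduli H m"
  shows "G \<cong> H"
proof -
  obtain \<phi> where "moduli_presentation G \<phi> m" using assms(1) by (auto simp: has_moduli_def)
  then interpret moduli_presentation G \<phi> m .
  obtain \<psi> where "moduli_presentation H \<psi> m" using assms(2) by (auto simp: has_moduli_def)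
  then interpret H: moduli_presentation H \<psi> m .
  have eq: "\<phi> x = \<phi> y \<longleftrightarrow> \<psi> x = \<psi> y" for x y
    by (simp add: vec_eq_iff H.vec_eq_iff vec_kernel H.vec_kernel)
  define h where "h = (\<lambda>a. \<psi> (inv_into UNIV \<phi> a))"
  have h: "h (\<phi> x) = \<psi> x" for x
    unfolding h_def using eq f_inv_into_f[of "\<phi> x" \<phi> UNIV] by blast
  have "h \<in> hom G H"
  proof (rule homI)
    fix a b assume "a \<in> carrier G" "b \<in> carrier G"
    then obtain x y where ab: "a = \<phi> x" "b = \<phi> y" by (auto simp flip: vec_surj)
    show "h a \<in> carrier H" by (simp add: ab h)
    show "h (a \<otimes>\<^bsub>G\<^esub> b) = h a \<otimes>\<^bsub>H\<^esub> h b"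
      by (simp add: ab h H.vec_add flip: vec_add)
  qed
  moreover have "inj_on h (carrier G)"
    unfolding vec_surj[symmetric] using h eq by (intro inj_onI) auto
  moreover have "h ` carrier G = carrier H"
    unfolding vec_surj[symmetric] H.vec_surj[symmetric] image_image h ..
  ultimately have "h \<in> iso G H" by (simp add: iso_def bij_betw_def)
  then show ?thesis by (auto simp: is_iso_def)
qed

section \<open>Numerical invariants read off from q-power subgroups\<close>

section \<open>Counting power classes\<close>


text \<open>The order of the subgroup of elements killed by \<open>q\<close> inside the
  \<open>q ^ j\<close>-th powers; the drops of its \<open>q\<close>-logarithm from \<open>j\<close>
  to \<open>Suc j\<close> are the Ulm invariants.\<close>

definition tors_count :: "('a, 'm) monoid_scheme \<Rightarrow> nat \<Rightarrow> nat \<Rightarrow> nat" where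
  "tors_count G q j = card {x [^]\<^bsub>G\<^esub> (q ^ j) | x. x \<in> carrier G \<and> x [^]\<^bsub>G\<^esub> (q ^ Suc j) = \<one>\<^bsub>G\<^esub>}"

definition power_coset :: "('a, 'm) monoid_scheme \<Rightarrow> nat \<Rightarrow> nat \<Rightarrow> 'a \<Rightarrow> 'a set" where
  "power_coset G q j x = {x [^]\<^bsub>G\<^esub> (q ^ j) \<otimes>\<^bsub>G\<^esub> z [^]\<^bsub>G\<^esub> (q ^ Suc j) | z. z \<in> carrier G}"

definition quot_count :: "('a, 'm) monoid_scheme \<Rightarrow> nat \<Rightarrow> nat \<Rightarrow> nat" where
  "quot_count G q j = card (power_coset G q j ` carrier G)"

lemma card_image_le_of_factor:
  assumes "finite (f ` A)" "\<And>x y. x \<in> A \<Longrightarrow> y \<in> A \<Longrightarrow> f x = f y \<Longrightarrow> g x = g y"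
  shows "finite (g ` A)" "card (g ` A) \<le> card (f ` A)"
proof -
  have "g x = g (inv_into A f (f x))" if "x \<in> A" for x
    using that f_inv_into_f[of "f x" f A] inv_into_into[of "f x" f A] by (intro assms(2)) auto
  then have "g ` A = (\<lambda>c. g (inv_into A f c)) ` (f ` A)"
    unfolding image_image by (rule image_cong[OF refl])
  then show "finite (g ` A)" "card (g ` A) \<le> card (f ` A)"
    using assms(1) by (simp_all add: card_image_le)
qed

lemma card_image_eq_of_iff:
  assumes "finite (f ` A)" "\<And>x y. x \<in> A \<Longrightarrow> y \<in> A \<Longrightarrow> f x = f y \<longleftrightarrow> g x = g y"
  shows "card (g ` A) = card (f ` A)"
proof (rule le_antisym)
  show "card (g ` A) \<le> card (f ` A)"
    by (rule card_image_le_of_factor(2)[OF assms(1)]) (simp add: assms(2)[symmetric])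
  have "finite (g ` A)"
    by (rule card_image_le_of_factor(1)[OF assms(1)]) (simp add: assms(2)[symmetric])
  then show "card (f ` A) \<le> card (g ` A)"
    by (rule card_image_le_of_factor(2)) (simp add: assms(2))
qed

lemma card_residues:
  assumes "finite J" "q > 0"
  shows "finite (range (\<lambda>x :: nat \<Rightarrow> int. \<lambda>i\<in>J. x i mod int q))"
    and "card (range (\<lambda>x :: nat \<Rightarrow> int. \<lambda>i\<in>J. x i mod int q)) = q ^ card J"
proof -
  have "range (\<lambda>x :: nat \<Rightarrow> int. \<lambda>i\<in>J. x i mod int q) = (\<Pi>\<^sub>E i\<in>J. {0..<int q})"
  proof
    show "(\<Pi>\<^sub>E i\<in>J. {0..<int q}) \<subseteq> range (\<lambda>x :: nat \<Rightarrow> int. \<lambda>i\<in>J. x i mod int q)"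
    proof
      fix f assume f: "f \<in> (\<Pi>\<^sub>E i\<in>J. {0..<int q})"
      have "f i = (\<lambda>i\<in>J. f i mod int q) i" for i
        using PiE_arb[OF f, of i] PiE_mem[OF f, of i] by (cases "i \<in> J") auto
      then have "f = (\<lambda>i\<in>J. f i mod int q)" by blast
      then show "f \<in> range (\<lambda>x :: nat \<Rightarrow> int. \<lambda>i\<in>J. x i mod int q)" by (rule range_eqI[of _ _ f])
    qed
  qed (use assms(2) in auto)
  then show "finite (range (\<lambda>x :: nat \<Rightarrow> int. \<lambda>i\<in>J. x i mod int q))"
    and "card (range (\<lambda>x :: nat \<Rightarrow> int. \<lambda>i\<in>J. x i mod int q)) = q ^ card J"
    using assms(1) by (simp_all add: finite_PiE card_PiE)
qed

lemma residues_eq_iff: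
  "(\<lambda>i\<in>J. x i mod int q) = (\<lambda>i\<in>J. y i mod int q) \<longleftrightarrow> (\<forall>i\<in>J. int q dvd x i - y i)"
  unfolding fun_eq_iff by (auto simp: mod_eq_dvd_iff)

lemma prime_power_gcd:
  fixes m q :: nat
  assumes "prime q" "\<not> q ^ Suc j dvd m"
  shows "gcd (int m) (int q ^ Suc j) dvd int q ^ j"
proof -
  have "gcd m (q ^ Suc j) dvd q ^ Suc j" by simp
  then obtain l where l: "l \<le> Suc j" "gcd m (q ^ Suc j) = q ^ l"
    using divides_primepow_nat[OF assms(1)] by blast
  have "l \<noteq> Suc j" using assms(2) l(2) by (metis gcd_dvd1)
  then have "gcd m (q ^ Suc j) dvd q ^ j" using l by (simp add: le_imp_power_dvd)
  then have "int (gcd m (q ^ Suc j)) dvd int (q ^ j)" by (simp only: int_dvd_int_iff)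
  then show ?thesis by (simp only: gcd_int_int_eq[symmetric] of_nat_power)
qed

lemma prime_power_div_cases:
  fixes m q :: nat
  assumes "prime q" "\<not> q ^ Suc j dvd m" "int m dvd int q ^ Suc j * w"
  shows "int m dvd int q ^ j * w"
proof -
  have "int m dvd gcd (int m * w) (int q ^ Suc j * w)" using assms(3) by simp
  also have "gcd (int m * w) (int q ^ Suc j * w) dvd gcd (int m) (int q ^ Suc j) * w"
    by (simp add: gcd_mult_right[symmetric] mult.commute[of _ w] gcd_mult_left)
  also have "\<dots> dvd int q ^ j * w" using prime_power_gcd[OF assms(1,2)] by (rule mult_dvd_mono) simp
  finally show ?thesis .
qed

text \<open>The computation in one cyclic summand. If \<open>q ^ Suc j\<close> does not divide
  \<open>m\<close>, then by Bezout \<open>q ^ j\<close> is a multiple of \<open>q ^ Suc j\<close>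
  modulo \<open>m\<close>; otherwise \<open>q ^ j\<close> can be cancelled.\<close>

lemma power_residue_iff:
  fixes m q :: nat
  assumes "prime q"
  shows "(\<exists>z. int m dvd int q ^ j * w - int q ^ Suc j * z) \<longleftrightarrow> (q ^ Suc j dvd m \<longrightarrow> int q dvd w)"
proof
  assume "\<exists>z. int m dvd int q ^ j * w - int q ^ Suc j * z"
  then obtain z where z: "int m dvd int q ^ j * w - int q ^ Suc j * z" by blast
  show "q ^ Suc j dvd m \<longrightarrow> int q dvd w"
  proof
    assume "q ^ Suc j dvd m"
    then have "int (q ^ Suc j) dvd int m" by (simp only: int_dvd_int_iff)
    then have "int q ^ j * int q dvd int q ^ j * (w - int q * z)"
      using dvd_trans[OF _ z] by (simp add: algebra_simps)
    then have "int q dvd w - int q * z"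
      using prime_gt_0_nat[OF assms] by (subst (asm) dvd_mult_cancel_left) simp
    then have "int q dvd (w - int q * z) + int q * z" by (rule dvd_add) simp
    then show "int q dvd w" by simp
  qed
next
  assume h: "q ^ Suc j dvd m \<longrightarrow> int q dvd w"
  show "\<exists>z. int m dvd int q ^ j * w - int q ^ Suc j * z"
  proof (cases "q ^ Suc j dvd m")
    case True
    then obtain v where "w = int q * v" using h by blast
    then show ?thesis by (intro exI[of _ v]) simp
  next
    case False
    obtain u v where uv: "u * int m + v * int q ^ Suc j = gcd (int m) (int q ^ Suc j)"
      using bezout_int by blast
    obtain d where d: "int q ^ j = gcd (int m) (int q ^ Suc j) * d"
      using prime_power_gcd[OF assms False] by blast
    have "int q ^ j * w - int q ^ Suc j * (v * d * w) = int m * (u * d * w)"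
      unfolding d by (subst uv[symmetric]) (simp add: algebra_simps)
    then show ?thesis by (intro exI[of _ "v * d * w"]) simp
  qed
qed

lemma (in comm_group) power_coset_eq_iff:
  assumes "x \<in> carrier G" "y \<in> carrier G"
  shows "power_coset G q j x = power_coset G q j y \<longleftrightarrow>
    (\<exists>z\<in>carrier G. x [^] (q ^ j) = y [^] (q ^ j) \<otimes> z [^] (q ^ Suc j))"
proof
  assume eq: "power_coset G q j x = power_coset G q j y"
  have "x [^] (q ^ j) \<otimes> \<one> [^] (q ^ Suc j) \<in> power_coset G q j x"
    unfolding power_coset_def by blast
  then have "x [^] (q ^ j) \<in> power_coset G q j y" using eq assms(1) by simp
  then show "\<exists>z\<in>carrier G. x [^] (q ^ j) = y [^] (q ^ j) \<otimes> z [^] (q ^ Suc j)"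
    unfolding power_coset_def by blast
next
  assume "\<exists>z\<in>carrier G. x [^] (q ^ j) = y [^] (q ^ j) \<otimes> z [^] (q ^ Suc j)"
  then obtain z where z: "z \<in> carrier G" "x [^] (q ^ j) = y [^] (q ^ j) \<otimes> z [^] (q ^ Suc j)" by blast
  have pow: "(a \<otimes> b) [^] (k::nat) = a [^] k \<otimes> b [^] k"
    if "a \<in> carrier G" "b \<in> carrier G" for a b k
    using that by (rule nat_pow_distrib)
  show "power_coset G q j x = power_coset G q j y"
  proof
    show "power_coset G q j x \<subseteq> power_coset G q j y"
    proof
      fix w assume "w \<in> power_coset G q j x"
      then obtain v where "v \<in> carrier G" "w = x [^] (q ^ j) \<otimes> v [^] (q ^ Suc j)"
        unfolding power_coset_def by blast
      then have "w = y [^] (q ^ j) \<otimes> (z \<otimes> v) [^] (q ^ Suc j)" "z \<otimes> v \<in> carrier G"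
        using z assms by (simp_all add: pow m_assoc)
      then show "w \<in> power_coset G q j y" unfolding power_coset_def by blast
    qed
    show "power_coset G q j y \<subseteq> power_coset G q j x"
    proof
      fix w assume "w \<in> power_coset G q j y"
      then obtain v where v: "v \<in> carrier G" "w = y [^] (q ^ j) \<otimes> v [^] (q ^ Suc j)"
        unfolding power_coset_def by blast
      have "z [^] (q ^ Suc j) \<otimes> (inv z \<otimes> v) [^] (q ^ Suc j) = v [^] (q ^ Suc j)"
        using v(1) z(1) by (subst pow[symmetric]) (simp_all add: m_assoc[symmetric])
      then have "w = x [^] (q ^ j) \<otimes> (inv z \<otimes> v) [^] (q ^ Suc j)" "inv z \<otimes> v \<in> carrier G"
        using z v assms by (simp_all add: m_assoc)
      then show "w \<in> power_coset G q j x" unfolding power_coset_def by blast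
    qed
  qed
qed

lemma (in vec_hom) vec_power_coset_eq_iff:
  assumes "range \<phi> = carrier G"
  shows "power_coset G q j (\<phi> x) = power_coset G q j (\<phi> y) \<longleftrightarrow>
    (\<exists>z. \<phi> (\<lambda>i. int q ^ j * (x i - y i) - int q ^ Suc j * z i) = \<one>)"
proof -
  have "power_coset G q j (\<phi> x) = power_coset G q j (\<phi> y) \<longleftrightarrow>
      (\<exists>z. \<phi> (\<lambda>i. int (q ^ j) * x i) = \<phi> ((\<lambda>i. int (q ^ j) * y i) + (\<lambda>i. int (q ^ Suc j) * z i)))"
    unfolding power_coset_eq_iff[OF vec_closed vec_closed] assms[symmetric] vec_add
    by (simp add: vec_nat_pow)
  also have "\<dots> \<longleftrightarrow> (\<exists>z. \<phi> (\<lambda>i. int q ^ j * (x i - y i) - int q ^ Suc j * z i) = \<one>)"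
    unfolding vec_eq_iff by (simp add: algebra_simps fun_diff_def plus_fun_def)
  finally show ?thesis .
qed

context moduli_presentation
begin

lemma finite_dvd_moduli: "k \<noteq> 1 \<Longrightarrow> finite {i. k dvd m i}"
  by (rule finite_subset[OF _ finite_moduli]) auto

text \<open>A coset is determined by the residues modulo \<open>q\<close> of the coordinates with
  \<open>q ^ Suc j dvd m i\<close>. Modulus 0 satisfies this for all \<open>j\<close>, which is how
  the free rank gets counted.\<close>

lemma quot_count:
  assumes q: "prime q"
  shows "quot_count G q j = q ^ card {i. q ^ Suc j dvd m i}"
    and "finite (power_coset G q j ` carrier G)"
proof -
  let ?J = "{i. q ^ Suc j dvd m i}"
  have J: "finite ?J" using finite_dvd_moduli[of "q ^ Suc j"] prime_gt_1_nat[OF q] by simp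
  have eq: "power_coset G q j (\<phi> x) = power_coset G q j (\<phi> y) \<longleftrightarrow>
      (\<lambda>i\<in>?J. x i mod int q) = (\<lambda>i\<in>?J. y i mod int q)" for x y
  proof -
    have "power_coset G q j (\<phi> x) = power_coset G q j (\<phi> y) \<longleftrightarrow>
        (\<exists>z. \<forall>i. int (m i) dvd int q ^ j * (x i - y i) - int q ^ Suc j * z i)"
      unfolding vec_power_coset_eq_iff[OF vec_surj] vec_kernel ..
    also have "\<dots> \<longleftrightarrow> (\<forall>i. \<exists>z. int (m i) dvd int q ^ j * (x i - y i) - int q ^ Suc j * z)"
      by metis
    also have "\<dots> \<longleftrightarrow> (\<forall>i\<in>?J. int q dvd x i - y i)"
      unfolding power_residue_iff[OF q] by auto
    finally show ?thesis by (simp only: residues_eq_iff)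
  qed
  have img: "power_coset G q j ` carrier G = range (\<lambda>x. power_coset G q j (\<phi> x))"
    by (simp add: vec_surj[symmetric] image_image)
  note fin = card_residues[OF J prime_gt_0_nat[OF q]]
  show "quot_count G q j = q ^ card ?J"
    unfolding quot_count_def img fin(2)[symmetric]
    by (rule card_image_eq_of_iff[OF fin(1)]) (simp add: eq)
  show "finite (power_coset G q j ` carrier G)"
    unfolding img by (rule card_image_le_of_factor[OF fin(1)]) (simp add: eq)
qed

lemma tors_count:
  assumes q: "prime q"
  shows "tors_count G q j = q ^ card {i. m i \<noteq> 0 \<and> q ^ Suc j dvd m i}"
    and "finite {x [^] (q ^ j) | x. x \<in> carrier G \<and> x [^] (q ^ Suc j) = \<one>}"
proof -
  let ?J = "{i. m i \<noteq> 0 \<and> q ^ Suc j dvd m i}"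
  have J: "finite ?J"
    using finite_dvd_moduli[of "q ^ Suc j"] prime_gt_1_nat[OF q] by (auto intro: finite_subset)
  define r where "r = (\<lambda>i. m i div q ^ Suc j)"
  have mr: "int (m i) = int q ^ Suc j * int (r i)" "r i \<noteq> 0" if "i \<in> ?J" for i
    using that by (auto simp: r_def simp flip: of_nat_power of_nat_mult)
  \<comment> \<open>In a finite summand of order \<open>m i\<close> divisible by
    \<open>q ^ Suc j\<close>, the elements killed by \<open>q\<close> are the multiples of
    \<open>m i div q\<close>, which is \<open>q ^ j * r i\<close>. The other coordinates contribute
    nothing.\<close>
  define h where "h = (\<lambda>y i. int q ^ j * (if i \<in> ?J then int (r i) * y i else 0))"
  have q0: "int q \<noteq> 0" using prime_gt_0_nat[OF q] by simp
  have eq: "\<phi> (h x) = \<phi> (h y) \<longleftrightarrow> (\<lambda>i\<in>?J. x i mod int q) = (\<lambda>i\<in>?J. y i mod int q)" for x y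
  proof -
    have "int (m i) dvd (h x - h y) i \<longleftrightarrow> (i \<in> ?J \<longrightarrow> int q dvd x i - y i)" for i
    proof (cases "i \<in> ?J")
      case True
      have "(h x - h y) i = (int q ^ j * int (r i)) * (x i - y i)"
        using True by (simp add: h_def algebra_simps)
      moreover have "int (m i) = (int q ^ j * int (r i)) * int q" using mr(1)[OF True] by simp
      ultimately show ?thesis using True mr(2)[OF True] q0 by simp
    next
      case False
      then show ?thesis unfolding h_def fun_diff_def by (simp only: if_False) simp
    qed
    then show ?thesis unfolding vec_eq_iff vec_kernel residues_eq_iff by simp
  qed
  have img: "{x [^] (q ^ j) | x. x \<in> carrier G \<and> x [^] (q ^ Suc j) = \<one>} = range (\<lambda>y. \<phi> (h y))"
  proof
    show "range (\<lambda>y. \<phi> (h y)) \<subseteq> {x [^] (q ^ j) | x. x \<in> carrier G \<and> x [^] (q ^ Suc j) = \<one>}"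
    proof
      fix a assume "a \<in> range (\<lambda>y. \<phi> (h y))"
      then obtain y where a: "a = \<phi> (h y)" by auto
      define x where "x = (\<lambda>i. if i \<in> ?J then int (r i) * y i else 0)"
      have "int (m i) dvd int (q ^ Suc j) * x i" for i
        using mr(1)[of i] by (cases "i \<in> ?J") (simp_all add: x_def)
      then have "\<phi> x [^] (q ^ Suc j) = \<one>" unfolding vec_nat_pow vec_kernel by blast
      moreover have "\<phi> x [^] (q ^ j) = a" by (simp add: vec_nat_pow a h_def x_def)
      ultimately show "a \<in> {x [^] (q ^ j) | x. x \<in> carrier G \<and> x [^] (q ^ Suc j) = \<one>}" by blast
    qed
    show "{x [^] (q ^ j) | x. x \<in> carrier G \<and> x [^] (q ^ Suc j) = \<one>} \<subseteq> range (\<lambda>y. \<phi> (h y))"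
    proof
      fix a assume "a \<in> {x [^] (q ^ j) | x. x \<in> carrier G \<and> x [^] (q ^ Suc j) = \<one>}"
      then obtain x where a: "a = \<phi> x [^] (q ^ j)" and x: "\<phi> x [^] (q ^ Suc j) = \<one>"
        by (auto simp flip: vec_surj)
      have d: "int (m i) dvd int q ^ Suc j * x i" for i
        using x unfolding vec_nat_pow vec_kernel by simp
      have "int (m i) dvd ((\<lambda>i. int (q ^ j) * x i) - h (\<lambda>i. x i div int (r i))) i" for i
      proof (cases "i \<in> ?J")
        case True
        have "int q ^ Suc j * int (r i) dvd int q ^ Suc j * x i" using d[of i] mr(1)[OF True] by simp
        then have "int (r i) dvd x i" using q0 by (subst (asm) dvd_mult_cancel_left) simp
        then show ?thesis using True by (simp add: h_def)
      next
        case False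
        have "int (m i) dvd int q ^ j * x i"
        proof (cases "m i = 0")
          case True
          then show ?thesis using d[of i] q0 by simp
        next
          case nz: False
          then have "\<not> q ^ Suc j dvd m i" using False by simp
          then show ?thesis using prime_power_div_cases[OF q _ d] by simp
        qed
        moreover have "((\<lambda>i. int (q ^ j) * x i) - h (\<lambda>i. x i div int (r i))) i = int q ^ j * x i"
          unfolding h_def fun_diff_def if_not_P[OF False] by simp
        ultimately show ?thesis by simp
      qed
      then have "a = \<phi> (h (\<lambda>i. x i div int (r i)))"
        unfolding a vec_nat_pow vec_eq_iff vec_kernel by blast
      then show "a \<in> range (\<lambda>y. \<phi> (h y))" by simp
    qed
  qed
  note fin = card_residues[OF J prime_gt_0_nat[OF q]]
  show "tors_count G q j = q ^ card ?J"
    unfolding tors_count_def img fin(2)[symmetric]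
    by (rule card_image_eq_of_iff[OF fin(1)]) (simp add: eq)
  show "finite {x [^] (q ^ j) | x. x \<in> carrier G \<and> x [^] (q ^ Suc j) = \<one>}"
    unfolding img by (rule card_image_le_of_factor[OF fin(1)]) (simp add: eq)
qed

end

section \<open>Balls described by exponent vectors of bounded length\<close>

section \<open>Balls in Cayley graphs\<close>


text \<open>The least length of a word with exponent vector \<open>x\<close>; in an abelian group
  only the exponents of a word matter.\<close>

definition vnorm :: "nat \<Rightarrow> (nat \<Rightarrow> int) \<Rightarrow> nat" where
  "vnorm n x = (\<Sum>i<n. nat \<bar>x i\<bar>)"

lemma vnorm_diff_le: "vnorm n (x - y) \<le> vnorm n x + vnorm n y"
  unfolding vnorm_def sum.distrib[symmetric] by (intro sum_mono) auto

lemma vnorm_mult: "vnorm n (\<lambda>i. int k * x i) = k * vnorm n x"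
  unfolding vnorm_def sum_distrib_left by (intro sum.cong) (auto simp: abs_mult nat_mult_distrib)

lemma vnorm_std_unit_le: "vnorm n (std_unit i) \<le> 1"
proof -
  have "vnorm n (std_unit i) = (\<Sum>j<n. if j = i then 1 else 0)"
    unfolding vnorm_def by (intro sum.cong) (auto simp: std_unit_def)
  then show ?thesis by simp
qed

lemma vnorm_uminus [simp]: "vnorm n (- x) = vnorm n x"
  by (simp add: vnorm_def)

lemma vnorm_add_le: "vnorm n (x + y) \<le> vnorm n x + vnorm n y"
  using vnorm_diff_le[of n x "- y"] by simp

lemma vnorm_eq_0_iff: "vnorm n x = 0 \<longleftrightarrow> (\<forall>i<n. x i = 0)"
  by (auto simp: vnorm_def)

lemma vnorm_component_le: "i < n \<Longrightarrow> nat \<bar>x i\<bar> \<le> vnorm n x"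
  unfolding vnorm_def by (rule member_le_sum) auto

lemma vnorm_decrease:
  assumes "vnorm n x = Suc R"
  obtains i where "i < n" "x i > 0" "vnorm n (x - std_unit i) = R"
  | i where "i < n" "x i < 0" "vnorm n (x + std_unit i) = R"
proof -
  obtain i where i: "i < n" "x i \<noteq> 0" using assms vnorm_eq_0_iff[of n x] by auto
  have split: "vnorm n y = nat \<bar>y i\<bar> + (\<Sum>j\<in>{..<n} - {i}. nat \<bar>y j\<bar>)" for y
    unfolding vnorm_def using i(1) by (intro sum.remove) auto
  have "(\<Sum>j\<in>{..<n} - {i}. nat \<bar>(x - std_unit i) j\<bar>) = (\<Sum>j\<in>{..<n} - {i}. nat \<bar>x j\<bar>)"
    and "(\<Sum>j\<in>{..<n} - {i}. nat \<bar>(x + std_unit i) j\<bar>) = (\<Sum>j\<in>{..<n} - {i}. nat \<bar>x j\<bar>)"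
    by (auto intro!: sum.cong simp: std_unit_def)
  then have "x i > 0 \<Longrightarrow> vnorm n (x - std_unit i) = R" "x i < 0 \<Longrightarrow> vnorm n (x + std_unit i) = R"
    using split[of x] split[of "x - std_unit i"] split[of "x + std_unit i"] assms
    by (auto simp: std_unit_def)
  then show ?thesis using that i by (cases "x i > 0") auto
qed

context comm_group
begin

context
  fixes g :: "nat \<Rightarrow> 'a" and n :: nat
  assumes g: "g \<in> {..<n} \<rightarrow> carrier G"
begin

interpretation w: vec_hom G "word_map G g n" by (rule word_map_hom[OF g])

lemma word_map_add_unit: "i < n \<Longrightarrow> word_map G g n (x + std_unit i) = word_map G g n x \<otimes> g i"
  using w.vec_add word_map_unit[OF g] by simp

text \<open>Adjacency becomes triviality of a word, so that two Cayley graphs can be compared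
  through kernels.\<close>

lemma word_map_edge_iff:
  assumes "i < n"
  shows "(word_map G g n x, g i, word_map G g n y) \<in> cayley_edges G (g ` {..<n}) \<longleftrightarrow>
    word_map G g n (x + std_unit i - y) = \<one>"
  unfolding w.vec_eq_iff[symmetric] word_map_add_unit[OF assms]
  using assms by (auto simp: cayley_edges_def)

lemma cayley_ball_eq: "cayley_ball G (g ` {..<n}) R = {word_map G g n x | x. vnorm n x \<le> R}"
proof (induction R)
  case 0
  have "word_map G g n x = \<one>" if "vnorm n x = 0" for x
    using that word_map_trivial[OF g, of x] by (auto simp: vnorm_eq_0_iff)
  moreover have "vnorm n 0 = 0" by (simp add: vnorm_eq_0_iff)
  ultimately have "{word_map G g n x | x. vnorm n x \<le> 0} = {\<one>}" by (auto intro!: exI[of _ 0] simp: w.vec_zero)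
  then show ?case by simp
next
  case (Suc R)
  show ?case
  proof
    show "cayley_ball G (g ` {..<n}) (Suc R) \<subseteq> {word_map G g n x | x. vnorm n x \<le> Suc R}"
    proof
      fix b assume "b \<in> cayley_ball G (g ` {..<n}) (Suc R)"
      then consider "b \<in> cayley_ball G (g ` {..<n}) R"
        | a s where "a \<in> cayley_ball G (g ` {..<n}) R" "(a, s, b) \<in> cayley_edges G (g ` {..<n})"
        | a s where "a \<in> cayley_ball G (g ` {..<n}) R" "(b, s, a) \<in> cayley_edges G (g ` {..<n})"
        by auto
      then show "b \<in> {word_map G g n x | x. vnorm n x \<le> Suc R}"
      proof cases
        case 1
        then show ?thesis using Suc.IH by fastforce
      next
        case (2 a s)
        then obtain x i where x: "a = word_map G g n x" "vnorm n x \<le> R"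
          and i: "i < n" "b = a \<otimes> g i"
          using Suc.IH by (auto simp: cayley_edges_def)
        have "b = word_map G g n (x + std_unit i)" using word_map_add_unit i x by simp
        moreover have "vnorm n (x + std_unit i) \<le> Suc R"
          using vnorm_add_le[of n x "std_unit i"] vnorm_std_unit_le[of n i] x(2) by linarith
        ultimately show ?thesis by blast
      next
        case (3 a s)
        then obtain x i where x: "a = word_map G g n x" "vnorm n x \<le> R"
          and i: "i < n" "a = b \<otimes> g i" and b: "b \<in> carrier G"
          using Suc.IH by (auto simp: cayley_edges_def)
        have "g i \<in> carrier G" using g i by auto
        then have "b = a \<otimes> inv (g i)" using b i by (simp add: m_assoc)
        then have "b = word_map G g n (x - std_unit i)"
          using w.vec_diff[of x "std_unit i"] word_map_unit[OF g i(1)] x(1) by simp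
        moreover have "vnorm n (x - std_unit i) \<le> Suc R"
          using vnorm_diff_le[of n x "std_unit i"] vnorm_std_unit_le[of n i] x(2) by linarith
        ultimately show ?thesis by blast
      qed
    qed
    show "{word_map G g n x | x. vnorm n x \<le> Suc R} \<subseteq> cayley_ball G (g ` {..<n}) (Suc R)"
    proof
      fix b assume "b \<in> {word_map G g n x | x. vnorm n x \<le> Suc R}"
      then obtain x where b: "b = word_map G g n x" "vnorm n x \<le> Suc R" by blast
      show "b \<in> cayley_ball G (g ` {..<n}) (Suc R)"
      proof (cases "vnorm n x \<le> R")
        case True
        then show ?thesis using Suc.IH b(1) by auto
      next
        case False
        then have "vnorm n x = Suc R" using b(2) by simp
        then show ?thesis
        proof (cases rule: vnorm_decrease)
          case (1 i)
          have "word_map G g n (x - std_unit i) \<in> cayley_ball G (g ` {..<n}) R"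
            using Suc.IH 1(3) by auto
          moreover have "(word_map G g n (x - std_unit i), g i, b) \<in> cayley_edges G (g ` {..<n})"
            unfolding b(1) word_map_edge_iff[OF 1(1)] by (simp add: w.vec_zero)
          ultimately show ?thesis by auto
        next
          case (2 i)
          have "word_map G g n (x + std_unit i) \<in> cayley_ball G (g ` {..<n}) R"
            using Suc.IH 2(3) by auto
          moreover have "(b, g i, word_map G g n (x + std_unit i)) \<in> cayley_edges G (g ` {..<n})"
            unfolding b(1) word_map_edge_iff[OF 2(1)] by (simp add: w.vec_zero)
          ultimately show ?thesis by auto
        qed
      qed
    qed
  qed
qed

end

end

text \<open>A label and one endpoint determine an edge, so \<open>\<phi>\<close> carries words in
  \<open>g\<close> to the same words in \<open>h\<close>, by following a shortest path from the
  root. Injectivity then transfers triviality.\<close>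

lemma balls_isomorphic_imp_kernel:
  assumes G: "comm_group G" and H: "comm_group H"
    and g: "g \<in> {..<n} \<rightarrow> carrier G" and h: "h \<in> {..<n} \<rightarrow> carrier H"
    and \<beta>: "\<And>i. i < n \<Longrightarrow> \<beta> (g i) = h i"
    and iso: "cayley_balls_isomorphic R \<beta> G (g ` {..<n}) H (h ` {..<n})"
    and x: "vnorm n x \<le> R"
  shows "word_map G g n x = \<one>\<^bsub>G\<^esub> \<longleftrightarrow> word_map H h n x = \<one>\<^bsub>H\<^esub>"
proof -
  interpret G: comm_group G by fact
  interpret H: comm_group H by fact
  interpret w: vec_hom G "word_map G g n" by (rule G.word_map_hom[OF g])
  interpret v: vec_hom H "word_map H h n" by (rule H.word_map_hom[OF h])
  let ?B = "cayley_ball G (g ` {..<n}) R"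
  obtain \<phi> where bij: "bij_betw \<phi> ?B (cayley_ball H (h ` {..<n}) R)" and one: "\<phi> \<one>\<^bsub>G\<^esub> = \<one>\<^bsub>H\<^esub>"
    and edges: "\<And>a b s. a \<in> ?B \<Longrightarrow> b \<in> ?B \<Longrightarrow> s \<in> g ` {..<n} \<Longrightarrow>
      (a, s, b) \<in> cayley_edges G (g ` {..<n}) \<longleftrightarrow> (\<phi> a, \<beta> s, \<phi> b) \<in> cayley_edges H (h ` {..<n})"
    using iso unfolding cayley_balls_isomorphic_def by blast
  have inB: "word_map G g n x \<in> ?B" if "vnorm n x \<le> R" for x
    using that by (auto simp: G.cayley_ball_eq[OF g])
  have edge: "\<phi> (word_map G g n (x + std_unit i)) = \<phi> (word_map G g n x) \<otimes>\<^bsub>H\<^esub> h i"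
    if "i < n" "vnorm n x \<le> R" "vnorm n (x + std_unit i) \<le> R" for x i
  proof -
    have "(word_map G g n x, g i, word_map G g n (x + std_unit i)) \<in> cayley_edges G (g ` {..<n})"
      unfolding G.word_map_edge_iff[OF g that(1)] by (simp add: w.vec_zero)
    then have "(\<phi> (word_map G g n x), h i, \<phi> (word_map G g n (x + std_unit i))) \<in> cayley_edges H (h ` {..<n})"
      using edges[OF inB inB, of x "x + std_unit i" "g i"] that \<beta> by simp
    then show ?thesis by (simp add: cayley_edges_def)
  qed
  have "vnorm n x \<le> R \<Longrightarrow> \<phi> (word_map G g n x) = word_map H h n x" for x
  proof (induction "vnorm n x" arbitrary: x)
    case 0
    then show ?case
      using G.word_map_trivial[OF g, of x] H.word_map_trivial[OF h, of x] one vnorm_eq_0_iff[of n x] by simp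
  next
    case (Suc k)
    from Suc.hyps(2)[symmetric] show ?case
    proof (cases rule: vnorm_decrease)
      case (1 i)
      have "\<phi> (word_map G g n (x - std_unit i)) = word_map H h n (x - std_unit i)"
        using Suc.hyps(1)[of "x - std_unit i"] 1(3) Suc.hyps(2) Suc.prems by simp
      then have "\<phi> (word_map G g n x) = word_map H h n (x - std_unit i) \<otimes>\<^bsub>H\<^esub> h i"
        using edge[OF 1(1), of "x - std_unit i"] 1(3) Suc.hyps(2) Suc.prems by simp
      then show ?thesis using H.word_map_add_unit[OF h 1(1), of "x - std_unit i"] by simp
    next
      case (2 i)
      have "\<phi> (word_map G g n (x + std_unit i)) = word_map H h n (x + std_unit i)"
        using Suc.hyps(1)[of "x + std_unit i"] 2(3) Suc.hyps(2) Suc.prems by simp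
      \<comment> \<open>A negative exponent means traversing an edge backwards, so the endpoint is
        recovered by cancelling \<open>h i\<close>.\<close>
      then have eq: "word_map H h n x \<otimes>\<^bsub>H\<^esub> h i = \<phi> (word_map G g n x) \<otimes>\<^bsub>H\<^esub> h i"
        using edge[OF 2(1), of x] H.word_map_add_unit[OF h 2(1), of x] 2(3) Suc.hyps(2) Suc.prems by simp
      have "\<phi> (word_map G g n x) \<in> cayley_ball H (h ` {..<n}) R"
        using bij inB[OF Suc.prems] by (auto simp: bij_betw_def)
      then have "\<phi> (word_map G g n x) \<in> carrier H"
        by (auto simp: H.cayley_ball_eq[OF h])
      moreover have "h i \<in> carrier H" using 2(1) h by auto
      ultimately show ?thesis using eq H.right_cancel[of "h i" "word_map H h n x" "\<phi> (word_map G g n x)"] by simp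
    qed
  qed
  from this[OF x] have "\<phi> (word_map G g n x) = word_map H h n x" .
  moreover have "\<one>\<^bsub>G\<^esub> \<in> ?B" using inB[of 0] by (simp add: w.vec_zero vnorm_def)
  ultimately show ?thesis
    using bij inB[OF x] one inj_on_eq_iff[of \<phi> ?B "word_map G g n x" "\<one>\<^bsub>G\<^esub>"]
    by (simp add: bij_betw_def)
qed

text \<open>The bound \<open>2 * R + 1\<close> arises from an edge inside the ball: two vertices of
  norm at most \<open>R\<close> and one generator.\<close>

lemma kernel_imp_balls_isomorphic:
  assumes G: "comm_group G" and H: "comm_group H"
    and g: "g \<in> {..<n} \<rightarrow> carrier G" and h: "h \<in> {..<n} \<rightarrow> carrier H"
    and \<beta>: "\<And>i. i < n \<Longrightarrow> \<beta> (g i) = h i"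
    and ker: "\<And>x. vnorm n x \<le> 2 * R + 1 \<Longrightarrow>
      word_map G g n x = \<one>\<^bsub>G\<^esub> \<longleftrightarrow> word_map H h n x = \<one>\<^bsub>H\<^esub>"
  shows "cayley_balls_isomorphic R \<beta> G (g ` {..<n}) H (h ` {..<n})"
proof -
  interpret G: comm_group G by fact
  interpret H: comm_group H by fact
  interpret w: vec_hom G "word_map G g n" by (rule G.word_map_hom[OF g])
  interpret v: vec_hom H "word_map H h n" by (rule H.word_map_hom[OF h])
  define V where "V = {x. vnorm n x \<le> R}"
  have eq: "word_map G g n x = word_map G g n y \<longleftrightarrow> word_map H h n x = word_map H h n y"
    if "x \<in> V" "y \<in> V" for x y
    unfolding w.vec_eq_iff v.vec_eq_iff
    using that vnorm_diff_le[of n x y] by (intro ker) (simp add: V_def)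
  define \<phi> where "\<phi> = (\<lambda>a. word_map H h n (inv_into V (word_map G g n) a))"
  have \<phi>: "\<phi> (word_map G g n x) = word_map H h n x" if "x \<in> V" for x
  proof -
    have m: "word_map G g n x \<in> word_map G g n ` V" using that by simp
    show ?thesis
      unfolding \<phi>_def using eq[OF inv_into_into[OF m] that] f_inv_into_f[OF m] by simp
  qed
  have balls: "cayley_ball G (g ` {..<n}) R = word_map G g n ` V"
    "cayley_ball H (h ` {..<n}) R = word_map H h n ` V"
    unfolding G.cayley_ball_eq[OF g] H.cayley_ball_eq[OF h] V_def by auto
  have "0 \<in> V" by (simp add: V_def vnorm_def)
  then have one: "\<phi> \<one>\<^bsub>G\<^esub> = \<one>\<^bsub>H\<^esub>" using \<phi>[of 0] w.vec_zero v.vec_zero by simp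
  have "bij_betw \<phi> (word_map G g n ` V) (word_map H h n ` V)"
    unfolding bij_betw_def
  proof
    show "inj_on \<phi> (word_map G g n ` V)" using \<phi> eq by (auto intro!: inj_onI)
    show "\<phi> ` word_map G g n ` V = word_map H h n ` V" unfolding image_image using \<phi> by simp
  qed
  moreover have "(a, s, b) \<in> cayley_edges G (g ` {..<n}) \<longleftrightarrow> (\<phi> a, \<beta> s, \<phi> b) \<in> cayley_edges H (h ` {..<n})"
    if ab: "a \<in> word_map G g n ` V" "b \<in> word_map G g n ` V" and s: "s \<in> g ` {..<n}" for a b s
  proof -
    obtain x y i where xy: "x \<in> V" "y \<in> V" "a = word_map G g n x" "b = word_map G g n y"
      and i: "i < n" "s = g i" using ab s by auto
    have "vnorm n (x + std_unit i - y) \<le> 2 * R + 1"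
      using vnorm_diff_le[of n "x + std_unit i" y] vnorm_add_le[of n x "std_unit i"]
        vnorm_std_unit_le[of n i] xy(1,2) unfolding V_def by simp
    then show ?thesis
      unfolding i(2) \<beta>[OF i(1)] xy(3,4) \<phi>[OF xy(1)] \<phi>[OF xy(2)]
        G.word_map_edge_iff[OF g i(1)] H.word_map_edge_iff[OF h i(1)] by (rule ker)
  qed
  ultimately show ?thesis unfolding cayley_balls_isomorphic_def balls using one by blast
qed

text \<open>Indexing both generating sets by \<open>{..<n}\<close> along the bijection reduces the
  relation to equality of kernels on short vectors.\<close>

lemma preformsE:
  assumes G: "comm_group G" and H: "comm_group H" and "G \<leadsto> H"
  obtains n h where "h \<in> {..<n} \<rightarrow> carrier H" "range (word_map H h n) = carrier H"
    "\<And>R. \<exists>g. g \<in> {..<n} \<rightarrow> carrier G \<and> range (word_map G g n) = carrier G \<and>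
       (\<forall>x. vnorm n x \<le> R \<longrightarrow> (word_map G g n x = \<one>\<^bsub>G\<^esub> \<longleftrightarrow> word_map H h n x = \<one>\<^bsub>H\<^esub>))"
proof -
  interpret G: comm_group G by fact
  interpret H: comm_group H by fact
  obtain T S \<beta> where T: "finite_generating_set H T"
    and S: "\<And>n. finite_generating_set G (S n)" "\<And>n. bij_betw (\<beta> n) (S n) T"
    and ev: "\<And>R :: nat. \<exists>N::nat. \<forall>n\<ge>N. cayley_balls_isomorphic R (\<beta> n) G (S n) H T"
    using assms(3) unfolding preforms_def by blast
  define n where "n = card T"
  have "finite T" using T by (simp add: finite_generating_set_def)
  then obtain h where "bij_betw h {0..<n} T" unfolding n_def using ex_bij_betw_nat_finite by blast
  then have h: "bij_betw h {..<n} T" by (simp add: lessThan_atLeast0)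
  then have hT: "h ` {..<n} = T" by (simp add: bij_betw_def)
  then have hc: "h \<in> {..<n} \<rightarrow> carrier H" using T by (auto simp: finite_generating_set_def)
  show ?thesis
  proof (rule that[OF hc])
    show "range (word_map H h n) = carrier H"
      using H.word_map_range[OF hc] hT T by (simp add: finite_generating_set_def)
    fix R
    obtain N where N: "cayley_balls_isomorphic R (\<beta> N) G (S N) H T" using ev by blast
    define g where "g = (\<lambda>i. inv_into (S N) (\<beta> N) (h i))"
    have "bij_betw (inv_into (S N) (\<beta> N) \<circ> h) {..<n} (S N)"
      by (rule bij_betw_trans[OF h bij_betw_inv_into[OF S(2)]])
    then have gS: "g ` {..<n} = S N" by (simp add: g_def bij_betw_def o_def)
    then have gc: "g \<in> {..<n} \<rightarrow> carrier G" using S(1) by (auto simp: finite_generating_set_def)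
    have \<beta>g: "\<beta> N (g i) = h i" if "i < n" for i
      unfolding g_def using hT that by (intro bij_betw_inv_into_right[OF S(2)]) auto
    have "range (word_map G g n) = carrier G"
      using G.word_map_range[OF gc] gS S(1) by (simp add: finite_generating_set_def)
    moreover have "word_map G g n x = \<one>\<^bsub>G\<^esub> \<longleftrightarrow> word_map H h n x = \<one>\<^bsub>H\<^esub>" if "vnorm n x \<le> R" for x
      using balls_isomorphic_imp_kernel[OF G H gc hc \<beta>g _ that] N gS hT by simp
    ultimately show "\<exists>g. g \<in> {..<n} \<rightarrow> carrier G \<and> range (word_map G g n) = carrier G \<and>
       (\<forall>x. vnorm n x \<le> R \<longrightarrow> (word_map G g n x = \<one>\<^bsub>G\<^esub> \<longleftrightarrow> word_map H h n x = \<one>\<^bsub>H\<^esub>))"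
      using gc by blast
  qed
qed

lemma preformsI:
  assumes G: "comm_group G" and H: "comm_group H"
    and hc: "h \<in> {..<n} \<rightarrow> carrier H" and hr: "range (word_map H h n) = carrier H"
    and inj: "inj_on h {..<n}"
    and ex: "\<And>R. \<exists>g. g \<in> {..<n} \<rightarrow> carrier G \<and> range (word_map G g n) = carrier G \<and>
       (\<forall>x. vnorm n x \<le> R \<longrightarrow> (word_map G g n x = \<one>\<^bsub>G\<^esub> \<longleftrightarrow> word_map H h n x = \<one>\<^bsub>H\<^esub>))"
  shows "G \<leadsto> H"
proof -
  interpret G: comm_group G by fact
  interpret H: comm_group H by fact
  interpret v: vec_hom H "word_map H h n" by (rule H.word_map_hom[OF hc])
  obtain g where gc: "\<And>R. g R \<in> {..<n} \<rightarrow> carrier G"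
    and gr: "\<And>R. range (word_map G (g R) n) = carrier G"
    \<comment> \<open>Besides the bound \<open>2 * R + 1\<close> for balls of radius
      \<open>R\<close>, norm 2 must be reached even for \<open>R = 0\<close>: differences of two
      unit vectors show that the generators \<open>g R\<close> are distinct.\<close>
    and ker: "\<And>R x. vnorm n x \<le> 2 * R + 2 \<Longrightarrow> word_map G (g R) n x = \<one>\<^bsub>G\<^esub> \<longleftrightarrow> word_map H h n x = \<one>\<^bsub>H\<^esub>"
    using ex[of "2 * R + 2" for R] by metis
  have injg: "inj_on (g R) {..<n}" for R
  proof (rule inj_onI)
    interpret w: vec_hom G "word_map G (g R) n" by (rule G.word_map_hom[OF gc])
    fix i j assume ij: "i \<in> {..<n}" "j \<in> {..<n}" "g R i = g R j"
    have "word_map G (g R) n (std_unit i) = word_map G (g R) n (std_unit j)"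
      using ij G.word_map_unit[OF gc] by simp
    then have "word_map G (g R) n (std_unit i - std_unit j) = \<one>\<^bsub>G\<^esub>" unfolding w.vec_eq_iff .
    moreover have "vnorm n (std_unit i - std_unit j) \<le> 2 * R + 2"
      using vnorm_diff_le[of n "std_unit i" "std_unit j"] vnorm_std_unit_le[of n i] vnorm_std_unit_le[of n j]
      by linarith
    ultimately have "word_map H h n (std_unit i - std_unit j) = \<one>\<^bsub>H\<^esub>" using ker by blast
    then have "word_map H h n (std_unit i) = word_map H h n (std_unit j)" unfolding v.vec_eq_iff .
    then have "h i = h j" using ij H.word_map_unit[OF hc] by simp
    then show "i = j" using inj ij by (simp add: inj_on_def)
  qed
  define \<beta> where "\<beta> = (\<lambda>R s. h (inv_into {..<n} (g R) s))"
  have \<beta>g: "\<beta> R (g R i) = h i" if "i < n" for R i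
    unfolding \<beta>_def using that by (simp add: inv_into_f_f[OF injg])
  have "finite_generating_set H (h ` {..<n})"
    using hc H.word_map_range[OF hc] hr by (auto simp: finite_generating_set_def)
  moreover have "finite_generating_set G (g R ` {..<n})" for R
    using gc[of R] G.word_map_range[OF gc] gr[of R] by (auto simp: finite_generating_set_def)
  moreover have "bij_betw (\<beta> R) (g R ` {..<n}) (h ` {..<n})" for R
    unfolding bij_betw_def
  proof
    show "inj_on (\<beta> R) (g R ` {..<n})"
      using inj \<beta>g by (auto intro!: inj_onI simp: inj_on_def)
    show "\<beta> R ` g R ` {..<n} = h ` {..<n}" unfolding image_image using \<beta>g by simp
  qed
  moreover have "\<exists>N. \<forall>k\<ge>N. cayley_balls_isomorphic R (\<beta> k) G (g k ` {..<n}) H (h ` {..<n})" for R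
  \<comment> \<open>The generating set with index \<open>k\<close> agrees up to radius
    \<open>k\<close>, so the threshold for \<open>R\<close> is \<open>R\<close> itself.\<close>
  proof (intro exI allI impI)
    fix k assume "R \<le> k"
    then show "cayley_balls_isomorphic R (\<beta> k) G (g k ` {..<n}) H (h ` {..<n})"
      using ker[of _ k] by (intro kernel_imp_balls_isomorphic[OF G H gc hc \<beta>g]) auto
  qed
  ultimately show ?thesis
    unfolding preforms_def
    by (intro exI[of _ "h ` {..<n}"] exI[of _ "\<lambda>R. g R ` {..<n}"] exI[of _ \<beta>]) blast
qed


text \<open>The finitely many elements counted in \<open>H\<close> are represented by vectors of
  bounded norm; generators of \<open>G\<close> that agree to a large radius see the same torsion
  relations and the same distinctions.\<close>

lemma preforms_tors_count_le:
  assumes G: "comm_group G" and H: "comm_group H" and "G \<leadsto> H"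
    and finH: "finite {x [^]\<^bsub>H\<^esub> (q ^ j) | x. x \<in> carrier H \<and> x [^]\<^bsub>H\<^esub> (q ^ Suc j) = \<one>\<^bsub>H\<^esub>}" (is "finite ?TH")
    and finG: "finite {x [^]\<^bsub>G\<^esub> (q ^ j) | x. x \<in> carrier G \<and> x [^]\<^bsub>G\<^esub> (q ^ Suc j) = \<one>\<^bsub>G\<^esub>}" (is "finite ?TG")
  shows "tors_count H q j \<le> tors_count G q j"
proof -
  interpret G: comm_group G by fact
  interpret H: comm_group H by fact
  obtain n h where h: "h \<in> {..<n} \<rightarrow> carrier H" "range (word_map H h n) = carrier H"
    and ex: "\<And>R. \<exists>g. g \<in> {..<n} \<rightarrow> carrier G \<and> range (word_map G g n) = carrier G \<and>
       (\<forall>x. vnorm n x \<le> R \<longrightarrow> (word_map G g n x = \<one>\<^bsub>G\<^esub> \<longleftrightarrow> word_map H h n x = \<one>\<^bsub>H\<^esub>))"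
    by (rule preformsE[OF G H assms(3)]) (rule that)
  interpret v: vec_hom H "word_map H h n" by (rule H.word_map_hom[OF h(1)])
  define X where "X = (\<lambda>a. SOME x. a = word_map H h n (\<lambda>i. int (q ^ j) * x i) \<and>
    word_map H h n (\<lambda>i. int (q ^ Suc j) * x i) = \<one>\<^bsub>H\<^esub>)"
  have X: "a = word_map H h n (\<lambda>i. int (q ^ j) * X a i) \<and>
      word_map H h n (\<lambda>i. int (q ^ Suc j) * X a i) = \<one>\<^bsub>H\<^esub>" if a: "a \<in> ?TH" for a
  proof -
    obtain y where y: "y \<in> carrier H" "a = y [^]\<^bsub>H\<^esub> (q ^ j)" "y [^]\<^bsub>H\<^esub> (q ^ Suc j) = \<one>\<^bsub>H\<^esub>"
      using a by blast
    then obtain x where "y = word_map H h n x" using h(2) by auto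
    then have "\<exists>x. a = word_map H h n (\<lambda>i. int (q ^ j) * x i) \<and>
        word_map H h n (\<lambda>i. int (q ^ Suc j) * x i) = \<one>\<^bsub>H\<^esub>"
      using y v.vec_nat_pow[of x] by auto
    from someI_ex[OF this] show ?thesis unfolding X_def .
  qed
  define B where "B = (\<Sum>a\<in>?TH. vnorm n (X a))"
  have XB: "vnorm n (X a) \<le> B" if "a \<in> ?TH" for a
    unfolding B_def using that finH by (intro member_le_sum) auto
  \<comment> \<open>The first summand covers the relations of exponent \<open>q ^ Suc j\<close>, the
    second the differences of two represented elements.\<close>
  define R where "R = q ^ Suc j * B + 2 * (q ^ j * B)"
  obtain g where g: "g \<in> {..<n} \<rightarrow> carrier G" "range (word_map G g n) = carrier G"
    and ker: "\<And>x. vnorm n x \<le> R \<Longrightarrow> word_map G g n x = \<one>\<^bsub>G\<^esub> \<longleftrightarrow> word_map H h n x = \<one>\<^bsub>H\<^esub>"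
    using ex[of R] by blast
  interpret w: vec_hom G "word_map G g n" by (rule G.word_map_hom[OF g(1)])
  let ?f = "\<lambda>a. word_map G g n (\<lambda>i. int (q ^ j) * X a i)"
  have "inj_on ?f ?TH"
  proof (rule inj_onI)
    fix a b assume ab: "a \<in> ?TH" "b \<in> ?TH" "?f a = ?f b"
    let ?z = "(\<lambda>i. int (q ^ j) * X a i) - (\<lambda>i. int (q ^ j) * X b i)"
    have "vnorm n ?z \<le> q ^ j * vnorm n (X a) + q ^ j * vnorm n (X b)"
      using vnorm_diff_le[of n "\<lambda>i. int (q ^ j) * X a i" "\<lambda>i. int (q ^ j) * X b i"]
      unfolding vnorm_mult .
    also have "\<dots> \<le> q ^ j * B + q ^ j * B" using XB[OF ab(1)] XB[OF ab(2)] by (intro add_mono mult_left_mono) auto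
    also have "\<dots> \<le> R" by (simp add: R_def)
    finally have "word_map G g n ?z = \<one>\<^bsub>G\<^esub> \<longleftrightarrow> word_map H h n ?z = \<one>\<^bsub>H\<^esub>" by (rule ker)
    moreover have "word_map G g n ?z = \<one>\<^bsub>G\<^esub>" using ab(3) unfolding w.vec_eq_iff .
    ultimately have "word_map H h n ?z = \<one>\<^bsub>H\<^esub>" by simp
    then show "a = b"
      using X[OF ab(1)] X[OF ab(2)] unfolding v.vec_eq_iff[symmetric] by presburger
  qed
  moreover have "?f ` ?TH \<subseteq> ?TG"
  proof
    fix b assume "b \<in> ?f ` ?TH"
    then obtain a where a: "a \<in> ?TH" "b = ?f a" by blast
    have "vnorm n (\<lambda>i. int (q ^ Suc j) * X a i) \<le> q ^ Suc j * B"
      unfolding vnorm_mult using XB[OF a(1)] by (intro mult_left_mono) auto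
    also have "\<dots> \<le> R" by (simp add: R_def)
    finally have "word_map G g n (\<lambda>i. int (q ^ Suc j) * X a i) = \<one>\<^bsub>G\<^esub>" using ker X[OF a(1)] by blast
    then have "word_map G g n (X a) [^]\<^bsub>G\<^esub> (q ^ Suc j) = \<one>\<^bsub>G\<^esub>" by (simp only: w.vec_nat_pow)
    moreover have "b = word_map G g n (X a) [^]\<^bsub>G\<^esub> (q ^ j)" by (simp only: w.vec_nat_pow a(2))
    ultimately show "b \<in> ?TG" using w.vec_closed by blast
  qed
  ultimately show ?thesis unfolding tors_count_def by (rule card_inj_on_le[OF _ _ finG])
qed

text \<open>In both groups all cosets have representatives in the finite box of vectors with entries
  in \<open>{0..<q}\<close>. Each coincidence of cosets in \<open>H\<close> has a witness
  \<open>Z\<close>, and for large radius these witnesses remain valid in \<open>G\<close>.\<close>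

lemma preforms_quot_count_le:
  assumes G: "comm_group G" and H: "comm_group H" and "G \<leadsto> H" and q: "q > 0"
    and finH: "finite (power_coset H q j ` carrier H)"
  shows "quot_count G q j \<le> quot_count H q j"
proof -
  interpret G: comm_group G by fact
  interpret H: comm_group H by fact
  obtain n h where h: "h \<in> {..<n} \<rightarrow> carrier H" "range (word_map H h n) = carrier H"
    and ex: "\<And>R. \<exists>g. g \<in> {..<n} \<rightarrow> carrier G \<and> range (word_map G g n) = carrier G \<and>
       (\<forall>x. vnorm n x \<le> R \<longrightarrow> (word_map G g n x = \<one>\<^bsub>G\<^esub> \<longleftrightarrow> word_map H h n x = \<one>\<^bsub>H\<^esub>))"
    by (rule preformsE[OF G H assms(3)]) (rule that)
  interpret v: vec_hom H "word_map H h n" by (rule H.word_map_hom[OF h(1)])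
  define C :: "(nat \<Rightarrow> int) set" where "C = (\<Pi>\<^sub>E i\<in>{..<n}. {0..<int q})"
  have C: "finite C" unfolding C_def by (intro finite_PiE) auto
  let ?rel = "\<lambda>x y z i. int q ^ j * (x i - y i) - int q ^ Suc j * z i"
  define Z where "Z = (\<lambda>x y. SOME z. word_map H h n (?rel x y z) = \<one>\<^bsub>H\<^esub>)"
  have Z: "word_map H h n (?rel x y (Z x y)) = \<one>\<^bsub>H\<^esub>"
    if "power_coset H q j (word_map H h n x) = power_coset H q j (word_map H h n y)" for x y
    using that unfolding v.vec_power_coset_eq_iff[OF h(2)] Z_def by (rule someI_ex)
  define R where "R = (\<Sum>p\<in>C \<times> C. vnorm n (?rel (fst p) (snd p) (Z (fst p) (snd p))))"
  have R: "vnorm n (?rel x y (Z x y)) \<le> R" if "x \<in> C" "y \<in> C" for x y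
    unfolding R_def
    using member_le_sum[of "(x, y)" "C \<times> C" "\<lambda>p. vnorm n (?rel (fst p) (snd p) (Z (fst p) (snd p)))"] that C
    by simp
  obtain g where g: "g \<in> {..<n} \<rightarrow> carrier G" "range (word_map G g n) = carrier G"
    and ker: "\<And>x. vnorm n x \<le> R \<Longrightarrow> word_map G g n x = \<one>\<^bsub>G\<^esub> \<longleftrightarrow> word_map H h n x = \<one>\<^bsub>H\<^esub>"
    using ex[of R] by blast
  interpret w: vec_hom G "word_map G g n" by (rule G.word_map_hom[OF g(1)])
  let ?cG = "\<lambda>x. power_coset G q j (word_map G g n x)" and ?cH = "\<lambda>x. power_coset H q j (word_map H h n x)"
  have "power_coset G q j ` carrier G \<subseteq> ?cG ` C"
  proof
    fix c assume "c \<in> power_coset G q j ` carrier G"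
    then obtain x where c: "c = ?cG x" by (auto simp flip: g(2))
    let ?y = "\<lambda>i\<in>{..<n}. x i mod int q"
    \<comment> \<open>Reducing coordinates modulo \<open>q\<close> changes the vector by
      \<open>q\<close> times the quotients, which the \<open>q ^ Suc j\<close>-th powers
      absorb.\<close>
    have "word_map G g n (?rel x ?y (\<lambda>i. x i div int q)) = \<one>\<^bsub>G\<^esub>"
      by (rule G.word_map_trivial[OF g(1)]) (simp add: minus_mod_eq_mult_div)
    then have "c = ?cG ?y" 
      unfolding c w.vec_power_coset_eq_iff[OF g(2)] by (rule exI[of _ "\<lambda>i. x i div int q"])
    moreover have "?y \<in> C" using q by (auto simp: C_def)
    ultimately show "c \<in> ?cG ` C" by blast
  qed
  then have "quot_count G q j \<le> card (?cG ` C)"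
    unfolding quot_count_def using C by (intro card_mono) auto
  also have "\<dots> \<le> card (?cH ` C)"
  proof (rule card_image_le_of_factor(2))
    fix x y assume xy: "x \<in> C" "y \<in> C" "?cH x = ?cH y"
    then have "word_map G g n (?rel x y (Z x y)) = \<one>\<^bsub>G\<^esub>" using ker[OF R] Z by blast
    then show "?cG x = ?cG y"
      unfolding w.vec_power_coset_eq_iff[OF g(2)] by (rule exI[of _ "Z x y"])
  qed (use C in simp)
  also have "\<dots> \<le> quot_count H q j"
    unfolding quot_count_def using finH by (intro card_mono) auto
  finally show ?thesis .
qed

section \<open>Quotient maps that are injective on large balls\<close>

section \<open>Approximating a group by quotients\<close>


text \<open>Signed digits of absolute value below the base: the last one is divisible by
  \<open>N\<close>, hence zero, and the rest can be divided by \<open>N\<close>.\<close>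

lemma small_digits_zero:
  fixes y :: "nat \<Rightarrow> int"
  assumes "\<And>c. c < l \<Longrightarrow> \<bar>y c\<bar> < N" "(\<Sum>c<l. y c * N ^ c) = 0" "c < l"
  shows "y c = 0"
  using assms
proof (induction l arbitrary: y c)
  case (Suc l)
  have N: "N > 0" using Suc.prems(1)[OF Suc.prems(3)] by linarith
  have sum: "y 0 + N * (\<Sum>c<l. y (Suc c) * N ^ c) = 0"
    using Suc.prems(2) unfolding sum.lessThan_Suc_shift by (simp add: sum_distrib_left mult_ac)
  then have "N dvd y 0" by (metis dvd_add_left_iff dvd_0_right dvd_triv_left)
  then have y0: "y 0 = 0" using Suc.prems(1)[of 0] dvd_imp_le_int[of "y 0" N] N by fastforce
  then have "(\<Sum>c<l. y (Suc c) * N ^ c) = 0" using sum N by simp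
  then have "y (Suc c) = 0" if "c < l" for c
    using Suc.IH[of "\<lambda>c. y (Suc c)" c] Suc.prems(1) that by auto
  then show ?case using y0 Suc.prems(3) by (cases c) auto
qed simp

lemma (in comm_group) word_map_of_hom:
  assumes "vec_hom G \<alpha>"
  shows "word_map G (\<lambda>i. \<alpha> (std_unit i)) n x = \<alpha> (\<lambda>i. if i < n then x i else 0)"
proof -
  interpret a: vec_hom G \<alpha> by fact
  let ?g = "\<lambda>i. \<alpha> (std_unit i)" and ?t = "\<lambda>x i. if i < n then x i else (0 :: int)"
  have g: "?g \<in> {..<n} \<rightarrow> carrier G" by auto
  interpret w: vec_hom G "word_map G ?g n" by (rule word_map_hom[OF g])
  have "x \<in> {x. word_map G ?g n x = \<alpha> (?t x)}"
  proof (rule lattice_full[of _ n])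
    have t0: "?t 0 = 0" by (auto simp: fun_eq_iff)
    have td: "?t (x - y) = ?t x - ?t y" for x y by (auto simp: fun_eq_iff)
    show "int_lattice {x. word_map G ?g n x = \<alpha> (?t x)}"
      unfolding int_lattice_def mem_Collect_eq t0 td Ball_def w.vec_diff a.vec_diff
      by (simp add: w.vec_zero a.vec_zero)
    show "x \<in> {x. word_map G ?g n x = \<alpha> (?t x)}" if "\<And>i. i < n \<Longrightarrow> x i = 0" for x
    proof -
      have "?t x = 0" using that by (auto simp: fun_eq_iff)
      then show ?thesis using word_map_trivial[OF g that] a.vec_zero by simp
    qed
    show "std_unit i \<in> {x. word_map G ?g n x = \<alpha> (?t x)}" if "i < n" for i
    proof -
      have "?t (std_unit i) = std_unit i" using that by (auto simp: fun_eq_iff std_unit_def)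
      then show ?thesis using word_map_unit[OF g that] by simp
    qed
  qed
  then show ?thesis by simp
qed

text \<open>Here \<open>d\<close> and \<open>d + r\<close> are the ranks of \<open>G\<close> and \<open>H\<close>. If \<open>x\<^sub>i\<close> are the torsion generators of \<open>G\<close>,
  of orders \<open>n\<^sub>i\<close>, and those of \<open>H\<close> have orders \<open>l\<^sub>i\<close>, then the latter are sent to
  \<open>(n\<^sub>i / l\<^sub>i) x\<^sub>i - x\<^sub>i\<^sub>+\<^sub>r\<close>; these span a copy of the torsion of \<open>H\<close>, with quotient generated by the
  first \<open>r\<close> of the \<open>x\<^sub>i\<close>. The \<open>r\<close> surplus free generators of \<open>H\<close> are sent to those, shifted by powers
  of \<open>N\<close> in an infinite cyclic summand so that no short word enters the kernel.\<close>

locale approximation =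
  G: moduli_presentation G \<phi> m + H: moduli_presentation H \<psi> m'
  for G (structure) and H (structure) and \<phi> m \<psi> m' +
  fixes d r k :: nat
  assumes d_pos: "d \<ge> 1" and r_pos: "r \<ge> 1"
    and zeros: "\<And>i. m i = 0 \<longleftrightarrow> i < d"
    and zeros': "\<And>i. m' i = 0 \<longleftrightarrow> i < d + r"
    and ones': "\<And>i. m' i = 1 \<longleftrightarrow> i \<ge> k"
    and shift_dvd: "\<And>i. i \<ge> d \<Longrightarrow> m' (i + r) dvd m i"
    and dvd: "\<And>i. i \<ge> d + r \<Longrightarrow> m i dvd m' i"
begin

text \<open>Coordinates below \<open>d\<close> are free in both groups, those from \<open>d\<close>
  to \<open>d + r - 1\<close> only in \<open>H\<close>. Row 0 is a number in base \<open>N\<close>;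
  the exponent \<open>Suc c\<close> reserves digit 0 for \<open>x 0\<close> itself.\<close>

definition A :: "int \<Rightarrow> (nat \<Rightarrow> int) \<Rightarrow> nat \<Rightarrow> int" where
  "A N x i = (if i < d + r then x i else - x i) +
     (if i = 0 then \<Sum>c<r. x (d + c) * N ^ Suc c else 0) +
     (if d \<le> i then x (i + r) * int (m i div m' (i + r)) else 0)"

lemma A_add: "A N (x + y) = A N x + A N y"
  by (auto simp: A_def fun_eq_iff sum.distrib algebra_simps)

lemma hom: "vec_hom G (\<lambda>x. \<phi> (A N x))"
  by unfold_locales (auto simp: A_add G.vec_add)

lemma quotient_moduli:
  assumes "d \<le> i"
  shows "int (m i) = int (m' (i + r)) * int (m i div m' (i + r))" "m i div m' (i + r) > 0"
proof -
  have "m i = m' (i + r) * (m i div m' (i + r))" using shift_dvd[OF assms] by simp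
  then show "int (m i) = int (m' (i + r)) * int (m i div m' (i + r))" by (metis of_nat_mult)
  show "m i div m' (i + r) > 0"
    using \<open>m i = _\<close> zeros[of i] assms by (metis gr0I mult_0_right not_le)
qed

text \<open>Makes the map well defined on \<open>H\<close>: a generator of order \<open>m' i\<close>
  goes to a combination that \<open>m' i\<close> kills, one term by \<open>m i dvd m' i\<close>, the
  other because \<open>m' i\<close> times the quotient is \<open>m (i - r)\<close>.\<close>

lemma kernel_if:
  assumes "\<psi> x = \<one>\<^bsub>H\<^esub>"
  shows "\<phi> (A N x) = \<one>"
proof -
  have x: "int (m' i) dvd x i" for i using assms by (simp add: H.vec_kernel)
  then have x0: "x i = 0" if "i < d + r" for i using x[of i] zeros'[of i] that by (metis dvd_0_left_iff of_nat_0)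
  have "int (m i) dvd A N x i" for i
  proof (cases "d \<le> i")
    case False
    then show ?thesis using x0 by (simp add: A_def)
  next
    case True
    have "int (m i) dvd x (i + r) * int (m i div m' (i + r))"
      using quotient_moduli(1)[OF True] x[of "i + r"] by (metis dvd_refl mult_dvd_mono)
    moreover have "int (m i) dvd x i"
    proof (cases "i < d + r")
      case False
      then have "int (m i) dvd int (m' i)" using dvd[of i] by simp
      then show ?thesis using x dvd_trans by blast
    qed (simp add: x0)
    ultimately show ?thesis using True d_pos by (auto simp: A_def)
  qed
  then show ?thesis by (simp add: G.vec_kernel)
qed

lemma kernel_only_if:
  assumes "\<phi> (A N x) = \<one>" and small: "\<And>i. i < d + r \<Longrightarrow> \<bar>x i\<bar> < N"
  shows "\<psi> x = \<one>\<^bsub>H\<^esub>"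
proof -
  have Ax: "int (m i) dvd A N x i" for i using assms(1) by (simp add: G.vec_kernel)
  then have A0: "A N x i = 0" if "i < d" for i using Ax[of i] zeros[of i] that by (metis dvd_0_left_iff of_nat_0)
  \<comment> \<open>Row 0 vanishes, and it is the number with digits \<open>x 0\<close> and the
    surplus free coordinates, so all of these vanish when they are small.\<close>
  let ?y = "case_nat (x 0) (\<lambda>c. x (d + c))"
  have "(\<Sum>c<Suc r. ?y c * N ^ c) = A N x 0"
    using d_pos unfolding sum.lessThan_Suc_shift by (simp add: A_def)
  then have "(\<Sum>c<Suc r. ?y c * N ^ c) = 0" using A0[of 0] d_pos by simp
  moreover have "\<bar>?y c\<bar> < N" if "c < Suc r" for c
    using small that d_pos by (auto split: nat.split)
  ultimately have y: "?y c = 0" if "c < Suc r" for c using small_digits_zero[of "Suc r" ?y N c] that by blast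
  have x0: "x i = 0" if i: "i < d + r" for i
  proof -
    consider "i = 0" | "0 < i" "i < d" | "d \<le> i" by linarith
    then show ?thesis
    proof cases
      case 1
      then show ?thesis using y[of 0] by simp
    next
      case 2
      then show ?thesis using A0[of i] by (simp add: A_def)
    next
      case 3
      then show ?thesis using y[of "Suc (i - d)"] i by simp
    qed
  qed
  \<comment> \<open>Row \<open>i - r\<close> contains only \<open>x (i - r)\<close>, controlled by
    induction, and \<open>x i\<close> times the quotient of the moduli. The strict decrease by
    \<open>r\<close> is where \<open>r \<ge> 1\<close> is used.\<close>
  have "int (m' i) dvd x i" for i
  proof (induction i rule: less_induct)
    case (less i)
    show ?case
    proof (cases "i < d + r")
      case False
      then obtain l where l: "i = l + r" "d \<le> l" by (metis add_le_imp_le_right le_Suc_ex add.commute not_less le_add2 order_trans)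
      have "int (m l) dvd x l"
      proof (cases "l < d + r")
        case False
        then have "int (m l) dvd int (m' l)" using dvd[of l] by simp
        moreover have "int (m' l) dvd x l" using less[of l] l(1) r_pos by simp
        ultimately show ?thesis using dvd_trans by blast
      qed (simp add: x0)
      then have "int (m l) dvd (if l < d + r then x l else - x l)" by simp
      moreover have "A N x l = (if l < d + r then x l else - x l) + x (l + r) * int (m l div m' (l + r))"
        using l(2) d_pos by (simp add: A_def)
      ultimately have "int (m l) dvd x (l + r) * int (m l div m' (l + r))"
        using Ax[of l] by (simp only: dvd_add_right_iff)
      then have "int (m' (l + r)) * int (m l div m' (l + r)) dvd x (l + r) * int (m l div m' (l + r))"
        using quotient_moduli(1)[OF l(2)] by simp
      then show ?thesis using quotient_moduli(2)[OF l(2)] l(1) by simp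
    qed (simp add: x0)
  qed
  then show ?thesis by (simp add: H.vec_kernel)
qed

lemma k_ge: "d + r \<le> k"
proof (rule ccontr)
  assume "\<not> d + r \<le> k"
  then show False using ones'[of k] zeros'[of k] by simp
qed

lemma ones: "i \<ge> k \<Longrightarrow> m i = 1"
  using dvd[of i] ones'[of i] k_ge by simp

text \<open>Up to signs \<open>A N\<close> is unitriangular: the image of each unit vector is plus
  or minus that vector and a multiple of an earlier one.\<close>

lemma surjective: "range (\<lambda>x. \<phi> (A N x)) = carrier G"
proof -
  interpret a: vec_hom G "\<lambda>x. \<phi> (A N x)" by (rule hom)
  let ?L = "{v. \<phi> v \<in> range (\<lambda>x. \<phi> (A N x))}"
  have L: "int_lattice ?L" by (rule G.vec_vimage_subgroup[OF a.vec_range_subgroup])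
  have AL: "A N x \<in> ?L" for x by auto
  have "std_unit i \<in> ?L" for i
  proof (induction i rule: less_induct)
    case (less i)
    have unit0: "std_unit 0 \<in> ?L"
    proof -
      have "A N (std_unit 0) = std_unit 0" using d_pos r_pos by (auto simp: A_def std_unit_def fun_eq_iff)
      then show ?thesis using AL[of "std_unit 0"] by simp
    qed
    consider "i < d" | "d \<le> i" "i < d + r" | "d + r \<le> i" by linarith
    then show ?case
    proof cases
      case 1
      then have "A N (std_unit i) = std_unit i" using d_pos r_pos by (auto simp: A_def std_unit_def fun_eq_iff)
      then show ?thesis using AL[of "std_unit i"] by simp
    next
      case 2
      have sum: "(\<Sum>c<r. std_unit i (d + c) * N ^ Suc c) = N ^ Suc (i - d)"
      proof -
        have "(\<Sum>c<r. std_unit i (d + c) * N ^ Suc c) = (\<Sum>c<r. if c = i - d then N ^ Suc c else 0)"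
          using 2 by (intro sum.cong) (auto simp: std_unit_def)
        then show ?thesis using 2 by simp
      qed
      have "A N (std_unit i) - (\<lambda>l. N ^ Suc (i - d) * std_unit 0 l) = std_unit i"
      proof
        fix l
        show "(A N (std_unit i) - (\<lambda>l. N ^ Suc (i - d) * std_unit 0 l)) l = std_unit i l"
          using 2 d_pos unfolding fun_diff_def A_def sum by (auto simp: std_unit_def)
      qed
      then show ?thesis using lattice_diff[OF L AL lattice_mult[OF L unit0]] by metis
    next
      case 3
      let ?q = "int (m (i - r) div m' i)"
      have "(\<lambda>l. ?q * std_unit (i - r) l) - A N (std_unit i) = std_unit i"
      proof
        fix l
        have "(\<Sum>c<r. std_unit i (d + c) * N ^ Suc c) = 0"
          using 3 by (intro sum.neutral) (auto simp: std_unit_def)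
        then show "((\<lambda>l. ?q * std_unit (i - r) l) - A N (std_unit i)) l = std_unit i l"
          using 3 r_pos unfolding fun_diff_def A_def by (auto simp: std_unit_def)
      qed
      moreover have "std_unit (i - r) \<in> ?L" using 3 r_pos d_pos by (intro less) simp
      ultimately show ?thesis using lattice_diff[OF L lattice_mult[OF L] AL] by metis
    qed
  qed
  moreover have "v \<in> ?L" if "\<And>i. i < k \<Longrightarrow> v i = 0" for v
  proof -
    have "int (m i) dvd v i" for i using that[of i] ones[of i] by (cases "i < k") auto
    then have "\<phi> v = \<one>" by (simp add: G.vec_kernel)
    then show ?thesis using subgroup.one_closed[OF a.vec_range_subgroup] by simp
  qed
  ultimately have "\<phi> v \<in> range (\<lambda>x. \<phi> (A N x))" for v using lattice_full[OF L, of k v] by blast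
  then have "carrier G \<subseteq> range (\<lambda>x. \<phi> (A N x))" unfolding G.vec_surj[symmetric] by blast
  then show ?thesis by auto
qed

lemma word_map_eq:
  "word_map H (\<lambda>i. \<psi> (std_unit i)) k x = \<psi> x"
  "word_map G (\<lambda>i. \<phi> (A N (std_unit i))) k x = \<phi> (A N x)"
proof -
  interpret a: vec_hom G "\<lambda>x. \<phi> (A N x)" by (rule hom)
  let ?t = "\<lambda>i. if i < k then x i else 0"
  have "int (m' i) dvd (?t - x) i" for i using ones'[of i] by (cases "i < k") auto
  then have "\<psi> (?t - x) = \<one>\<^bsub>H\<^esub>" unfolding H.vec_kernel ..
  then have "\<psi> ?t = \<psi> x" "\<phi> (A N ?t) = \<phi> (A N x)"
    unfolding H.vec_eq_iff a.vec_eq_iff by (simp_all add: kernel_if)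
  then show "word_map H (\<lambda>i. \<psi> (std_unit i)) k x = \<psi> x"
    "word_map G (\<lambda>i. \<phi> (A N (std_unit i))) k x = \<phi> (A N x)"
    using H.word_map_of_hom[OF H.vec_hom_axioms, of k x] G.word_map_of_hom[OF hom, of N k x] by simp_all
qed

theorem preforms: "G \<leadsto> H"
proof (rule preformsI[OF G.comm_group_axioms H.comm_group_axioms])
  show "(\<lambda>i. \<psi> (std_unit i)) \<in> {..<k} \<rightarrow> carrier H" by auto
  show "range (word_map H (\<lambda>i. \<psi> (std_unit i)) k) = carrier H"
    unfolding word_map_eq using H.vec_surj by simp
  show "inj_on (\<lambda>i. \<psi> (std_unit i)) {..<k}"
  proof (rule inj_onI)
    fix i j assume ij: "i \<in> {..<k}" "j \<in> {..<k}" "\<psi> (std_unit i) = \<psi> (std_unit j)"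
    then have "int (m' i) dvd (std_unit i - std_unit j) i" unfolding H.vec_eq_iff H.vec_kernel by blast
    then show "i = j" using ij(1) ones'[of i] by (auto simp: std_unit_def split: if_splits)
  qed
  fix R
  \<comment> \<open>A vector of norm at most \<open>R\<close> has all relevant entries of absolute
    value below \<open>R + 1\<close>.\<close>
  let ?N = "int R + 1"
  have "word_map G (\<lambda>i. \<phi> (A ?N (std_unit i))) k x = \<one> \<longleftrightarrow> word_map H (\<lambda>i. \<psi> (std_unit i)) k x = \<one>\<^bsub>H\<^esub>"
    if "vnorm k x \<le> R" for x
  proof -
    have "\<bar>x i\<bar> < ?N" if "i < d + r" for i
      using vnorm_component_le[of i k x] \<open>vnorm k x \<le> R\<close> that k_ge by linarith
    then show ?thesis unfolding word_map_eq using kernel_if[of x ?N] kernel_only_if[of ?N x] by blast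
  qed
  moreover have "range (word_map G (\<lambda>i. \<phi> (A ?N (std_unit i))) k) = carrier G"
    unfolding word_map_eq by (rule surjective)
  moreover have "(\<lambda>i. \<phi> (A ?N (std_unit i))) \<in> {..<k} \<rightarrow> carrier G" by auto
  ultimately show "\<exists>g. g \<in> {..<k} \<rightarrow> carrier G \<and> range (word_map G g k) = carrier G \<and>
       (\<forall>x. vnorm k x \<le> R \<longrightarrow> (word_map G g k x = \<one> \<longleftrightarrow> word_map H (\<lambda>i. \<psi> (std_unit i)) k x = \<one>\<^bsub>H\<^esub>))"
    by blast
qed

end

section \<open>Invariant factors versus conjugate partitions\<close>

section \<open>The order in terms of codes\<close>


definition moduli_code :: "(nat \<Rightarrow> nat) \<Rightarrow> nat \<times> (nat \<Rightarrow> nat \<Rightarrow> nat)" where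
  "moduli_code m = (card {i. m i = 0},
     \<lambda>q j. if prime q then card {i. m i \<noteq> 0 \<and> q ^ Suc j dvd m i} else 0)"

definition desc_moduli :: "(nat \<Rightarrow> nat) \<Rightarrow> bool" where
  "desc_moduli m \<longleftrightarrow> (\<forall>i. m (Suc i) dvd m i) \<and> finite {i. m i \<noteq> 1}"

lemma finite_prime_power_moduli:
  assumes "finite {i. m i \<noteq> (1::nat)}" "prime q"
  shows "finite {i. q ^ Suc j dvd m i}"
  using prime_gt_1_nat[OF assms(2)] by (intro finite_subset[OF _ assms(1)]) auto

lemma moduli_code_in_codes:
  assumes fin: "finite {i. m i \<noteq> 1}"
  shows "snd (moduli_code m) \<in> codes"
proof -
  let ?a = "snd (moduli_code m)"
  have "?a q (Suc j) \<le> ?a q j" for q j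
  proof (cases "prime q")
    case True
    have "finite {i. m i \<noteq> 0 \<and> q ^ Suc j dvd m i}"
      by (rule finite_subset[OF _ finite_prime_power_moduli[OF fin True]]) auto
    moreover have "{i. m i \<noteq> 0 \<and> q ^ Suc (Suc j) dvd m i} \<subseteq> {i. m i \<noteq> 0 \<and> q ^ Suc j dvd m i}"
      using dvd_trans[OF le_imp_power_dvd[of "Suc j" "Suc (Suc j)" q]] by auto
    ultimately show ?thesis using True by (simp add: moduli_code_def card_mono)
  qed (simp add: moduli_code_def)
  moreover have "finite {x. ?a (fst x) (snd x) \<noteq> 0}"
  proof (rule finite_subset)
    show "{x. ?a (fst x) (snd x) \<noteq> 0} \<subseteq> (\<Union>i\<in>{i. m i \<noteq> 1}. {..m i} \<times> {..m i})"
    proof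
      fix x assume "x \<in> {x. ?a (fst x) (snd x) \<noteq> 0}"
      then have "?a (fst x) (snd x) \<noteq> 0" by simp
      then have "prime (fst x) \<and> card {i. m i \<noteq> 0 \<and> fst x ^ Suc (snd x) dvd m i} \<noteq> 0"
        unfolding moduli_code_def snd_conv by presburger
      then have x: "prime (fst x)" "{i. m i \<noteq> 0 \<and> fst x ^ Suc (snd x) dvd m i} \<noteq> {}"
        by (metis card.empty)+
      then obtain i where i: "m i \<noteq> 0" "fst x ^ Suc (snd x) dvd m i" by blast
      have gt: "fst x > 1" using x(1) by (rule prime_gt_1_nat)
      have le: "fst x ^ Suc (snd x) \<le> m i" using i by (intro dvd_imp_le) auto
      have "fst x \<le> fst x ^ Suc (snd x)" "snd x < fst x ^ Suc (snd x)"
        using gt self_le_power[of "fst x" "Suc (snd x)"] power_gt_expt[of "fst x" "Suc (snd x)"] by auto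
      then have "fst x \<le> m i" "snd x \<le> m i" using le by linarith+
      then have "x \<in> {..m i} \<times> {..m i}" by (simp add: mem_Times_iff)
      moreover have "m i \<noteq> 1" using gt \<open>fst x \<le> m i\<close> by linarith
      ultimately show "x \<in> (\<Union>i\<in>{i. m i \<noteq> 1}. {..m i} \<times> {..m i})" by blast
    qed
    show "finite (\<Union>i\<in>{i. m i \<noteq> 1}. {..m i} \<times> {..m i})" using fin by blast
  qed
  moreover have "prime q" if "?a q j \<noteq> 0" for q j
    using that by (auto simp: moduli_code_def split: if_splits)
  ultimately show ?thesis unfolding codes_def by blast
qed

lemma down_closed_card:
  assumes "finite S" "\<And>i j. j \<in> S \<Longrightarrow> i \<le> j \<Longrightarrow> i \<in> S"
  shows "i \<in> S \<longleftrightarrow> i < card (S :: nat set)"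
proof
  assume "i \<in> S"
  then have "{..i} \<subseteq> S" using assms(2) by auto
  then have "card {..i} \<le> card S" by (rule card_mono[OF assms(1)])
  then show "i < card S" by simp
next
  assume lt: "i < card S"
  show "i \<in> S"
  proof (rule ccontr)
    assume "i \<notin> S"
    then have "S \<subseteq> {..<i}" using assms(2) not_le by auto
    then have "card S \<le> i" using card_mono[of "{..<i}" S] by simp
    then show False using lt by simp
  qed
qed

lemma card_moduli_split:
  assumes "finite {i. m i \<noteq> (1::nat)}" "prime q"
  shows "card {i. q ^ Suc j dvd m i} = snd (moduli_code m) q j + fst (moduli_code m)"
proof -
  have "{i. q ^ Suc j dvd m i} = {i. m i \<noteq> 0 \<and> q ^ Suc j dvd m i} \<union> {i. m i = 0}"
    by auto
  moreover have "finite {i. m i \<noteq> 0 \<and> q ^ Suc j dvd m i}"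
    by (rule finite_subset[OF _ finite_prime_power_moduli[OF assms]]) auto
  moreover have "finite {i. m i = 0}" by (rule finite_subset[OF _ assms(1)]) auto
  ultimately show ?thesis using assms(2)
    by (simp add: moduli_code_def card_Un_disjoint disjoint_iff del: power_Suc)
qed

lemma desc_moduli_antimono:
  assumes "desc_moduli m" "i \<le> j"
  shows "m j dvd m i"
  using assms(2)
proof (induction rule: dec_induct)
  case (step k)
  then show ?case using assms(1) dvd_trans unfolding desc_moduli_def by blast
qed simp

lemma desc_moduli_zero_iff:
  assumes "desc_moduli m"
  shows "m i = 0 \<longleftrightarrow> i < fst (moduli_code m)"
proof -
  have "finite {i. m i = 0}"
    by (rule finite_subset[of _ "{i. m i \<noteq> 1}"]) (use assms in \<open>auto simp: desc_moduli_def\<close>)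
  then have "i \<in> {i. m i = 0} \<longleftrightarrow> i < card {i. m i = 0}"
  proof (rule down_closed_card)
    show "i \<in> {i. m i = 0}" if "j \<in> {i. m i = 0}" "i \<le> j" for i j
      using desc_moduli_antimono[OF assms that(2)] that(1) by simp
  qed
  then show ?thesis by (simp add: moduli_code_def)
qed

text \<open>Conjugation of partitions: along a divisibility chain the indices with
  \<open>q ^ Suc j dvd m i\<close> form an initial segment, so its length decides
  membership.\<close>

lemma desc_moduli_dvd_iff:
  assumes "desc_moduli m" "prime q"
  shows "q ^ Suc j dvd m i \<longleftrightarrow> i < snd (moduli_code m) q j + fst (moduli_code m)"
proof -
  have fin: "finite {i. m i \<noteq> 1}" using assms(1) by (simp add: desc_moduli_def)
  have "i \<in> {i. q ^ Suc j dvd m i} \<longleftrightarrow> i < card {i. q ^ Suc j dvd m i}"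
  proof (rule down_closed_card[OF finite_prime_power_moduli[OF fin assms(2)]])
    fix i j' assume "j' \<in> {i. q ^ Suc j dvd m i}" "i \<le> j'"
    then show "i \<in> {i. q ^ Suc j dvd m i}"
      using dvd_trans[OF _ desc_moduli_antimono[OF assms(1)]] by blast
  qed
  then show ?thesis by (simp only: mem_Collect_eq card_moduli_split[OF fin assms(2)])
qed

lemma prime_powers_dvd_imp_dvd:
  fixes x y :: nat
  assumes "x \<noteq> 0" "\<And>q j. prime q \<Longrightarrow> q ^ Suc j dvd x \<Longrightarrow> q ^ Suc j dvd y"
  shows "x dvd y"
proof (cases "y = 0")
  case False
  show ?thesis
  proof (rule multiplicity_le_imp_dvd[OF assms(1)])
    fix q :: nat assume q: "prime q"
    show "multiplicity q x \<le> multiplicity q y"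
    proof (cases "multiplicity q x")
      case (Suc j)
      have "q ^ multiplicity q x dvd x" by (rule multiplicity_dvd)
      then have "q ^ Suc j dvd y" using assms(2)[OF q] Suc by metis
      then have "Suc j \<le> multiplicity q y"
        using False q by (intro multiplicity_geI) (auto dest: prime_gt_1_nat)
      then show ?thesis using Suc by simp
    qed simp
  qed
qed simp

text \<open>With \<open>i'\<close> shifted by the rank difference, or equal to \<open>i\<close>, the
  two code inequalities become the interlacing divisibilities; with equal codes and
  \<open>i' = i\<close> the moduli are recovered.\<close>

lemma desc_moduli_shift_dvd:
  assumes m: "desc_moduli m" and m': "desc_moduli m'"
    and nz: "m' i' \<noteq> 0"
    and le: "\<And>q j. prime q \<Longrightarrow>
      snd (moduli_code m') q j + fst (moduli_code m') + i \<le> snd (moduli_code m) q j + fst (moduli_code m) + i'"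
  shows "m' i' dvd m i"
proof (rule prime_powers_dvd_imp_dvd[OF nz])
  fix q j assume q: "prime (q :: nat)" and "q ^ Suc j dvd m' i'"
  then show "q ^ Suc j dvd m i"
    unfolding desc_moduli_dvd_iff[OF m q] desc_moduli_dvd_iff[OF m' q] using le[OF q, of j] by linarith
qed

lemma moduli_code_inj:
  assumes m: "desc_moduli m" and m': "desc_moduli m'" and eq: "moduli_code m = moduli_code m'"
  shows "m = m'"
proof
  fix i
  show "m i = m' i"
  proof (cases "m i = 0")
    case True
    then show ?thesis using desc_moduli_zero_iff[OF m, of i] desc_moduli_zero_iff[OF m', of i] eq by simp
  next
    case False
    then have "m' i \<noteq> 0" using desc_moduli_zero_iff[OF m, of i] desc_moduli_zero_iff[OF m', of i] eq by simp
    then show ?thesis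
      using desc_moduli_shift_dvd[OF m m', of i i] desc_moduli_shift_dvd[OF m' m, of i i] False eq
      by (auto intro: dvd_antisym)
  qed
qed

lemma moduli_code_surj:
  assumes a: "a \<in> codes"
  obtains m where "desc_moduli m" "moduli_code m = (d, a)"
proof -
  define Q where "Q = {q. a q 0 \<noteq> 0}"
  \<comment> \<open>The conjugate partition: \<open>j < b q i\<close> holds exactly if
    \<open>i < a q j\<close>, so \<open>b q i\<close> is the exponent of \<open>q\<close> in the
    invariant factor number \<open>i\<close>.\<close>
  define b where "b = (\<lambda>q i. card {j. a q j > i})"
  define m where "m = (\<lambda>i. if i < d then 0 else \<Prod>q\<in>Q. q ^ b q (i - d))"
  have Q: "finite Q" "\<And>q. q \<in> Q \<Longrightarrow> prime q"
  proof -
    have "Q \<subseteq> fst ` {x. a (fst x) (snd x) \<noteq> 0}"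
    proof
      show "q \<in> fst ` {x. a (fst x) (snd x) \<noteq> 0}" if "q \<in> Q" for q
        using that by (intro image_eqI[of _ _ "(q, 0)"]) (auto simp: Q_def)
    qed
    then show "finite Q" using codes_finite[OF a] finite_subset by blast
    show "prime q" if "q \<in> Q" for q using that codes_prime[OF a] by (simp add: Q_def)
  qed
  have finj: "finite {j. a q j > i}" for q i
  proof -
    have "{j. a q j > i} \<subseteq> snd ` {x. a (fst x) (snd x) \<noteq> 0}"
    proof
      show "j \<in> snd ` {x. a (fst x) (snd x) \<noteq> 0}" if "j \<in> {j. a q j > i}" for j
        using that by (intro image_eqI[of _ _ "(q, j)"]) auto
    qed
    then show ?thesis using codes_finite[OF a] finite_subset by blast
  qed
  have b: "j < b q i \<longleftrightarrow> i < a q j" for q i j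
    using down_closed_card[OF finj[of i q], of j] codes_antimono[OF a, of _ _ q]
    unfolding b_def by (metis le_less_trans mem_Collect_eq not_le)
  have anti: "b q (Suc i) \<le> b q i" for q i
    unfolding b_def by (rule card_mono[OF finj]) auto
  have outside: "b q i = 0" if "q \<notin> Q" for q i
    using b[of 0 q i] that by (auto simp: Q_def)
  have nz: "(\<Prod>q\<in>Q. q ^ b q i) \<noteq> 0" for i
    using Q by (auto dest: prime_gt_0_nat)
  have dvd_iff: "q ^ Suc j dvd m i \<longleftrightarrow> i - d < a q j" if q: "prime q" and i: "i \<ge> d" for q i j
  proof -
    have "multiplicity q (m i) = b q (i - d)"
      using i multiplicity_prod_prime_powers[OF Q q, of "\<lambda>q. b q (i - d)"] outside
      by (simp add: m_def)
    moreover have "q ^ Suc j dvd m i \<longleftrightarrow> Suc j \<le> multiplicity q (m i)"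
      using nz[of "i - d"] i q by (intro power_dvd_iff_le_multiplicity) (auto simp: m_def dest: prime_gt_1_nat)
    ultimately show ?thesis using b by (simp add: Suc_le_eq)
  qed
  have "m (Suc i) dvd m i" for i
  proof (cases "Suc i \<le> d")
    case False
    then have "Suc i - d = Suc (i - d)" "i \<ge> d" by auto
    then show ?thesis
      unfolding m_def using False anti by (auto intro!: prod_dvd_prod le_imp_power_dvd)
  qed (simp add: m_def)
  moreover have "finite {i. m i \<noteq> 1}"
  proof (rule finite_subset)
    define M where "M = (\<Sum>q\<in>Q. a q 0)"
    show "{i. m i \<noteq> 1} \<subseteq> {..<d + M}"
    proof
      fix i assume "i \<in> {i. m i \<noteq> 1}"
      then have i: "m i \<noteq> 1" by simp
      show "i \<in> {..<d + M}"
      proof (rule ccontr)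
        assume "i \<notin> {..<d + M}"
        then have ge: "i - d \<ge> M" "i \<ge> d" by auto
        have "b q (i - d) = 0" if "q \<in> Q" for q
        proof -
          have "a q 0 \<le> M" unfolding M_def using that Q(1) by (intro member_le_sum) auto
          then show ?thesis using b[of 0 q "i - d"] ge(1) by simp
        qed
        then have "m i = 1" using ge(2) by (simp add: m_def)
        then show False using i by simp
      qed
    qed
  qed simp
  ultimately have desc: "desc_moduli m" by (simp add: desc_moduli_def)
  have m0: "m i = 0 \<longleftrightarrow> i < d" for i using nz by (simp add: m_def)
  have "card {i. m i \<noteq> 0 \<and> q ^ Suc j dvd m i} = a q j" if "prime q" for q j
  proof -
    have "{i. m i \<noteq> 0 \<and> q ^ Suc j dvd m i} = (+) d ` {..<a q j}"
    proof
      show "{i. m i \<noteq> 0 \<and> q ^ Suc j dvd m i} \<subseteq> (+) d ` {..<a q j}"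
      proof
        fix i assume "i \<in> {i. m i \<noteq> 0 \<and> q ^ Suc j dvd m i}"
        then have "i \<ge> d" "i - d < a q j" using m0[of i] dvd_iff[OF that, of i j] by auto
        then show "i \<in> (+) d ` {..<a q j}" by (intro image_eqI[of _ _ "i - d"]) auto
      qed
      show "(+) d ` {..<a q j} \<subseteq> {i. m i \<noteq> 0 \<and> q ^ Suc j dvd m i}"
      proof
        fix i assume "i \<in> (+) d ` {..<a q j}"
        then have "i \<ge> d" "i - d < a q j" by auto
        then show "i \<in> {i. m i \<noteq> 0 \<and> q ^ Suc j dvd m i}"
          using m0[of i] dvd_iff[OF that, of i j] by simp
      qed
    qed
    then show ?thesis by (simp add: card_image)
  qed
  then have "snd (moduli_code m) = a"
    using codes_nonprime[OF a] by (auto simp: moduli_code_def fun_eq_iff simp del: power_Suc)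
  moreover have "fst (moduli_code m) = d" by (simp add: moduli_code_def m0)
  ultimately show ?thesis using that[OF desc] by (simp add: prod_eq_iff)
qed

lemma has_moduli_finite: "has_moduli G m \<Longrightarrow> finite {i. m i \<noteq> 1}"
  by (auto simp: has_moduli_def moduli_presentation_def moduli_presentation_axioms_def)

lemma has_moduli_counts:
  assumes "has_moduli G m" "prime q"
  shows "tors_count G q j = q ^ snd (moduli_code m) q j"
    and "quot_count G q j = q ^ (snd (moduli_code m) q j + fst (moduli_code m))"
proof -
  obtain \<phi> where "moduli_presentation G \<phi> m" using assms(1) by (auto simp: has_moduli_def)
  then interpret moduli_presentation G \<phi> m .
  show "tors_count G q j = q ^ snd (moduli_code m) q j"
    using tors_count(1)[OF assms(2)] assms(2) by (simp add: moduli_code_def del: power_Suc)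
  show "quot_count G q j = q ^ (snd (moduli_code m) q j + fst (moduli_code m))"
    unfolding quot_count(1)[OF assms(2)] card_moduli_split[OF finite_moduli assms(2)] ..
qed

text \<open>At a prime where both groups have no torsion, the index of powers depends on the free
  rank alone, so the ranks can be compared there.\<close>

lemma codes_prime_vanishing:
  assumes "a \<in> codes" "b \<in> codes"
  obtains q where "prime q" "a q 0 = 0" "b q 0 = 0"
proof -
  have "{q. c q 0 \<noteq> 0} \<subseteq> fst ` {x. c (fst x) (snd x) \<noteq> 0}" for c :: "nat \<Rightarrow> nat \<Rightarrow> nat"
  proof
    show "q \<in> fst ` {x. c (fst x) (snd x) \<noteq> 0}" if "q \<in> {q. c q 0 \<noteq> 0}" for q
      using that by (intro image_eqI[of _ _ "(q, 0)"]) auto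
  qed
  then have "finite {q. c q 0 \<noteq> 0}" if "c \<in> codes" for c
    using codes_finite[OF that] finite_subset by blast
  then have "finite ({q. a q 0 \<noteq> 0} \<union> {q. b q 0 \<noteq> 0})" using assms by blast
  moreover have "infinite {q::nat. prime q}" by (rule primes_infinite)
  ultimately have "\<not> {q::nat. prime q} \<subseteq> {q. a q 0 \<noteq> 0} \<union> {q. b q 0 \<noteq> 0}" using finite_subset by blast
  then show ?thesis using that by blast
qed

lemma preforms_imp_code_le:
  assumes "has_moduli G m" "has_moduli H m'" "G \<leadsto> H"
  shows "code_le (moduli_code m) (moduli_code m')"
proof -
  obtain \<phi> where "moduli_presentation G \<phi> m" using assms(1) by (auto simp: has_moduli_def)
  then interpret G: moduli_presentation G \<phi> m .
  obtain \<psi> where "moduli_presentation H \<psi> m'" using assms(2) by (auto simp: has_moduli_def)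
  then interpret H: moduli_presentation H \<psi> m' .
  let ?a = "snd (moduli_code m)" and ?b = "snd (moduli_code m')"
  let ?d = "fst (moduli_code m)" and ?e = "fst (moduli_code m')"
  have ab: "?a \<in> codes" "?b \<in> codes" using moduli_code_in_codes G.finite_moduli H.finite_moduli by blast+
  have prime: "?b q j \<le> ?a q j" "?a q j + ?d \<le> ?b q j + ?e" if q: "prime q" for q j
  proof -
    have "q ^ ?b q j \<le> q ^ ?a q j"
      using preforms_tors_count_le[OF G.comm_group_axioms H.comm_group_axioms assms(3)
          H.tors_count(2)[OF q] G.tors_count(2)[OF q]]
      unfolding has_moduli_counts(1)[OF assms(1) q] has_moduli_counts(1)[OF assms(2) q] .
    then show "?b q j \<le> ?a q j" using prime_gt_1_nat[OF q] by simp
    have "q ^ (?a q j + ?d) \<le> q ^ (?b q j + ?e)"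
      using preforms_quot_count_le[OF G.comm_group_axioms H.comm_group_axioms assms(3)
          prime_gt_0_nat[OF q] H.quot_count(2)[OF q]]
      unfolding has_moduli_counts(2)[OF assms(1) q] has_moduli_counts(2)[OF assms(2) q] .
    then show "?a q j + ?d \<le> ?b q j + ?e" using prime_gt_1_nat[OF q] by simp
  qed
  obtain q where "prime q" "?a q 0 = 0" "?b q 0 = 0" using codes_prime_vanishing[OF ab] .
  then have de: "?d \<le> ?e" using prime(2)[of q 0] by simp
  have "?b q j \<le> ?a q j \<and> ?a q j + ?d \<le> ?b q j + ?e" for q j
  proof (cases "prime q")
    case False
    then have "?a q j = 0" "?b q j = 0" by (simp_all add: moduli_code_def)
    then show ?thesis using de by simp
  qed (use prime in blast)
  then show ?thesis using de unfolding code_le_def by blast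
qed

lemma has_moduli_code_unique:
  assumes "has_moduli G m" "has_moduli G m'"
  shows "moduli_code m = moduli_code m'"
proof -
  let ?a = "snd (moduli_code m)" and ?b = "snd (moduli_code m')"
  have a: "?a q j = ?b q j" for q j
  proof (cases "prime q")
    case True
    have "q ^ ?a q j = q ^ ?b q j"
      using has_moduli_counts(1)[OF assms(1) True] has_moduli_counts(1)[OF assms(2) True] by metis
    then show ?thesis using prime_gt_1_nat[OF True] by simp
  qed (simp add: moduli_code_def)
  have "2 ^ (?a 2 0 + fst (moduli_code m)) = (2::nat) ^ (?b 2 0 + fst (moduli_code m'))"
    using has_moduli_counts(2)[OF assms(1) two_is_prime_nat] has_moduli_counts(2)[OF assms(2) two_is_prime_nat] by metis
  then have "fst (moduli_code m) = fst (moduli_code m')" using a[of 2 0] by simp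
  then show ?thesis using a by (simp add: prod_eq_iff fun_eq_iff)
qed

lemma desc_moduli_one_iff:
  assumes "desc_moduli m"
  obtains k where "\<And>i. m i = 1 \<longleftrightarrow> i \<ge> k"
proof -
  have "i \<in> {i. m i \<noteq> 1} \<longleftrightarrow> i < card {i. m i \<noteq> 1}" for i
    using assms desc_moduli_antimono[OF assms] unfolding desc_moduli_def
    by (intro down_closed_card) (auto, metis One_nat_def nat_dvd_1_iff_1)
  then have "m i = 1 \<longleftrightarrow> i \<ge> card {i. m i \<noteq> 1}" for i by (metis (mono_tags) mem_Collect_eq not_le)
  then show ?thesis using that by blast
qed

text \<open>Equal ranks are treated apart because the quotient construction assumes
  \<open>r \<ge> 1\<close>; here the same generators agree to every radius.\<close>

lemma preforms_same_moduli:
  assumes "has_moduli G m" "has_moduli H m" "desc_moduli m"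
  shows "G \<leadsto> H"
proof -
  obtain \<phi> where "moduli_presentation G \<phi> m" using assms(1) by (auto simp: has_moduli_def)
  then interpret G: moduli_presentation G \<phi> m .
  obtain \<psi> where "moduli_presentation H \<psi> m" using assms(2) by (auto simp: has_moduli_def)
  then interpret H: moduli_presentation H \<psi> m .
  obtain k where k: "\<And>i. m i = 1 \<longleftrightarrow> i \<ge> k" using desc_moduli_one_iff[OF assms(3)] by blast
  have dvd: "int (m i) dvd ((\<lambda>i. if i < k then x i else 0) - x) i" for x i using k[of i] by (cases "i < k") auto
  have w: "word_map G (\<lambda>i. \<phi> (std_unit i)) k x = \<phi> x" for x
    unfolding G.word_map_of_hom[OF G.vec_hom_axioms] G.vec_eq_iff G.vec_kernel using dvd ..
  have v: "word_map H (\<lambda>i. \<psi> (std_unit i)) k x = \<psi> x" for x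
    unfolding H.word_map_of_hom[OF H.vec_hom_axioms] H.vec_eq_iff H.vec_kernel using dvd ..
  show ?thesis
  proof (rule preformsI[OF G.comm_group_axioms H.comm_group_axioms])
    show "(\<lambda>i. \<psi> (std_unit i)) \<in> {..<k} \<rightarrow> carrier H" by auto
    show "range (word_map H (\<lambda>i. \<psi> (std_unit i)) k) = carrier H" unfolding v using H.vec_surj by simp
    show "inj_on (\<lambda>i. \<psi> (std_unit i)) {..<k}"
    proof (rule inj_onI)
      fix i j assume ij: "i \<in> {..<k}" "j \<in> {..<k}" "\<psi> (std_unit i) = \<psi> (std_unit j)"
      then have "int (m i) dvd (std_unit i - std_unit j) i" unfolding H.vec_eq_iff H.vec_kernel by blast
      then show "i = j" using ij(1) k[of i] by (auto simp: std_unit_def split: if_splits)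
    qed
    have "(\<lambda>i. \<phi> (std_unit i)) \<in> {..<k} \<rightarrow> carrier G" by auto
    then show "\<exists>g. g \<in> {..<k} \<rightarrow> carrier G \<and> range (word_map G g k) = carrier G \<and>
       (\<forall>x. vnorm k x \<le> R \<longrightarrow> (word_map G g k x = \<one>\<^bsub>G\<^esub> \<longleftrightarrow> word_map H (\<lambda>i. \<psi> (std_unit i)) k x = \<one>\<^bsub>H\<^esub>))" for R
      by (intro exI[of _ "\<lambda>i. \<phi> (std_unit i)"]) (simp add: w v G.vec_surj G.vec_kernel H.vec_kernel eta_contract_eq)
  qed
qed

lemma code_le_imp_preforms:
  assumes "has_moduli G m" "has_moduli H m'" and m: "desc_moduli m" and m': "desc_moduli m'"
    and d: "fst (moduli_code m) \<ge> 1" and le: "code_le (moduli_code m) (moduli_code m')"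
  shows "G \<leadsto> H"
proof (cases "fst (moduli_code m) = fst (moduli_code m')")
  case True
  then have "m = m'" using code_le_antisym_fst[OF le] moduli_code_inj[OF m m'] by blast
  then show ?thesis using preforms_same_moduli assms(1,2) m by blast
next
  case False
  obtain \<phi> where \<phi>: "moduli_presentation G \<phi> m" using assms(1) by (auto simp: has_moduli_def)
  obtain \<psi> where \<psi>: "moduli_presentation H \<psi> m'" using assms(2) by (auto simp: has_moduli_def)
  obtain k where k: "\<And>i. m' i = 1 \<longleftrightarrow> i \<ge> k" using desc_moduli_one_iff[OF m'] by blast
  define d where "d = fst (moduli_code m)"
  define r where "r = fst (moduli_code m') - d"
  have de: "fst (moduli_code m) = d" "fst (moduli_code m') = d + r" "r \<ge> 1"
    using le False unfolding code_le_def d_def r_def by auto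
  have le': "snd (moduli_code m') q j \<le> snd (moduli_code m) q j"
    "snd (moduli_code m) q j + d \<le> snd (moduli_code m') q j + (d + r)" for q j
    using le unfolding code_le_def de by blast+
  interpret G: moduli_presentation G \<phi> m by fact
  interpret H: moduli_presentation H \<psi> m' by fact
  interpret approximation G H \<phi> m \<psi> m' d r k
  proof unfold_locales
    show "d \<ge> 1" "r \<ge> 1" using d de by auto
    show "m i = 0 \<longleftrightarrow> i < d" "m' i = 0 \<longleftrightarrow> i < d + r" for i
      using desc_moduli_zero_iff[OF m, of i] desc_moduli_zero_iff[OF m', of i] de by auto
    show "m' i = 1 \<longleftrightarrow> i \<ge> k" for i by (rule k)
    show "m' (i + r) dvd m i" if "i \<ge> d" for i
      using desc_moduli_zero_iff[OF m', of "i + r"] that le'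
      by (intro desc_moduli_shift_dvd[OF m m']) (auto simp: de)
    show "m i dvd m' i" if "i \<ge> d + r" for i
      using desc_moduli_zero_iff[OF m, of i] that le'
      by (intro desc_moduli_shift_dvd[OF m' m]) (auto simp: de)
  qed
  show ?thesis by (rule preforms)
qed

lemma comm_group_of_vec_surj:
  fixes G (structure) and \<phi> :: "(nat \<Rightarrow> int) \<Rightarrow> 'a"
  assumes surj: "range \<phi> = carrier G" and add: "\<And>x y. \<phi> (x + y) = \<phi> x \<otimes> \<phi> y" and zero: "\<phi> 0 = \<one>"
  shows "comm_group G"
proof (rule comm_groupI)
  show "\<exists>y\<in>carrier G. y \<otimes> x = \<one>" if "x \<in> carrier G" for x
  proof -
    obtain v where "x = \<phi> v" using \<open>x \<in> carrier G\<close> surj by auto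
    then have "\<phi> (- v) \<otimes> x = \<one>" using add[of "- v" v] zero by simp
    moreover have "\<phi> (- v) \<in> carrier G" using surj by auto
    ultimately show ?thesis by blast
  qed
qed (auto simp flip: surj zero add simp: ac_simps)

text \<open>Isomorphism classes consist of groups on natural numbers, so every code must be realised
  there.\<close>

lemma has_moduli_realize:
  assumes "finite {i. m i \<noteq> 1}"
  shows "\<exists>G :: nat monoid. has_moduli G m"
proof -
  obtain n where "\<forall>i\<in>{i. m i \<noteq> 1}. i < n" using assms unfolding finite_nat_set_iff_bounded ..
  then have n: "m i = 1 \<or> i < n" for i by blast
  \<comment> \<open>Lists of residues are countable and can be numbered. Residues modulo 0 are the
    integers themselves, which gives the infinite summands.\<close>
  define \<psi> :: "(nat \<Rightarrow> int) \<Rightarrow> nat" where "\<psi> = (\<lambda>x. to_nat (map (\<lambda>i. x i mod int (m i)) [0..<n]))"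
  have eq: "\<psi> x = \<psi> y \<longleftrightarrow> (\<forall>i. int (m i) dvd x i - y i)" for x y
  proof -
    have "\<psi> x = \<psi> y \<longleftrightarrow> (\<forall>i<n. int (m i) dvd x i - y i)"
      by (auto simp: \<psi>_def mod_eq_dvd_iff)
    also have "\<dots> \<longleftrightarrow> (\<forall>i. int (m i) dvd x i - y i)" 
    proof
      assume h: "\<forall>i<n. int (m i) dvd x i - y i"
      show "\<forall>i. int (m i) dvd x i - y i"
      proof
        fix i show "int (m i) dvd x i - y i" using n[of i] h by auto
      qed
    qed blast
    finally show ?thesis .
  qed
  define s where "s = inv_into UNIV \<psi>"
  define G :: "nat monoid" where "G = \<lparr>carrier = range \<psi>, monoid.mult = (\<lambda>a b. \<psi> (s a + s b)), one = \<psi> 0\<rparr>"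
  have s: "\<psi> (s (\<psi> x)) = \<psi> x" for x
    unfolding s_def by (rule f_inv_into_f[of "\<psi> x" \<psi> UNIV]) simp
  have add: "\<psi> (x + y) = \<psi> x \<otimes>\<^bsub>G\<^esub> \<psi> y" for x y
  proof -
    have "int (m i) dvd (s (\<psi> x) i - x i) + (s (\<psi> y) i - y i)" for i
      using s[of x] s[of y] unfolding eq by (intro dvd_add) auto
    then have "\<psi> (s (\<psi> x) + s (\<psi> y)) = \<psi> (x + y)" unfolding eq by (simp add: algebra_simps)
    then show ?thesis by (simp add: G_def)
  qed
  interpret comm_group G
    by (rule comm_group_of_vec_surj[of \<psi>]) (simp_all add: add, simp_all add: G_def)
  have "moduli_presentation G \<psi> m"
  proof unfold_locales
    show "\<psi> (x + y) = \<psi> x \<otimes>\<^bsub>G\<^esub> \<psi> y" for x y by (rule add)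
    show "finite {i. m i \<noteq> 1}" by (rule assms)
    show "\<psi> x = \<one>\<^bsub>G\<^esub> \<longleftrightarrow> (\<forall>i. int (m i) dvd x i)" for x
      using eq[of x 0] by (simp add: G_def)
  qed (simp_all add: G_def)
  then show ?thesis unfolding has_moduli_def by blast
qed

section \<open>From codes to isomorphism classes and prime permutations\<close>

section \<open>The automorphism group\<close>


lemma std_abelian_group_has_moduli:
  "has_moduli (std_abelian_group d k p \<nu>)
     (\<lambda>i. if i < d then 0 else if i < d + k then p (i - d) ^ \<nu> (i - d) else 1)"
    (is "has_moduli ?G ?m")
proof -
  define \<phi> :: "(nat \<Rightarrow> int) \<Rightarrow> (nat \<Rightarrow> int) \<times> (nat \<Rightarrow> int)"
    where "\<phi> = (\<lambda>x. (\<lambda>i\<in>{..<d}. x i, \<lambda>i\<in>{..<k}. x (d + i) mod int (p i ^ \<nu> i)))"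
  have mem: "z = z mod int l" if "z \<in> carrier (integer_mod_group l)" for z l
    using that by (simp add: carrier_integer_mod_group split: if_splits)
  have carrier_mod: "z mod int l \<in> carrier (integer_mod_group l)" for z l
    by (simp add: carrier_integer_mod_group)
  have surj: "range \<phi> = carrier ?G"
  proof
    have "\<phi> x \<in> carrier ?G" for x
      using carrier_mod unfolding \<phi>_def std_abelian_group_def
      by (simp add: integer_group_def restrict_PiE_iff del: of_nat_power)
    then show "range \<phi> \<subseteq> carrier ?G" by blast
    show "carrier ?G \<subseteq> range \<phi>"
    proof
      fix u assume "u \<in> carrier ?G"
      then obtain v w where u: "u = (v, w)" and v: "v \<in> (\<Pi>\<^sub>E i\<in>{..<d}. UNIV)"
        and w: "w \<in> (\<Pi>\<^sub>E i\<in>{..<k}. carrier (integer_mod_group (p i ^ \<nu> i)))"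
        by (auto simp: std_abelian_group_def integer_group_def)
      let ?x = "\<lambda>i. if i < d then v i else w (i - d)"
      have "v = (\<lambda>i\<in>{..<d}. ?x i)" using PiE_arb[OF v] by (auto simp: fun_eq_iff)
      moreover have "w i = (\<lambda>i\<in>{..<k}. ?x (d + i) mod int (p i ^ \<nu> i)) i" for i
        using PiE_arb[OF w, of i] mem[OF PiE_mem[OF w, of i]] by (cases "i < k") auto
      ultimately have "u = \<phi> ?x" unfolding u \<phi>_def by blast
      then show "u \<in> range \<phi>" by blast
    qed
  qed
  have add: "\<phi> (x + y) = \<phi> x \<otimes>\<^bsub>?G\<^esub> \<phi> y" for x y
    by (auto simp: \<phi>_def std_abelian_group_def product_group_def integer_group_def fun_eq_iff mod_add_eq)
  have zero: "\<phi> 0 = \<one>\<^bsub>?G\<^esub>"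
    by (auto simp: \<phi>_def std_abelian_group_def product_group_def integer_group_def fun_eq_iff)
  interpret comm_group ?G by (rule comm_group_of_vec_surj[OF surj add zero])
  have ker: "\<phi> x = \<one>\<^bsub>?G\<^esub> \<longleftrightarrow> (\<forall>i. int (?m i) dvd x i)" for x
  proof -
    have "\<phi> x = \<one>\<^bsub>?G\<^esub> \<longleftrightarrow> (\<forall>i<d. x i = 0) \<and> (\<forall>i<k. int (p i ^ \<nu> i) dvd x (d + i))"
      unfolding zero[symmetric] by (auto simp: \<phi>_def fun_eq_iff restrict_def dvd_eq_mod_eq_0)
    also have "\<dots> \<longleftrightarrow> (\<forall>i. int (?m i) dvd x i)"
    proof
      assume l: "(\<forall>i<d. x i = 0) \<and> (\<forall>i<k. int (p i ^ \<nu> i) dvd x (d + i))"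
      show "\<forall>i. int (?m i) dvd x i"
      proof
        fix i
        consider "i < d" | l where "i = d + l" "l < k" | "d + k \<le> i"
          by (metis add.commute le_Suc_ex less_diff_conv not_le add_diff_cancel_left')
        then show "int (?m i) dvd x i" using l by cases auto
      qed
    next
      assume r: "\<forall>i. int (?m i) dvd x i"
      have "x i = 0" if "i < d" for i using r[rule_format, of i] that by simp
      moreover have "int (p i ^ \<nu> i) dvd x (d + i)" if "i < k" for i
        using r[rule_format, of "d + i"] that by simp
      ultimately show "(\<forall>i<d. x i = 0) \<and> (\<forall>i<k. int (p i ^ \<nu> i) dvd x (d + i))" by blast
    qed
    finally show ?thesis .
  qed
  have "moduli_presentation ?G \<phi> ?m"
  proof unfold_locales
    show "\<phi> x \<in> carrier ?G" for x using surj by auto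
    show "finite {i. ?m i \<noteq> 1}" by (rule finite_subset[of _ "{..<d + k}"]) auto
  qed (fact add surj ker)+
  then show ?thesis unfolding has_moduli_def by blast
qed

definition std_code :: "nat \<Rightarrow> nat \<Rightarrow> (nat \<Rightarrow> nat) \<Rightarrow> (nat \<Rightarrow> nat) \<Rightarrow> nat \<times> (nat \<Rightarrow> nat \<Rightarrow> nat)" where
  "std_code d k p \<nu> = (d, \<lambda>q j. if prime q then card {i. i < k \<and> p i = q \<and> j < \<nu> i} else 0)"

lemma moduli_code_std:
  assumes "\<forall>i<k. prime (p i) \<and> \<nu> i \<ge> 1"
  shows "moduli_code (\<lambda>i. if i < d then 0 else if i < d + k then p (i - d) ^ \<nu> (i - d) else 1) = std_code d k p \<nu>"
    (is "moduli_code ?m = _")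
proof -
  have nz: "p i ^ \<nu> i \<noteq> 0" if "i < k" for i using assms that by (auto dest: prime_gt_0_nat)
  have "?m i = 0 \<longleftrightarrow> i < d" for i using nz[of "i - d"] by auto
  then have "{i. ?m i = 0} = {..<d}" by auto
  then have fst: "fst (moduli_code ?m) = d" by (simp add: moduli_code_def)
  have "card {i. ?m i \<noteq> 0 \<and> q ^ Suc j dvd ?m i} = card {i. i < k \<and> p i = q \<and> j < \<nu> i}" if q: "prime q" for q j
  proof -
    have iff: "q ^ Suc j dvd p i ^ \<nu> i \<longleftrightarrow> p i = q \<and> j < \<nu> i" if "i < k" for i
    proof
      have pi: "prime (p i)" using assms that by blast
      assume d: "q ^ Suc j dvd p i ^ \<nu> i"
      have "q dvd q ^ Suc j" by simp
      then have "q dvd p i ^ \<nu> i" using d dvd_trans by blast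
      then have "q dvd p i" using q prime_dvd_power by blast
      then have eq: "p i = q" using primes_dvd_imp_eq[OF q pi] by simp
      have "Suc j \<le> \<nu> i" using d prime_gt_1_nat[OF q] unfolding eq by (rule power_dvd_imp_le)
      then show "p i = q \<and> j < \<nu> i" using eq by simp
    next
      assume "p i = q \<and> j < \<nu> i"
      then show "q ^ Suc j dvd p i ^ \<nu> i" by (auto intro!: le_imp_power_dvd simp del: power_Suc)
    qed
    have not1: "\<not> q ^ Suc j dvd 1" using prime_gt_1_nat[OF q] by simp
    have "{i. ?m i \<noteq> 0 \<and> q ^ Suc j dvd ?m i} = (+) d ` {i. i < k \<and> p i = q \<and> j < \<nu> i}"
    proof
      show "{i. ?m i \<noteq> 0 \<and> q ^ Suc j dvd ?m i} \<subseteq> (+) d ` {i. i < k \<and> p i = q \<and> j < \<nu> i}"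
      proof
        fix i assume i: "i \<in> {i. ?m i \<noteq> 0 \<and> q ^ Suc j dvd ?m i}"
        then have "d \<le> i \<and> i < d + k" using not1 by (auto simp del: power_Suc split: if_splits)
        moreover from this have "q ^ Suc j dvd p (i - d) ^ \<nu> (i - d)" using i by (simp del: power_Suc)
        ultimately show "i \<in> (+) d ` {i. i < k \<and> p i = q \<and> j < \<nu> i}"
          using iff[of "i - d"] by (intro image_eqI[of _ _ "i - d"]) auto
      qed
      show "(+) d ` {i. i < k \<and> p i = q \<and> j < \<nu> i} \<subseteq> {i. ?m i \<noteq> 0 \<and> q ^ Suc j dvd ?m i}"
      proof
        fix i assume "i \<in> (+) d ` {i. i < k \<and> p i = q \<and> j < \<nu> i}"
        then obtain l where "i = d + l" "l < k" "p l = q \<and> j < \<nu> l" by auto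
        then show "i \<in> {i. ?m i \<noteq> 0 \<and> q ^ Suc j dvd ?m i}"
          using iff[of l] nz[of l] by (simp del: power_Suc)
      qed
    qed
    then show ?thesis by (simp add: card_image)
  qed
  then have "snd (moduli_code ?m) = snd (std_code d k p \<nu>)"
    by (auto simp: moduli_code_def std_code_def fun_eq_iff simp del: power_Suc)
  then show ?thesis using fst by (simp add: prod_eq_iff std_code_def)
qed

definition has_code :: "('a, 'm) monoid_scheme \<Rightarrow> nat \<times> (nat \<Rightarrow> nat \<Rightarrow> nat) \<Rightarrow> bool" where
  "has_code G c \<longleftrightarrow> (\<exists>m. has_moduli G m \<and> desc_moduli m \<and> moduli_code m = c)"

lemma has_code_of_fg:
  assumes "comm_group G" "finitely_generated_group G"
  obtains c where "has_code G c"
proof -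
  obtain m where m: "has_moduli G m" "\<forall>i. m (Suc i) dvd m i" using has_moduli_of_fg[OF assms] by blast
  then have "desc_moduli m" using has_moduli_finite by (auto simp: desc_moduli_def)
  then show ?thesis using that[of "moduli_code m"] m(1) by (auto simp: has_code_def)
qed

text \<open>The moduli need not form a divisibility chain, as for the prime powers of a standard
  group; the code is still right because the counts depend on the group only.\<close>

lemma has_moduli_imp_has_code:
  assumes "has_moduli G m"
  shows "has_code G (moduli_code m)"
proof -
  obtain \<phi> where "moduli_presentation G \<phi> m" using assms by (auto simp: has_moduli_def)
  then interpret moduli_presentation G \<phi> m .
  obtain c where c: "has_code G c" using has_code_of_fg[OF comm_group_axioms finitely_generated] .
  then obtain m' where "has_moduli G m'" "moduli_code m' = c" by (auto simp: has_code_def)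
  then show ?thesis using c has_moduli_code_unique[OF assms] by metis
qed

lemma has_code_unique: "has_code G c \<Longrightarrow> has_code G c' \<Longrightarrow> c = c'"
  using has_moduli_code_unique by (auto simp: has_code_def)

lemma has_code_iso: "has_code G c \<Longrightarrow> G \<cong> H \<Longrightarrow> comm_group H \<Longrightarrow> has_code H c"
  using has_moduli_iso by (auto simp: has_code_def)

lemma has_code_imp_iso: "has_code G c \<Longrightarrow> has_code H c \<Longrightarrow> G \<cong> H"
  using moduli_code_inj has_moduli_imp_iso by (fastforce simp: has_code_def)

lemma has_code_in_codes: "has_code G c \<Longrightarrow> snd c \<in> codes"
  using moduli_code_in_codes by (auto simp: has_code_def desc_moduli_def)

lemma has_code_infinite_iff:
  assumes "has_code G c"
  shows "infinite (carrier G) \<longleftrightarrow> fst c \<ge> 1"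
proof -
  obtain m where m: "has_moduli G m" "desc_moduli m" "moduli_code m = c" using assms by (auto simp: has_code_def)
  obtain \<phi> where "moduli_presentation G \<phi> m" using m(1) by (auto simp: has_moduli_def)
  then interpret moduli_presentation G \<phi> m .
  show ?thesis using infinite_iff desc_moduli_zero_iff[OF m(2)] m(3)
    by (metis One_nat_def Suc_le_eq gr0I not_less_zero)
qed

lemma has_code_preforms_iff:
  assumes "has_code G c" "has_code H c'" "fst c \<ge> 1"
  shows "G \<leadsto> H \<longleftrightarrow> code_le c c'"
  using assms preforms_imp_code_le code_le_imp_preforms unfolding has_code_def by blast

lemma has_code_inf_fg_abelian:
  assumes "has_code (G :: nat monoid) c"
  shows "G \<in> inf_fg_abelian \<longleftrightarrow> fst c \<ge> 1"
proof -
  obtain m \<phi> where "moduli_presentation G \<phi> m" using assms by (auto simp: has_code_def has_moduli_def)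
  then interpret moduli_presentation G \<phi> m .
  show ?thesis
    using has_code_infinite_iff[OF assms] finitely_generated comm_group_axioms by (auto simp: inf_fg_abelian_def)
qed

definition code_class :: "nat \<times> (nat \<Rightarrow> nat \<Rightarrow> nat) \<Rightarrow> nat monoid set" where
  "code_class c = {H \<in> inf_fg_abelian. has_code H c}"

lemma inf_fg_abelian_code:
  assumes "G \<in> inf_fg_abelian"
  obtains c where "c \<in> ranked_codes" "has_code G c"
proof -
  obtain c where c: "has_code G c"
    using has_code_of_fg[of G] assms by (auto simp: inf_fg_abelian_def)
  then have "c \<in> ranked_codes"
    using has_code_inf_fg_abelian[OF c] has_code_in_codes[OF c] assms
    by (auto simp: ranked_codes_def mem_Times_iff)
  then show ?thesis using that c by blast
qed

lemma ranked_code_group: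
  assumes "c \<in> ranked_codes"
  obtains G where "G \<in> code_class c"
proof -
  have a: "snd c \<in> codes" "fst c \<ge> 1" using assms by (auto simp: ranked_codes_def)
  obtain m where m: "desc_moduli m" "moduli_code m = (fst c, snd c)" using moduli_code_surj[OF a(1)] .
  have "finite {i. m i \<noteq> 1}" using m(1) by (simp add: desc_moduli_def)
  then obtain G :: "nat monoid" where "has_moduli G m" using has_moduli_realize by blast
  then have "has_code G c" using m by (auto simp: has_code_def)
  then show ?thesis using that[of G] has_code_inf_fg_abelian[of G c] a(2) by (simp add: code_class_def)
qed

lemma iso_class_eq_code_class: "has_code G c \<Longrightarrow> iso_class G = code_class c"
  using has_code_iso[of G c] has_code_imp_iso[of G c]
  by (auto simp: iso_class_def code_class_def inf_fg_abelian_def)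

lemma iso_classes_eq: "iso_classes = code_class ` ranked_codes"
proof -
  have cl: "{(G, H). G \<in> inf_fg_abelian \<and> H \<in> inf_fg_abelian \<and> G \<cong> H} `` {G} = code_class c"
    if "G \<in> inf_fg_abelian" "has_code G c" for G c
    using iso_class_eq_code_class[OF that(2)] that(1) by (auto simp: iso_class_def)
  show ?thesis
  proof
    show "iso_classes \<subseteq> code_class ` ranked_codes"
    proof
      fix C assume "C \<in> iso_classes"
      then obtain G where G: "G \<in> inf_fg_abelian"
        "C = {(G, H). G \<in> inf_fg_abelian \<and> H \<in> inf_fg_abelian \<and> G \<cong> H} `` {G}"
        unfolding iso_classes_def by (rule quotientE)
      obtain c where "c \<in> ranked_codes" "has_code G c" using inf_fg_abelian_code[OF G(1)] .
      then show "C \<in> code_class ` ranked_codes" using cl[OF G(1)] G(2) by blast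
    qed
    show "code_class ` ranked_codes \<subseteq> iso_classes"
    proof
      fix C assume "C \<in> code_class ` ranked_codes"
      then obtain c where c: "c \<in> ranked_codes" "C = code_class c" by blast
      obtain G where "G \<in> code_class c" using ranked_code_group[OF c(1)] .
      then have G: "G \<in> inf_fg_abelian" "has_code G c" by (auto simp: code_class_def)
      show "C \<in> iso_classes"
        unfolding iso_classes_def c(2) cl[OF G, symmetric] by (rule quotientI[OF G(1)])
    qed
  qed
qed

lemma inj_on_code_class: "inj_on code_class ranked_codes"
proof (rule inj_onI)
  fix c c' assume c: "c \<in> ranked_codes" and eq: "code_class c = code_class c'"
  obtain G where "G \<in> code_class c" using ranked_code_group[OF c] .
  then have "has_code G c" "has_code G c'" using eq by (auto simp: code_class_def)
  then show "c = c'" by (rule has_code_unique)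
qed

lemma preforms_class_iff:
  assumes c: "c \<in> ranked_codes" and c': "c' \<in> ranked_codes"
  shows "preforms_class (code_class c) (code_class c') \<longleftrightarrow> code_le c c'"
proof -
  have "fst c \<ge> 1" using c by (auto simp: ranked_codes_def)
  then have "G \<leadsto> H \<longleftrightarrow> code_le c c'" if "G \<in> code_class c" "H \<in> code_class c'" for G H
    using that has_code_preforms_iff[of G c H c'] by (simp add: code_class_def)
  moreover obtain G where "G \<in> code_class c" using ranked_code_group[OF c] .
  moreover obtain H where "H \<in> code_class c'" using ranked_code_group[OF c'] .
  ultimately show ?thesis unfolding preforms_class_def by blast
qed

text \<open>The torsion at \<open>p\<close> has to move to \<open>\<sigma> p\<close>, so the code is
  read at the inverse image of each prime.\<close>

definition class_perm :: "(nat \<Rightarrow> nat) \<Rightarrow> nat monoid set \<Rightarrow> nat monoid set" where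
  "class_perm \<sigma> = (\<lambda>C\<in>iso_classes.
     code_class (code_perm (inv_into {p. prime p} \<sigma>) (inv_into ranked_codes code_class C)))"

lemma class_perm_code_class:
  assumes "c \<in> ranked_codes"
  shows "class_perm \<sigma> (code_class c) = code_class (code_perm (inv_into {p. prime p} \<sigma>) c)"
  using assms inv_into_f_f[OF inj_on_code_class assms]
  by (simp add: class_perm_def iso_classes_eq)

lemma Bij_primes_inv:
  assumes "\<sigma> \<in> Bij {p::nat. prime p}"
  shows "bij_betw (inv_into {p. prime p} \<sigma>) {p. prime p} {p. prime p}"
  using assms by (auto simp: Bij_def intro: bij_betw_inv_into)

lemma class_perm_closed:
  assumes \<sigma>: "\<sigma> \<in> Bij {p. prime p}"
  shows "class_perm \<sigma> \<in> carrier (order_aut_group iso_classes preforms_class)"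
proof -
  let ?r = "inv_into {p. prime p} \<sigma>"
  note r = Bij_primes_inv[OF \<sigma>]
  have "bij_betw code_class ranked_codes iso_classes"
    using inj_on_code_class by (simp add: bij_betw_def iso_classes_eq)
  then have "bij_betw (code_class \<circ> (code_perm ?r \<circ> inv_into ranked_codes code_class)) iso_classes iso_classes"
    using bij_code_perm[OF r] by (intro bij_betw_trans) (auto intro: bij_betw_inv_into)
  then have "bij_betw (class_perm \<sigma>) iso_classes iso_classes"
    by (rule bij_betw_cong[THEN iffD1, rotated]) (simp add: class_perm_def)
  then have "class_perm \<sigma> \<in> Bij iso_classes" by (simp add: Bij_def class_perm_def)
  moreover have "preforms_class C D \<longleftrightarrow> preforms_class (class_perm \<sigma> C) (class_perm \<sigma> D)"
    if CD: "C \<in> iso_classes" "D \<in> iso_classes" for C D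
  proof -
    obtain c c' where c: "c \<in> ranked_codes" "c' \<in> ranked_codes" "C = code_class c" "D = code_class c'"
      using CD by (auto simp: iso_classes_eq)
    then show ?thesis
      by (simp add: class_perm_code_class preforms_class_iff code_perm_in[OF r] code_perm_le_iff[OF r])
  qed
  ultimately show ?thesis by (simp add: order_aut_group_def)
qed

text \<open>Precomposition and inversion each reverse the order of factors, and the two reversals
  cancel.\<close>

lemma class_perm_compose:
  assumes \<sigma>: "\<sigma> \<in> Bij {p. prime p}" and \<tau>: "\<tau> \<in> Bij {p. prime p}"
  shows "class_perm (compose {p. prime p} \<sigma> \<tau>) = compose iso_classes (class_perm \<sigma>) (class_perm \<tau>)"
proof
  let ?P = "{p :: nat. prime p}"
  fix C
  show "class_perm (compose ?P \<sigma> \<tau>) C = compose iso_classes (class_perm \<sigma>) (class_perm \<tau>) C"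
  proof (cases "C \<in> iso_classes")
    case True
    then obtain c where c: "c \<in> ranked_codes" "C = code_class c" by (auto simp: iso_classes_eq)
    have b: "bij_betw \<sigma> ?P ?P" "bij_betw \<tau> ?P ?P" using \<sigma> \<tau> by (auto simp: Bij_def)
    have inv: "inv_into ?P (compose ?P \<sigma> \<tau>) q = inv_into ?P \<tau> (inv_into ?P \<sigma> q)" if "prime q" for q
    proof (rule inv_into_f_eq)
      show "inj_on (compose ?P \<sigma> \<tau>) ?P" using bij_betw_compose[OF b(2,1)] by (simp add: bij_betw_def)
      have "inv_into ?P \<sigma> q \<in> ?P" using bij_betwE[OF Bij_primes_inv[OF \<sigma>]] that by blast
      moreover from this show "inv_into ?P \<tau> (inv_into ?P \<sigma> q) \<in> ?P"
        using bij_betwE[OF Bij_primes_inv[OF \<tau>]] by blast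
      ultimately show "compose ?P \<sigma> \<tau> (inv_into ?P \<tau> (inv_into ?P \<sigma> q)) = q"
        using bij_betw_inv_into_right[OF b(1), of q] bij_betw_inv_into_right[OF b(2)] that
        by (simp add: compose_def)
    qed
    have prime_inv: "prime (inv_into ?P \<sigma> q)" if "prime q" for q
      using bij_betwE[OF Bij_primes_inv[OF \<sigma>]] that by blast
    have "code_perm (inv_into ?P \<sigma>) (code_perm (inv_into ?P \<tau>) c) =
        code_perm (inv_into ?P \<tau> \<circ> inv_into ?P \<sigma>) c"
      by (rule code_perm_comp) (rule prime_inv)
    also have "\<dots> = code_perm (inv_into ?P (compose ?P \<sigma> \<tau>)) c"
      by (rule code_perm_cong) (simp add: inv)
    finally have "code_perm (inv_into ?P (compose ?P \<sigma> \<tau>)) c =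
        code_perm (inv_into ?P \<sigma>) (code_perm (inv_into ?P \<tau>) c)" by simp
    then show ?thesis
      using True c code_perm_in[OF Bij_primes_inv[OF \<tau>]]
      by (simp add: compose_def class_perm_code_class)
  qed (simp add: class_perm_def compose_def)
qed

lemma class_perm_surj:
  assumes F: "F \<in> carrier (order_aut_group iso_classes preforms_class)"
  obtains \<sigma> where "\<sigma> \<in> Bij {p. prime p}" "class_perm \<sigma> = F"
proof -
  let ?P = "{p :: nat. prime p}" and ?k = "inv_into ranked_codes code_class"
  have ext: "F \<in> extensional iso_classes" and bij: "bij_betw F iso_classes iso_classes"
    and le: "\<And>C D. C \<in> iso_classes \<Longrightarrow> D \<in> iso_classes \<Longrightarrow> preforms_class C D \<longleftrightarrow> preforms_class (F C) (F D)"
    using F by (auto simp: order_aut_group_def Bij_def)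
  have cc: "bij_betw code_class ranked_codes iso_classes"
    using inj_on_code_class by (simp add: bij_betw_def iso_classes_eq)
  \<comment> \<open>Transport of \<open>F\<close> to codes; the permutation sought is the inverse of
    the one found there, restricted to the primes to be extensional.\<close>
  define f where "f = ?k \<circ> (F \<circ> code_class)"
  have bf: "bij_betw f ranked_codes ranked_codes"
    unfolding f_def by (intro bij_betw_trans[OF bij_betw_trans[OF cc bij]] bij_betw_inv_into cc)
  have cf: "code_class (f c) = F (code_class c)" if "c \<in> ranked_codes" for c
    using bij_betw_inv_into_right[OF cc, of "F (code_class c)"] that bij cc
    by (auto simp: f_def bij_betw_def)
  have f_in: "f c \<in> ranked_codes" if "c \<in> ranked_codes" for c
    using bf that by (auto simp: bij_betw_def)
  interpret code_automorphism f
  proof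
    fix x y assume xy: "x \<in> ranked_codes" "y \<in> ranked_codes"
    then have "code_class x \<in> iso_classes" "code_class y \<in> iso_classes" by (simp_all add: iso_classes_eq)
    from le[OF this] show "code_le (f x) (f y) \<longleftrightarrow> code_le x y"
      using xy f_in by (simp add: preforms_class_iff flip: cf)
  qed (rule bf)
  obtain \<tau> where \<tau>: "bij_betw \<tau> ?P ?P" and f: "\<And>x. x \<in> ranked_codes \<Longrightarrow> f x = code_perm \<tau> x"
    using eq_code_perm by blast
  let ?s = "restrict (inv_into ?P \<tau>) ?P"
  have s: "?s \<in> Bij ?P" using bij_betw_inv_into[OF \<tau>] by (simp add: Bij_def)
  have inv: "inv_into ?P ?s q = \<tau> q" if q: "prime q" for q
  proof (rule inv_into_f_eq)
    show "inj_on ?s ?P" using s by (simp add: Bij_def bij_betw_def)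
    show "\<tau> q \<in> ?P" using \<tau> q by (auto simp: bij_betw_def)
    then show "?s (\<tau> q) = q" using bij_betw_inv_into_left[OF \<tau>] q by simp
  qed
  have "class_perm ?s C = F C" for C
  proof (cases "C \<in> iso_classes")
    case True
    then obtain c where c: "c \<in> ranked_codes" "C = code_class c" by (auto simp: iso_classes_eq)
    have "code_perm (inv_into ?P ?s) c = f c" unfolding f[OF c(1)] by (rule code_perm_cong) (rule inv)
    then show ?thesis using class_perm_code_class[OF c(1), of ?s] cf[OF c(1)] c(2) by simp
  next
    case False
    then show ?thesis using ext by (simp add: class_perm_def extensional_def)
  qed
  then show ?thesis using that[OF s] by blast
qed

lemma class_perm_inj: "inj_on class_perm (Bij {p. prime p})"
proof (rule inj_onI)
  let ?P = "{p :: nat. prime p}"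
  fix \<sigma> \<tau> assume \<sigma>: "\<sigma> \<in> Bij ?P" and \<tau>: "\<tau> \<in> Bij ?P" and eq: "class_perm \<sigma> = class_perm \<tau>"
  have b: "bij_betw \<sigma> ?P ?P" "bij_betw \<tau> ?P ?P" using \<sigma> \<tau> by (auto simp: Bij_def)
  show "\<sigma> = \<tau>"
  proof (rule extensionalityI[of _ ?P])
    fix p assume p: "p \<in> ?P"
    \<comment> \<open>The group Z + Z/p detects the image of \<open>p\<close>: after the action its
      code is supported at that prime.\<close>
    let ?c = "(1, code_delta p)"
    have c: "?c \<in> ranked_codes" using p code_delta_in_codes by (simp add: ranked_codes_def)
    have "code_class (code_perm (inv_into ?P \<sigma>) ?c) = code_class (code_perm (inv_into ?P \<tau>) ?c)"
      using eq class_perm_code_class[OF c] by metis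
    then have "code_perm (inv_into ?P \<sigma>) ?c = code_perm (inv_into ?P \<tau>) ?c"
      using inj_onD[OF inj_on_code_class] code_perm_in[OF Bij_primes_inv c] \<sigma> \<tau> by blast
    then have "snd (code_perm (inv_into ?P \<sigma>) ?c) (\<sigma> p) 0 = snd (code_perm (inv_into ?P \<tau>) ?c) (\<sigma> p) 0"
      by simp
    moreover have sp: "prime (\<sigma> p)" using b(1) p by (auto simp: bij_betw_def)
    moreover have "inv_into ?P \<sigma> (\<sigma> p) = p" using bij_betw_inv_into_left[OF b(1) p] .
    ultimately have "inv_into ?P \<tau> (\<sigma> p) = p"
      by (simp add: code_perm_def code_delta_def split: if_splits)
    then show "\<sigma> p = \<tau> p" using bij_betw_inv_into_right[OF b(2), of "\<sigma> p"] sp by simp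
  qed (use \<sigma> \<tau> in \<open>auto simp: Bij_def\<close>)
qed

lemma class_perm_std:
  assumes \<sigma>: "\<sigma> \<in> Bij {p. prime p}" and d: "d \<ge> 1" and p: "\<forall>i<k. prime (p i) \<and> \<nu> i \<ge> 1"
  shows "class_perm \<sigma> (iso_class (std_abelian_group d k p \<nu>)) =
    iso_class (std_abelian_group d k (\<lambda>i. \<sigma> (p i)) \<nu>)"
proof -
  let ?P = "{p :: nat. prime p}"
  have b: "bij_betw \<sigma> ?P ?P" using \<sigma> by (auto simp: Bij_def)
  have code: "has_code (std_abelian_group d k p \<nu>) (std_code d k p \<nu>)"
    if "\<forall>i<k. prime (p i) \<and> \<nu> i \<ge> 1" for p
    using has_moduli_imp_has_code[OF std_abelian_group_has_moduli] moduli_code_std[OF that] by metis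
  have \<sigma>p: "\<forall>i<k. prime (\<sigma> (p i)) \<and> \<nu> i \<ge> 1" using p b by (auto simp: bij_betw_def)
  have c: "std_code d k p \<nu> \<in> ranked_codes"
    using has_code_in_codes[OF code[OF p]] d by (auto simp: ranked_codes_def mem_Times_iff std_code_def)
  have "\<sigma> (p i) = q \<longleftrightarrow> p i = inv_into ?P \<sigma> q" if "prime q" "i < k" for i q
    using bij_betw_inv_into_left[OF b, of "p i"] bij_betw_inv_into_right[OF b, of q] p that by auto
  then have "{i. i < k \<and> p i = inv_into ?P \<sigma> q \<and> j < \<nu> i} = {i. i < k \<and> \<sigma> (p i) = q \<and> j < \<nu> i}"
    if "prime q" for q j using that by auto
  moreover have "prime (inv_into ?P \<sigma> q)" if "prime q" for q
    using bij_betwE[OF Bij_primes_inv[OF \<sigma>]] that by blast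
  ultimately have "code_perm (inv_into ?P \<sigma>) (std_code d k p \<nu>) = std_code d k (\<lambda>i. \<sigma> (p i)) \<nu>"
    by (auto simp: code_perm_def std_code_def fun_eq_iff)
  then show ?thesis
    using class_perm_code_class[OF c, of \<sigma>] iso_class_eq_code_class[OF code[OF p]]
      iso_class_eq_code_class[OF code[OF \<sigma>p]] by simp
qed

theorem proposition3p7:
  shows "\<exists>\<Phi> \<in> iso (BijGroup {p::nat. prime p}) (order_aut_group iso_classes preforms_class).
           \<forall>\<sigma> \<in> Bij {p::nat. prime p}.
           \<forall>(d::nat) (k::nat) (p :: nat \<Rightarrow> nat) (\<nu> :: nat \<Rightarrow> nat).
             d \<ge> 1 \<longrightarrow> (\<forall>i<k. prime (p i) \<and> \<nu> i \<ge> 1) \<longrightarrow>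
             \<Phi> \<sigma> (iso_class (std_abelian_group d k p \<nu>)) =
               iso_class (std_abelian_group d k (\<lambda>i. \<sigma> (p i)) \<nu>)"
proof (rule bexI[of _ class_perm])
  let ?P = "{p :: nat. prime p}" and ?A = "order_aut_group iso_classes preforms_class"
  have mult: "class_perm (\<sigma> \<otimes>\<^bsub>BijGroup ?P\<^esub> \<tau>) = class_perm \<sigma> \<otimes>\<^bsub>?A\<^esub> class_perm \<tau>"
    if "\<sigma> \<in> Bij ?P" "\<tau> \<in> Bij ?P" for \<sigma> \<tau>
    using class_perm_compose[OF that] class_perm_closed[OF that(1)] class_perm_closed[OF that(2)] that
    by (simp add: BijGroup_def order_aut_group_def)
  have "class_perm ` Bij ?P = carrier ?A"
    using class_perm_closed class_perm_surj by blast
  then show "class_perm \<in> iso (BijGroup ?P) ?A"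
    using class_perm_inj class_perm_closed mult
    by (auto simp: iso_def hom_def bij_betw_def BijGroup_def)
qed (use class_perm_std in blast)

end
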